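(* Let $\Omega\subset\mathbb{R}^n$ be a bounded John domain, $1<p<\infty$, $0<s<1$, and let $0<\tau_1<\frac1{36\sqrt n}$ and $\frac35\le\tau_2<1$. If $\beta\in\mathbb{R}$ satisfies $$\beta+1-s>-(n-\dim_A(\partial\Omega))/p,$$ then there exists a constant $C$ such that $$\inf_{{\bf r}\in RM}|{\bf u}-{\bf r}|_{W^{s,p}_{\tau_1}(\Omega,d^{p\beta})^n}\le C\,|{\bf u}|_{X^{s,p}_{\tau_2}(\Omega,d^{p\beta})^n}$$ for every vector field ${\bf u}\in W^{s,p}_{\tau_2}(\Omega,d^{p\beta})^n$.
   Context: A bounded domain $D\subset\mathbb{R}^n$ is a John domain if there are $C\ge1$ and $x_0\in D$ such that every $x\in D$ can be joined to $x_0$ by a rectifiable curve $\gamma:[0,\ell]\to D$ parametrized by arc length with $\gamma(0)=x$, $\gamma(\ell)=x_0$ and $d(\gamma(t),\partial D)\ge t/C$. $RM=\{{\bf r}(x)=Ax+b: A\in\mathbb{R}^{n\times n}\text{ skew-symmetric}, b\in\mathbb{R}^n\}$. The Assouad dimension $\dim_A(E)$ of $E\subset\mathbb{R}^n$ is the infimum of $\lambda\ge0$ for which there is $C>0$ with $\sup_{x\in E}N_r(B_R(x)\cap E)\le C(R/r)^\lambda$ for all $0<r<R$, where $N_r(F)$ is the least number of open balls of radius $r$ covering $F$. Let $\delta(x)=\mathrm{dist}(x,\partial\Omega)$ and $d(x,y)=\min\{\delta(x),\delta(y)\}$. For $\tau\in(0,1)$ and $\alpha\in\mathbb{R}$: $|{\bf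 u}|_{W^{s,p}_\tau(\Omega,d^\alpha)^n}=\left(\int_\Omega\int_{B(x,\tau\delta(x))}\frac{|{\bf u}(y)-{\bf u}(x)|^p}{|y-x|^{n+sp}}d(x,y)^\alpha\,dy\,dx\right)^{1/p}$, $|{\bf u}|_{X^{s,p}_\tau(\Omega,d^\alpha)^n}=\left(\int_\Omega\int_{B(x,\tau\delta(x))}\frac{|({\bf u}(y)-{\bf u}(x))\cdot(y-x)|^p}{|y-x|^{n+sp+p}}d(x,y)^\alpha\,dy\,dx\right)^{1/p}$, and $W^{s,p}_\tau(\Omega,d^\alpha)^n$ is the space of vector fields on $\Omega$ for which $|{\bf u}|_{W^{s,p}_\tau(\Omega,d^\alpha)^n}<\infty$. *)

theory Defs
  imports "HOL-Analysis.Analysis"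
begin

definition curve_length :: "(real \<Rightarrow> 'a::metric_space) \<Rightarrow> real \<Rightarrow> real \<Rightarrow> ereal" where
  "curve_length \<gamma> a b =
     (SUP ts \<in> {ts. ts \<noteq> [] \<and> hd ts = a \<and> last ts = b \<and> sorted ts}.
        ereal (\<Sum>i < length ts - 1. dist (\<gamma> (ts ! Suc i)) (\<gamma> (ts ! i))))"

definition arc_length_param :: "(real \<Rightarrow> 'a::metric_space) \<Rightarrow> real \<Rightarrow> bool" where
  "arc_length_param \<gamma> l \<longleftrightarrow> 0 \<le> l \<and> continuous_on {0..l} \<gamma> \<and>
     (\<forall>a b. 0 \<le> a \<longrightarrow> a \<le> b \<longrightarrow> b \<le> l \<longrightarrow> curve_length \<gamma> a b = ereal (b - a))"

definition john_domain :: "'a::euclidean_space set \<Rightarrow> bool" where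
  "john_domain D \<longleftrightarrow> open D \<and> connected D \<and> bounded D \<and>
     (\<exists>C \<ge> 1. \<exists>x0 \<in> D. \<forall>x \<in> D. \<exists>\<gamma> l. arc_length_param \<gamma> l \<and> \<gamma> ` {0..l} \<subseteq> D \<and>
        \<gamma> 0 = x \<and> \<gamma> l = x0 \<and> (\<forall>t \<in> {0..l}. infdist (\<gamma> t) (frontier D) \<ge> t / C))"

definition RM :: "(real^'n \<Rightarrow> real^'n) set" where
  "RM = {(\<lambda>x. A *v x + b) | A b. transpose A = - A}"

definition cover_number :: "real \<Rightarrow> 'a::metric_space set \<Rightarrow> nat" where
  "cover_number r F = (LEAST k. \<exists>S. finite S \<and> card S = k \<and> F \<subseteq> (\<Union>c\<in>S. ball c r))"

definition assouad_dim :: "'a::metric_space set \<Rightarrow> real" where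
  "assouad_dim E = Inf {lam. lam \<ge> 0 \<and> (\<exists>C>0. \<forall>r R. 0 < r \<longrightarrow> r < R \<longrightarrow>
        (\<forall>x\<in>E. real (cover_number r (ball x R \<inter> E)) \<le> C * (R / r) powr lam))}"

definition bdist :: "'a::metric_space set \<Rightarrow> 'a \<Rightarrow> real" where
  "bdist \<Omega> x = infdist x (frontier \<Omega>)"

definition dmin :: "'a::metric_space set \<Rightarrow> 'a \<Rightarrow> 'a \<Rightarrow> real" where
  "dmin \<Omega> x y = min (bdist \<Omega> x) (bdist \<Omega> y)"

definition W_int :: "real \<Rightarrow> real \<Rightarrow> real \<Rightarrow> real \<Rightarrow> (real^'n) set \<Rightarrow> (real^'n \<Rightarrow> real^'n) \<Rightarrow> ennreal" where
  "W_int s p \<tau> \<alpha> \<Omega> u =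
     (\<integral>\<^sup>+ x \<in> \<Omega>. (\<integral>\<^sup>+ y \<in> ball x (\<tau> * bdist \<Omega> x).
        ennreal (norm (u y - u x) powr p / norm (y - x) powr (real CARD('n) + s * p)
                 * dmin \<Omega> x y powr \<alpha>) \<partial>lebesgue) \<partial>lebesgue)"

definition X_int :: "real \<Rightarrow> real \<Rightarrow> real \<Rightarrow> real \<Rightarrow> (real^'n) set \<Rightarrow> (real^'n \<Rightarrow> real^'n) \<Rightarrow> ennreal" where
  "X_int s p \<tau> \<alpha> \<Omega> u =
     (\<integral>\<^sup>+ x \<in> \<Omega>. (\<integral>\<^sup>+ y \<in> ball x (\<tau> * bdist \<Omega> x).
        ennreal (\<bar>(u y - u x) \<bullet> (y - x)\<bar> powr p / norm (y - x) powr (real CARD('n) + s * p + p)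
                 * dmin \<Omega> x y powr \<alpha>) \<partial>lebesgue) \<partial>lebesgue)"

definition enn_root :: "real \<Rightarrow> ennreal \<Rightarrow> ennreal" where
  "enn_root p I = (if I = \<infinity> then \<infinity> else ennreal (enn2real I powr (1 / p)))"

definition W_seminorm where
  "W_seminorm s p \<tau> \<alpha> \<Omega> u = enn_root p (W_int s p \<tau> \<alpha> \<Omega> u)"

definition X_seminorm where
  "X_seminorm s p \<tau> \<alpha> \<Omega> u = enn_root p (X_int s p \<tau> \<alpha> \<Omega> u)"

definition W_space :: "real \<Rightarrow> real \<Rightarrow> real \<Rightarrow> real \<Rightarrow> (real^'n) set \<Rightarrow> (real^'n \<Rightarrow> real^'n) set" where
  "W_space s p \<tau> \<alpha> \<Omega> = {u. u \<in> borel_measurable (lebesgue_on \<Omega>) \<and> W_seminorm s p \<tau> \<alpha> \<Omega> u < \<infinity>}"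

end

theory Submission
  imports Defs
begin

text \<open>
  Write e(y, x) = (u(y) - u(x)) . (y - x). On a ball there is a bounded vector kernel \<phi> with mean zero
  and \<open>\<integral> (x . v) \<phi>(x) dx = v\<close>. Integrating e(y, x) \<phi>(x) in x expresses u(y) as an affine map of y plus an
  error controlled by \<open>\<integral> |e(y, x)| dx\<close>, and the linear part is skew up to the same kind of error:
  this is a local Korn inequality with explicit averaged gradients and no compactness argument.
  Comparing averaged gradients on the concentric balls of radius \<open>2\<^sup>-\<^sup>k \<delta>(x) / 20\<close> and summing (here s < 1 is used)
  bounds the W-energy of u near x by the X-energy and by the deviation of the gradient at scale \<open>\<delta>(x)\<close>
  from a fixed skew matrix. That deviation is estimated along the John curve, on whose points
  at geometrically spaced arc lengths \<open>\<delta>\<close> is comparable to the elapsed length plus \<open>\<delta>(x)\<close>; giving away a factor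
  \<open>\<delta>(x)\<^sup>-\<^sup>\<epsilon>\<close> makes the chain summable. Fubini then reduces the claim to
  \<open>\<integral> \<delta>\<^sup>q \<le> C M\<^sup>n\<^sup>+\<^sup>q\<close> over balls of radius M with n + q above the Assouad dimension of the boundary.
\<close>

text \<open>The chain is the obstacle: bounding the p-th power of a sum of links costs a factor
  growing with their number, which is unbounded near the boundary. The strict inequality in the
  hypothesis pays for it. Half of its slack, times p, is the exponent \<epsilon>; weights along the
  chain may then grow like arc length to the power \<epsilon>, and the power of \<delta> that
  remains, q = p \<beta> + (1 - s) p - \<epsilon>, still has n + q above the dimension. After Fubini
  the exponents add up to p \<beta> - n - p - s p, the weight of the X-energy at scale \<delta>. The
  radii come from what must fit into what: gradients live on balls of radius \<delta>/20, neighbours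
  are compared inside \<delta>/10, and for y in such a ball around z the whole ball lies in the ball
  of radius 2/5 \<delta>(y) around y. This last inclusion turns every chain-dependent quantity into
  a function of y alone. So the left side asks for \<tau>1 at most 1/20 and the right side for
  \<tau>2 at least 2/5. Finiteness of the W-energy provides the local integrability of u that
  averaged gradients presuppose.\<close>

section \<open>Elementary inequalities and the moment kernel\<close>

text \<open>Lets the measurability prover handle balls whose centre and radius depend on the
  integration variable, as in the nested integrals below.\<close>

lemma pred_mem_ball [measurable (raw)]:
  fixes f g :: "'b \<Rightarrow> 'a::euclidean_space"
  assumes [measurable]: "f \<in> borel_measurable M" "g \<in> borel_measurable M" "h \<in> borel_measurable M"
  shows "Measurable.pred M (\<lambda>x. f x \<in> ball (g x) (h x))"
  unfolding mem_ball by measurable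

text \<open>The point is that \<mu> may be as close to 1 as desired, at the price of a large
  \<open>C\<close>: in a recursion over scales or chain links the factor \<mu> is then beaten by
  geometric decay or absorbed in a small power. With (1 + k)^p = \<mu>, either b <= k a and the
  first term suffices, or a < b / k and the second does.\<close>

lemma powr_add_le_weighted:
  fixes p \<mu> :: real
  assumes "1 < p" "1 < \<mu>"
  obtains C where "0 < C" "\<And>a b. 0 \<le> a \<Longrightarrow> 0 \<le> b \<Longrightarrow> (a + b) powr p \<le> \<mu> * a powr p + C * b powr p"
proof -
  define k where "k = \<mu> powr (1/p) - 1"
  have k: "k > 0" using assms by (simp add: k_def)
  have k1: "(1 + k) powr p = \<mu>" using assms by (simp add: k_def powr_powr)
  show thesis
  proof (rule that[of "(1 + 1/k) powr p"])
    have "0 < 1 + 1/k" using k by (simp add: add_pos_pos)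
    then show "0 < (1 + 1/k) powr p" by simp
    fix a b :: real assume ab: "0 \<le> a" "0 \<le> b"
    show "(a + b) powr p \<le> \<mu> * a powr p + (1 + 1/k) powr p * b powr p"
    proof (cases "b \<le> k * a")
      case True
      then have "a + b \<le> (1 + k) * a" by (simp add: algebra_simps)
      then have "(a + b) powr p \<le> ((1 + k) * a) powr p" using ab assms by (intro powr_mono2) auto
      also have "\<dots> = \<mu> * a powr p" using k ab k1 by (simp add: powr_mult)
      finally show ?thesis by (simp add: add_increasing2)
    next
      case False
      then have "a \<le> b / k" using k by (simp add: field_simps)
      then have "a + b \<le> (1 + 1/k) * b" by (simp add: algebra_simps)
      then have "(a + b) powr p \<le> ((1 + 1/k) * b) powr p" using ab assms by (intro powr_mono2) auto
      also have "\<dots> = (1 + 1/k) powr p * b powr p" using k ab by (simp add: powr_mult)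
      finally show ?thesis using assms by (simp add: add_increasing)
    qed
  qed
qed

text \<open>The choice t = (Y / W)^(1/p) makes the two terms on the right equal, so that X <= 2 t
  W.\<close>

lemma powr_le_of_interpolation:
  fixes p X W Y :: real
  assumes "1 < p" "0 \<le> X" "0 < W" "0 \<le> Y"
    and le: "\<And>t. 0 < t \<Longrightarrow> X \<le> t * W + t powr (1 - p) * Y"
  shows "X powr p \<le> 2 powr p * W powr (p - 1) * Y"
proof (cases "Y = 0")
  case True
  have "X \<le> 0"
  proof (rule ccontr)
    assume "\<not> X \<le> 0"
    \<comment> \<open>For Y = 0 this value of t makes t W equal to X / 2, absurd for X > 0.\<close>
    then have "X \<le> X / (2 * W) * W" using le[of "X / (2 * W)"] True assms by simp
    also have "\<dots> = X / 2" using assms by simp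
    finally show False using \<open>\<not> X \<le> 0\<close> by simp
  qed
  then show ?thesis using assms True by simp
next
  case False
  then have Y: "Y > 0" using assms by simp
  define t where "t = (Y / W) powr (1 / p)"
  have t: "t > 0" "t powr p = Y / W" using Y assms by (auto simp: t_def powr_powr)
  have "t powr (1 - p) * Y = t * W"
    using t Y assms by (simp add: powr_diff)
  then have "X \<le> 2 * (t * W)" using le[OF t(1)] by linarith
  then have "X powr p \<le> (2 * (t * W)) powr p" using assms by (intro powr_mono2) auto
  also have "\<dots> = 2 powr p * (Y / W * W powr p)" using t assms by (simp add: powr_mult)
  also have "\<dots> = 2 powr p * W powr (p - 1) * Y" using assms by (simp add: powr_diff)
  finally show ?thesis .
qed

text \<open>Jensen's inequality up to the factor \<open>2\<^sup>p\<close>, from \<open>f \<le> t + t\<^sup>1\<^sup>-\<^sup>p f\<^sup>p\<close> with t optimized.\<close>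
lemma powr_nn_integral_le:
  fixes f :: "'b \<Rightarrow> real" and p :: real
  assumes p: "1 < p" and [measurable]: "f \<in> borel_measurable M" "A \<in> sets M"
    and f: "\<And>x. 0 \<le> f x" and V: "emeasure M A \<le> ennreal V" "0 < V"
    and r: "0 \<le> r" "ennreal r \<le> (\<integral>\<^sup>+x\<in>A. ennreal (f x) \<partial>M)"
  shows "ennreal (r powr p) \<le> ennreal (2 powr p * V powr (p - 1)) * (\<integral>\<^sup>+x\<in>A. ennreal (f x powr p) \<partial>M)"
proof (cases "(\<integral>\<^sup>+x\<in>A. ennreal (f x powr p) \<partial>M) = \<infinity>")
  case True
  then show ?thesis using V by (simp add: ennreal_mult_eq_top_iff ennreal_mult_top)
next
  case False
  define Y where "Y = enn2real (\<integral>\<^sup>+x\<in>A. ennreal (f x powr p) \<partial>M)"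
  have Y: "(\<integral>\<^sup>+x\<in>A. ennreal (f x powr p) \<partial>M) = ennreal Y" "0 \<le> Y"
    using False by (auto simp: Y_def less_top)
  have "r powr p \<le> 2 powr p * V powr (p - 1) * Y"
  proof (rule powr_le_of_interpolation[OF p r(1) V(2) Y(2)])
    fix t :: real assume t: "0 < t"
    \<comment> \<open>Where f exceeds t, write f = f^(1-p) f^p; as 1 - p is negative, the first
      factor is at most t^(1-p).\<close>
    have pt: "f x \<le> t + t powr (1 - p) * f x powr p" for x
    proof (cases "f x \<le> t")
      case True then show ?thesis by (simp add: add_increasing2)
    next
      case False
      then have "f x powr (1 - p) \<le> t powr (1 - p)" using p t by (intro powr_mono2') auto
      then have "f x powr (1 - p) * f x powr p \<le> t powr (1 - p) * f x powr p"
        by (rule mult_right_mono) simp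
      moreover have "f x powr (1 - p) * f x powr p = f x"
        using False t by (simp flip: powr_add)
      ultimately show ?thesis using t by simp
    qed
    have "ennreal r \<le> (\<integral>\<^sup>+x\<in>A. ennreal (f x) \<partial>M)" by (rule r)
    also have "\<dots> \<le> (\<integral>\<^sup>+x. ennreal t * indicator A x + ennreal (t powr (1 - p)) * (ennreal (f x powr p) * indicator A x) \<partial>M)"
      using pt t by (intro nn_integral_mono) (auto simp: indicator_def simp flip: ennreal_mult ennreal_plus intro: ennreal_leI)
    also have "\<dots> = ennreal t * emeasure M A + ennreal (t powr (1 - p)) * ennreal Y"
      by (subst nn_integral_add) (simp_all add: nn_integral_cmult_indicator nn_integral_cmult Y)
    also have "\<dots> \<le> ennreal t * ennreal V + ennreal (t powr (1 - p)) * ennreal Y"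
      using V by (intro add_mono mult_left_mono) auto
    also have "\<dots> = ennreal (t * V + t powr (1 - p) * Y)"
      using t V Y by (simp flip: ennreal_mult ennreal_plus)
    finally have "ennreal r \<le> ennreal (t * V + t powr (1 - p) * Y)" .
    then show "r \<le> t * V + t powr (1 - p) * Y"
      using t V Y by (subst (asm) ennreal_le_iff) auto
  qed
  then show ?thesis unfolding Y using Y V by (simp flip: ennreal_mult add: ennreal_leI)
qed

section \<open>A bounded kernel on the ball with mean zero and identity first moment\<close>

lemma lborel_integral_affine:
  fixes g :: "'a::euclidean_space \<Rightarrow> 'b::euclidean_space"
  assumes [measurable]: "g \<in> borel_measurable borel" and r: "0 < r"
  shows "(\<integral>x. g ((1 / r) *\<^sub>R (x - a)) \<partial>lborel) = r ^ DIM('a) *\<^sub>R (\<integral>x. g x \<partial>lborel)"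
proof -
  have "(\<integral>x. g ((1 / r) *\<^sub>R (x - a)) \<partial>lborel)
    = (\<integral>x. g ((1 / r) *\<^sub>R (x - a)) \<partial>density (distr lborel borel (\<lambda>x. a + r *\<^sub>R x)) (\<lambda>_. ennreal (\<bar>r\<bar> ^ DIM('a))))"
    using lborel_affine[of r a] r by simp
  also have "\<dots> = r ^ DIM('a) *\<^sub>R (\<integral>x. g x \<partial>lborel)"
    using r by (simp add: integral_density integral_distr)
  finally show ?thesis .
qed

text \<open>Reflection in the hyperplane orthogonal to \<open>i\<close> preserves Lebesgue measure,
  so the integral equals its own negative. A nonintegrable \<open>f\<close> is covered too, its
  Bochner integral being 0 by convention.\<close>

lemma integral_eq_0_of_reflect_odd:
  fixes f :: "'a::euclidean_space \<Rightarrow> real"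
  assumes [measurable]: "f \<in> borel_measurable borel" and i: "i \<in> Basis"
    and odd: "\<And>x. f (x - (2 * (x \<bullet> i)) *\<^sub>R i) = - f x"
  shows "(\<integral>x. f x \<partial>lborel) = 0"
proof -
  \<comment> \<open>The reflection is written as a diagonal map, the form in which
    \<open>lborel_affine_euclidean\<close> computes the image of Lebesgue measure.\<close>
  define c :: "'a \<Rightarrow> real" where "c = (\<lambda>j. if j = i then -1 else 1)"
  define T where "T = (\<lambda>x. 0 + (\<Sum>j\<in>Basis. (c j * (x \<bullet> j)) *\<^sub>R j))"
  have T: "T x = x - (2 * (x \<bullet> i)) *\<^sub>R i" for x
  proof (rule euclidean_eqI)
    fix b :: 'a assume b: "b \<in> Basis"
    then show "T x \<bullet> b = (x - (2 * (x \<bullet> i)) *\<^sub>R i) \<bullet> b"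
      using i by (auto simp: T_def c_def inner_sum_left inner_diff_left inner_Basis if_distrib cong: if_cong)
  qed
  have [measurable]: "T \<in> borel_measurable borel" unfolding T_def by measurable
  have "(\<Prod>j\<in>Basis. \<bar>c j\<bar>) = 1" by (auto simp: c_def intro: prod.neutral)
  then have "lborel = distr lborel borel T"
    using lborel_affine_euclidean[of c 0] by (simp add: c_def T_def density_1)
  then have "(\<integral>x. f x \<partial>lborel) = (\<integral>x. f x \<partial>distr lborel borel T)" by simp
  also have "\<dots> = (\<integral>x. f (T x) \<partial>lborel)" by (rule integral_distr) auto
  also have "\<dots> = - (\<integral>x. f x \<partial>lborel)" by (simp add: T odd)
  finally show ?thesis by simp
qed

definition ball_moment :: "'a::euclidean_space \<Rightarrow> real" where
  "ball_moment i = (\<integral>x. indicator (ball 0 1) x * (x \<bullet> i)\<^sup>2 \<partial>lborel)"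

text \<open>The identity field cut off to the unit ball and normalized in each coordinate so that
  its matrix of first moments is the identity. Only size, support and moments of the kernel enter
  below, so a sharp cut-off is good enough.\<close>

definition unit_kern :: "'a::euclidean_space \<Rightarrow> 'a" where
  "unit_kern x = indicator (ball 0 1) x *\<^sub>R (\<Sum>i\<in>Basis. ((x \<bullet> i) / ball_moment i) *\<^sub>R i)"

lemma integrable_bounded_ball:
  fixes f :: "'a::euclidean_space \<Rightarrow> 'b::{banach, second_countable_topology}"
  assumes [measurable]: "f \<in> borel_measurable borel" and f: "\<And>x. norm (f x) \<le> K * indicator (ball a r) x"
  shows "integrable lborel f"
proof (rule Bochner_Integration.integrable_bound)
  show "integrable lborel (\<lambda>x. K * indicator (ball a r) x)"
    by (intro integrable_mult_right integrable_real_indicator) (simp_all add: emeasure_lborel_ball_finite[unfolded infinity_ennreal_def])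
  show "AE x in lborel. norm (f x) \<le> norm (K * indicator (ball a r) x)"
    using f by (auto intro!: AE_I2 order_trans[OF f] )
qed auto

text \<open>The ball of radius 1/4 around i/2 lies in the unit ball, and on it the i-th coordinate
  is at least 1/4, so the integrand is at least 1/16 there.\<close>

lemma ball_moment_pos:
  fixes i :: "'a::euclidean_space"
  assumes i: "i \<in> Basis" shows "0 < ball_moment i"
proof -
  have x1: "\<bar>x \<bullet> i\<bar> \<le> norm x" for x using i by (metis Basis_le_norm)
  have "0 < (1/16) * measure lborel (ball ((1/2) *\<^sub>R i) (1/4))"
    by (simp add: content_ball_pos)
  also have "\<dots> = (\<integral>x. (1/16) * indicator (ball ((1/2) *\<^sub>R i) (1/4)) x \<partial>lborel)"
    by simp
  also have "\<dots> \<le> ball_moment i" unfolding ball_moment_def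
  proof (rule integral_mono)
    show "integrable lborel (\<lambda>x. 1/16 * indicat_real (ball ((1/2) *\<^sub>R i) (1/4)) x)"
      by (intro integrable_mult_right integrable_real_indicator) (simp_all add: emeasure_lborel_ball_finite[unfolded infinity_ennreal_def])
    have "(x \<bullet> i)\<^sup>2 \<le> 1" if "norm x < 1" for x
      using x1[of x] that by (simp add: abs_square_le_1)
    then show "integrable lborel (\<lambda>x. indicat_real (ball 0 1) x * (x \<bullet> i)\<^sup>2)"
      by (intro integrable_bounded_ball[where K=1 and a=0 and r=1]) (auto simp: indicator_def)
    fix x :: 'a
    show "1/16 * indicat_real (ball ((1/2) *\<^sub>R i) (1/4)) x \<le> indicat_real (ball 0 1) x * (x \<bullet> i)\<^sup>2"
    proof (cases "x \<in> ball ((1/2) *\<^sub>R i) (1/4)")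
      case True
      then have d: "norm (x - (1/2) *\<^sub>R i) < 1/4" by (simp add: dist_norm norm_minus_commute)
      have "\<bar>(x - (1/2) *\<^sub>R i) \<bullet> i\<bar> < 1/4" using d x1[of "x - (1/2) *\<^sub>R i"] by simp
      then have ge: "x \<bullet> i \<ge> 1/4" using i unfolding inner_diff_left by (simp add: abs_if split: if_splits)
      have "norm x \<le> norm (x - (1/2) *\<^sub>R i) + norm ((1/2) *\<^sub>R i)" by (metis diff_add_cancel norm_triangle_ineq)
      then have "norm x < 1" using d i by simp
      moreover have "(1/4)\<^sup>2 \<le> (x \<bullet> i)\<^sup>2" using ge by (intro power_mono) auto
      ultimately show ?thesis by (simp add: indicator_def power2_eq_square)
    qed (simp add: indicator_def)
  qed
  finally show ?thesis .
qed

lemma norm_reflect_Basis: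
  fixes x :: "'a::euclidean_space"
  assumes "i \<in> Basis" shows "norm (x - (2 * (x \<bullet> i)) *\<^sub>R i) = norm x"
  using assms by (simp add: norm_eq_sqrt_inner algebra_simps inner_commute)

lemma unit_kern_measurable [measurable]: "unit_kern \<in> borel_measurable borel"
  unfolding unit_kern_def[abs_def]
  by (intro borel_measurable_scaleR borel_measurable_indicator borel_measurable_sum) auto

lemma unit_kern_bound:
  obtains K where "0 < K" "\<And>x::'a::euclidean_space. norm (unit_kern x) \<le> K * indicator (ball 0 1) x"
proof (rule that[of "1 + (\<Sum>i\<in>Basis. 1 / ball_moment (i::'a))"])
  show "0 < 1 + (\<Sum>i\<in>Basis. 1 / ball_moment (i::'a))"
    by (intro add_pos_nonneg sum_nonneg) (auto intro: less_imp_le ball_moment_pos)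
  fix x :: 'a
  have "norm (\<Sum>i\<in>Basis. ((x \<bullet> i) / ball_moment i) *\<^sub>R i) \<le> (\<Sum>i\<in>Basis. 1 / ball_moment (i::'a))" if "norm x < 1"
  proof (rule sum_norm_le)
    fix i :: 'a assume i: "i \<in> Basis"
    have "\<bar>x \<bullet> i\<bar> \<le> 1" using Basis_le_norm[OF i, of x] that by simp
    then show "norm (((x \<bullet> i) / ball_moment i) *\<^sub>R i) \<le> 1 / ball_moment i"
      using i ball_moment_pos[OF i] by (simp add: divide_right_mono)
  qed
  then show "norm (unit_kern x) \<le> (1 + (\<Sum>i\<in>Basis. 1 / ball_moment (i::'a))) * indicator (ball 0 1) x"
    by (auto simp: unit_kern_def indicator_def)
qed

text \<open>Each coordinate of the kernel is odd under the reflection of that coordinate.\<close>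

lemma integral_unit_kern: "(\<integral>x. unit_kern x \<partial>lborel) = (0::'a::euclidean_space)"
proof -
  obtain K where K: "\<And>x::'a. norm (unit_kern x) \<le> K * indicator (ball 0 1) x"
    using unit_kern_bound by blast
  have int: "integrable lborel (unit_kern :: 'a \<Rightarrow> 'a)"
    by (rule integrable_bounded_ball[OF _ K]) auto
  show ?thesis
  proof (rule euclidean_eqI)
    fix b :: 'a assume b: "b \<in> Basis"
    have "(\<integral>x. unit_kern x \<partial>lborel) \<bullet> b = (\<integral>x. unit_kern x \<bullet> b \<partial>lborel)"
      using int by (simp add: integral_inner_left)
    also have "\<dots> = (\<integral>x. indicator (ball 0 1) x * ((x \<bullet> b) / ball_moment b) \<partial>lborel)"
      using b by (intro Bochner_Integration.integral_cong) (auto simp: unit_kern_def inner_sum_left inner_Basis if_distrib cong: if_cong)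
    also have "\<dots> = 0"
      using b by (intro integral_eq_0_of_reflect_odd[OF _ b]) (auto simp: indicator_def norm_reflect_Basis inner_diff_left)
    finally show "(\<integral>x. unit_kern x \<partial>lborel) \<bullet> b = 0 \<bullet> b" by simp
  qed
qed

text \<open>The matrix of second moments of the unit ball is diagonal, since a mixed product of
  coordinates is odd under reflection of one of them; \<open>ball_moment\<close> normalizes the
  diagonal entries to 1.\<close>

lemma integral_inner_unit_kern: "(\<integral>x. (x \<bullet> v) *\<^sub>R unit_kern x \<partial>lborel) = (v::'a::euclidean_space)"
proof -
  obtain K where K: "0 < K" "\<And>x::'a. norm (unit_kern x) \<le> K * indicator (ball 0 1) x"
    using unit_kern_bound by blast
  have int: "integrable lborel (\<lambda>x. (x \<bullet> v) *\<^sub>R unit_kern (x::'a))"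
  proof (rule integrable_bounded_ball[where K = "norm v * K" and a=0 and r=1])
    fix x :: 'a
    have "norm ((x \<bullet> v) *\<^sub>R unit_kern x) \<le> (norm x * norm v) * (K * indicator (ball 0 1) x)"
      using K Cauchy_Schwarz_ineq2[of x v] by (simp add: mult_mono)
    also have "\<dots> \<le> (1 * norm v) * (K * indicator (ball 0 1) x)"
      using K by (auto simp: indicator_def intro!: mult_right_mono mult_left_le_one_le)
    finally show "norm ((x \<bullet> v) *\<^sub>R unit_kern x) \<le> norm v * K * indicator (ball 0 1) x" by simp
  qed measurable
  show ?thesis
  proof (rule euclidean_eqI)
    fix b :: 'a assume b: "b \<in> Basis"
    have bm: "ball_moment b \<noteq> 0" using ball_moment_pos[OF b] by simp
    define F where "F = (\<lambda>(i::'a) x. indicator (ball 0 1) x * ((x \<bullet> i) * (x \<bullet> b)))"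
    have Fint: "integrable lborel (F i)" if i: "i \<in> Basis" for i
    proof (rule integrable_bounded_ball[where K=1 and a=0 and r=1])
      fix x :: 'a
      have "\<bar>x \<bullet> i\<bar> \<le> norm x" "\<bar>x \<bullet> b\<bar> \<le> norm x" using i b Basis_le_norm by auto
      then show "norm (F i x) \<le> 1 * indicator (ball 0 1) x"
        by (auto simp: F_def indicator_def abs_mult intro!: mult_le_one)
    qed (unfold F_def, intro borel_measurable_times borel_measurable_indicator borel_measurable_inner, auto)
    have F0: "(\<integral>x. F i x \<partial>lborel) = (if i = b then ball_moment b else 0)" if i: "i \<in> Basis" for i
    proof (cases "i = b")
      case True then show ?thesis by (simp add: F_def ball_moment_def power2_eq_square)
    next
      case False
      then have "i \<bullet> b = 0" "b \<bullet> i = 0" using i b by (auto simp: inner_Basis)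
      then have "(\<integral>x. F i x \<partial>lborel) = 0"
        using b by (intro integral_eq_0_of_reflect_odd[OF _ b]) (auto simp: F_def indicator_def norm_reflect_Basis inner_diff_left)
      with False show ?thesis by simp
    qed
    have "(\<integral>x. (x \<bullet> v) *\<^sub>R unit_kern x \<partial>lborel) \<bullet> b = (\<integral>x. ((x \<bullet> v) *\<^sub>R unit_kern x) \<bullet> b \<partial>lborel)"
      by (rule integral_inner_left[symmetric]) (rule int)
    also have "\<dots> = (\<integral>x. (\<Sum>i\<in>Basis. (v \<bullet> i / ball_moment b) * F i x) \<partial>lborel)"
    proof (intro Bochner_Integration.integral_cong refl)
      fix x :: 'a
      have "x \<bullet> v = (\<Sum>i\<in>Basis. (x \<bullet> i) * (v \<bullet> i))" by (rule euclidean_inner)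
      moreover have "unit_kern x \<bullet> b = indicator (ball 0 1) x * ((x \<bullet> b) / ball_moment b)"
        using b by (auto simp: unit_kern_def inner_sum_left inner_Basis if_distrib cong: if_cong)
      ultimately show "((x \<bullet> v) *\<^sub>R unit_kern x) \<bullet> b = (\<Sum>i\<in>Basis. (v \<bullet> i / ball_moment b) * F i x)"
        by (simp add: F_def sum_distrib_right sum_distrib_left mult_ac sum_divide_distrib)
    qed
    also have "\<dots> = (\<Sum>i\<in>Basis. (v \<bullet> i / ball_moment b) * (if i = b then ball_moment b else 0))"
      using Fint F0 by (simp add: Bochner_Integration.integral_sum)
    also have "\<dots> = v \<bullet> b" using b bm by (simp add: if_distrib cong: if_cong)
    finally show "(\<integral>x. (x \<bullet> v) *\<^sub>R unit_kern x \<partial>lborel) \<bullet> b = v \<bullet> b" .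
  qed
qed

text \<open>The exponent is \<open>DIM('a) + 1\<close> and not \<open>DIM('a)\<close>, because it is
  the first moment, and not the mass, that has to be independent of the scale.\<close>

definition kern :: "'a::euclidean_space \<Rightarrow> real \<Rightarrow> 'a \<Rightarrow> 'a" where
  "kern a r x = (1 / r ^ (DIM('a) + 1)) *\<^sub>R unit_kern ((1 / r) *\<^sub>R (x - a))"

lemma kern_measurable [measurable]: "kern a r \<in> borel_measurable borel"
  unfolding kern_def[abs_def] by measurable

lemma kern_bound:
  obtains K where "0 < K" "\<And>(a::'a::euclidean_space) r x. 0 < r \<Longrightarrow> norm (kern a r x) \<le> K / r ^ (DIM('a) + 1) * indicator (ball a r) x"
proof -
  obtain K where K: "0 < K" "\<And>x::'a. norm (unit_kern x) \<le> K * indicator (ball 0 1) x"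
    using unit_kern_bound by blast
  show thesis
  proof (rule that[OF K(1)])
    fix a x :: 'a and r :: real assume r: "0 < r"
    have ind: "indicator (ball 0 1) ((1 / r) *\<^sub>R (x - a)) = (indicator (ball a r) x :: real)"
      using r by (simp add: indicator_def dist_norm norm_minus_commute[of a x] divide_less_eq del: scaleR_diff_right)
    have "norm (unit_kern ((1 / r) *\<^sub>R (x - a))) \<le> K * indicator (ball a r) x"
      using K(2)[of "(1 / r) *\<^sub>R (x - a)"] by (simp only: ind)
    then have "norm (unit_kern ((1 / r) *\<^sub>R (x - a))) / r ^ (DIM('a) + 1) \<le> (K * indicator (ball a r) x) / r ^ (DIM('a) + 1)"
      using r by (intro divide_right_mono) auto
    then show "norm (kern a r x) \<le> K / r ^ (DIM('a) + 1) * indicator (ball a r) x"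
      using r by (simp add: kern_def)
  qed
qed

lemma integral_kern:
  fixes a :: "'a::euclidean_space" assumes "0 < r"
  shows "(\<integral>x. kern a r x \<partial>lborel) = 0"
proof -
  have "(\<integral>x. kern a r x \<partial>lborel) = (1 / r ^ (DIM('a) + 1)) *\<^sub>R (\<integral>x. unit_kern ((1 / r) *\<^sub>R (x - a)) \<partial>lborel)"
    unfolding kern_def by (rule integral_scaleR_right)
  then show ?thesis
    using assms by (simp only: lborel_integral_affine unit_kern_measurable integral_unit_kern) simp
qed

lemma integral_inner_kern:
  fixes a v :: "'a::euclidean_space" assumes r: "0 < r"
  shows "(\<integral>x. ((x - a) \<bullet> v) *\<^sub>R kern a r x \<partial>lborel) = v"
proof -
  define g where "g = (\<lambda>x::'a. (x \<bullet> v) *\<^sub>R unit_kern x)"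
  have [measurable]: "g \<in> borel_measurable borel" unfolding g_def by measurable
  have "((x - a) \<bullet> v) *\<^sub>R kern a r x = (1 / r ^ DIM('a)) *\<^sub>R g ((1 / r) *\<^sub>R (x - a))" for x
    using r by (simp add: g_def kern_def)
  then have "(\<integral>x. ((x - a) \<bullet> v) *\<^sub>R kern a r x \<partial>lborel) = (1 / r ^ DIM('a)) *\<^sub>R (\<integral>x. g ((1 / r) *\<^sub>R (x - a)) \<partial>lborel)"
    by (simp only: integral_scaleR_right)
  also have "\<dots> = (\<integral>x. g x \<partial>lborel)" using r by (simp add: lborel_integral_affine)
  also have "\<dots> = v" unfolding g_def by (rule integral_inner_unit_kern)
  finally show ?thesis .
qed

section \<open>Averaged gradients and the local Korn inequality\<close>

text \<open>Symmetric in its two points and zero for rigid motions: a difference version of the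
  symmetric gradient.\<close>

definition strain :: "('a::euclidean_space \<Rightarrow> 'a) \<Rightarrow> 'a \<Rightarrow> 'a \<Rightarrow> real" where
  "strain u y x = (u y - u x) \<bullet> (y - x)"

text \<open>For an affine field with linear part L the moments of the kernel make this L v; for
  general \<open>u\<close> it is an averaged gradient obtained without differentiating
  \<open>u\<close>.\<close>

definition kgrad :: "('a::euclidean_space \<Rightarrow> 'a) \<Rightarrow> 'a \<Rightarrow> real \<Rightarrow> 'a \<Rightarrow> 'a" where
  "kgrad u a r v = (\<integral>x. (kern a r x \<bullet> v) *\<^sub>R u x \<partial>lborel)"

text \<open>The transpose of the averaged gradient (\<open>kgrad_inner\<close>). Integrating the
  strain in its second argument produces this operator rather than \<open>kgrad\<close>.\<close>

definition kadj :: "('a::euclidean_space \<Rightarrow> 'a) \<Rightarrow> 'a \<Rightarrow> real \<Rightarrow> 'a \<Rightarrow> 'a" where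
  "kadj u a r v = (\<integral>x. (u x \<bullet> v) *\<^sub>R kern a r x \<partial>lborel)"

text \<open>By \<open>kerr_representation\<close> this is an affine field minus \<open>u\<close>:
  the deviation of \<open>u\<close> from being affine, expressed through the strain alone.\<close>

definition kerr :: "('a::euclidean_space \<Rightarrow> 'a) \<Rightarrow> 'a \<Rightarrow> real \<Rightarrow> 'a \<Rightarrow> 'a" where
  "kerr u a r y = (\<integral>x. strain u y x *\<^sub>R kern a r x \<partial>lborel)"

definition strain_at :: "('a::euclidean_space \<Rightarrow> 'a) \<Rightarrow> real \<Rightarrow> 'a \<Rightarrow> real \<Rightarrow> 'a \<Rightarrow> ennreal" where
  "strain_at u p a r y = (\<integral>\<^sup>+x\<in>ball a r. ennreal (\<bar>strain u y x\<bar> powr p) \<partial>lborel)"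

definition strain_on :: "('a::euclidean_space \<Rightarrow> 'a) \<Rightarrow> real \<Rightarrow> 'a \<Rightarrow> real \<Rightarrow> ennreal" where
  "strain_on u p a r = (\<integral>\<^sup>+y\<in>ball a r. strain_at u p a r y \<partial>lborel)"

lemma strain_measurable [measurable (raw)]:
  assumes [measurable]: "u \<in> borel_measurable borel" "f \<in> borel_measurable M" "g \<in> borel_measurable M"
  shows "(\<lambda>x. strain u (f x) (g x)) \<in> borel_measurable M"
  unfolding strain_def by measurable

lemma strain_at_measurable [measurable]:
  assumes [measurable]: "u \<in> borel_measurable borel"
  shows "strain_at u p a r \<in> borel_measurable borel"
  unfolding strain_at_def by measurable

lemma kerr_measurable [measurable]:
  assumes [measurable]: "u \<in> borel_measurable borel"
  shows "kerr u a r \<in> borel_measurable borel"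
  unfolding kerr_def by measurable

lemma integrable_le_affine_norm:
  fixes u :: "'a::euclidean_space \<Rightarrow> 'a" and g :: "'a \<Rightarrow> 'b::{banach, second_countable_topology}"
  assumes u: "set_integrable lborel (ball a r) u" and [measurable]: "g \<in> borel_measurable borel"
    and g: "\<And>x. norm (g x) \<le> indicator (ball a r) x * (K + L * norm (u x))"
  shows "integrable lborel g"
proof (rule Bochner_Integration.integrable_bound)
  have "integrable lborel (\<lambda>x. norm (indicator (ball a r) x *\<^sub>R u x))"
    using u unfolding set_integrable_def by (rule integrable_norm)
  then have "integrable lborel (\<lambda>x. K * indicator (ball a r) x + L * norm (indicator (ball a r) x *\<^sub>R u x))"
    by (intro Bochner_Integration.integrable_add integrable_mult_right integrable_real_indicator)
       (simp_all add: emeasure_lborel_ball_finite[unfolded infinity_ennreal_def])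
  then show "integrable lborel (\<lambda>x. indicator (ball a r) x * (K + L * norm (u x)))"
    by (rule Bochner_Integration.integrable_cong[THEN iffD1, rotated 2]) (auto simp: indicator_def)
  show "AE x in lborel. norm (g x) \<le> norm (indicator (ball a r) x * (K + L * norm (u x)))"
    by (intro AE_I2 order_trans[OF g]) simp
qed simp

lemma integrable_kern_mult:
  fixes u :: "'a::euclidean_space \<Rightarrow> 'a" and h :: "'a \<Rightarrow> real"
  assumes r: "0 < r" and u: "set_integrable lborel (ball a r) u" and [measurable]: "h \<in> borel_measurable borel"
    and h: "\<And>x. x \<in> ball a r \<Longrightarrow> \<bar>h x\<bar> \<le> A + B * norm (u x)"
  shows "integrable lborel (\<lambda>x. h x *\<^sub>R kern a r x)"
proof -
  obtain K where K: "0 < K" "\<And>x. norm (kern a r x) \<le> K / r ^ (DIM('a) + 1) * indicator (ball a r) x"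
    using kern_bound r by metis
  define M where "M = K / r ^ (DIM('a) + 1)"
  show ?thesis
  proof (rule integrable_le_affine_norm[OF u, where K = "A * M" and L = "B * M"])
    fix x
    have "norm (h x *\<^sub>R kern a r x) \<le> \<bar>h x\<bar> * (M * indicator (ball a r) x)"
      unfolding norm_scaleR M_def by (intro mult_left_mono K) auto
    also have "\<dots> \<le> (A + B * norm (u x)) * (M * indicator (ball a r) x)"
      using h[of x] K r by (auto simp: indicator_def M_def intro!: divide_right_mono mult_right_mono)
    finally show "norm (h x *\<^sub>R kern a r x) \<le> indicator (ball a r) x * (A * M + B * M * norm (u x))"
      by (simp add: algebra_simps)
  qed measurable
qed

lemma inner_le_norm_mult: "\<bar>x \<bullet> y\<bar> \<le> norm y * norm x"
  using Cauchy_Schwarz_ineq2[of x y] by (simp add: mult.commute)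

lemma integrable_kadj:
  fixes u :: "'a::euclidean_space \<Rightarrow> 'a"
  assumes "0 < r" "set_integrable lborel (ball a r) u" and [measurable]: "u \<in> borel_measurable borel"
  shows "integrable lborel (\<lambda>x. (u x \<bullet> v) *\<^sub>R kern a r x)"
  by (rule integrable_kern_mult[OF assms(1,2), where A=0 and B="norm v"]) (auto simp: inner_le_norm_mult)

lemma linear_kadj:
  fixes u :: "'a::euclidean_space \<Rightarrow> 'a"
  assumes "0 < r" "set_integrable lborel (ball a r) u" "u \<in> borel_measurable borel"
  shows "linear (kadj u a r)"
  using integrable_kadj[OF assms]
  by (auto intro!: linearI simp: kadj_def inner_add_right scaleR_left_distrib simp flip: scaleR_scaleR)

lemma integrable_kgrad:
  fixes u :: "'a::euclidean_space \<Rightarrow> 'a"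
  assumes r: "0 < r" "set_integrable lborel (ball a r) u" and [measurable]: "u \<in> borel_measurable borel"
  shows "integrable lborel (\<lambda>x. (kern a r x \<bullet> v) *\<^sub>R u x)"
proof -
  obtain K where K: "0 < K" "\<And>x. norm (kern a r x) \<le> K / r ^ (DIM('a) + 1) * indicator (ball a r) x"
    using kern_bound r by metis
  define M where "M = K / r ^ (DIM('a) + 1)"
  show ?thesis
  proof (rule integrable_le_affine_norm[OF r(2), where K = 0 and L = "norm v * M"])
    fix x
    have "norm ((kern a r x \<bullet> v) *\<^sub>R u x) \<le> (norm v * norm (kern a r x)) * norm (u x)"
      by (simp add: inner_le_norm_mult mult_right_mono)
    also have "\<dots> \<le> (norm v * (M * indicator (ball a r) x)) * norm (u x)"
      using K by (intro mult_right_mono mult_left_mono) (auto simp: M_def)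
    finally show "norm ((kern a r x \<bullet> v) *\<^sub>R u x) \<le> indicator (ball a r) x * (0 + norm v * M * norm (u x))"
      by (simp add: algebra_simps)
  qed measurable
qed

lemma linear_kgrad:
  fixes u :: "'a::euclidean_space \<Rightarrow> 'a"
  assumes "0 < r" "set_integrable lborel (ball a r) u" "u \<in> borel_measurable borel"
  shows "linear (kgrad u a r)"
  using integrable_kgrad[OF assms]
  by (auto intro!: linearI simp: kgrad_def inner_add_right scaleR_left_distrib simp flip: scaleR_scaleR)

text \<open>Both sides are the integral of the product of \<open>kern a r x \<bullet> v\<close> and
  \<open>u x \<bullet> w\<close>.\<close>

lemma kgrad_inner:
  fixes u :: "'a::euclidean_space \<Rightarrow> 'a"
  assumes "0 < r" "set_integrable lborel (ball a r) u" "u \<in> borel_measurable borel"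
  shows "kgrad u a r v \<bullet> w = kadj u a r w \<bullet> v"
  using integrable_kgrad[OF assms, of v] integrable_kadj[OF assms, of w]
  unfolding kgrad_def kadj_def by (simp flip: integral_inner_left add: mult.commute)

text \<open>Allows the kernel lemmas to be applied to the identity field, from which the
  integrability of the kernel and of its moments follows.\<close>

lemma set_integrable_ball_id: "set_integrable lborel (ball a r) (\<lambda>x::'a::euclidean_space. x)"
  unfolding set_integrable_def
proof (rule integrable_bounded_ball)
  fix x :: 'a
  have "norm x \<le> norm a + dist a x" by (metis add.commute dist_norm norm_triangle_sub norm_minus_commute)
  then show "norm (indicat_real (ball a r) x *\<^sub>R x) \<le> (norm a + r) * indicator (ball a r) x"
    by (auto simp: indicator_def)
qed auto

lemma integrable_kern:
  assumes "0 < r" shows "integrable lborel (\<lambda>x. kern (a::'a::euclidean_space) r x)"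
  using integrable_kern_mult[OF assms set_integrable_ball_id[of a r], of "\<lambda>_. 1" 1 0] by simp

lemma integrable_inner_kern:
  assumes "0 < r" shows "integrable lborel (\<lambda>x. ((x - a) \<bullet> v) *\<^sub>R kern (a::'a::euclidean_space) r x)"
proof (rule integrable_kern_mult[OF assms set_integrable_ball_id[of a r], where A="norm v * r" and B=0])
  fix x assume "x \<in> ball a r"
  then have "norm v * norm (x - a) \<le> norm v * r" by (intro mult_left_mono) (auto simp: dist_norm norm_minus_commute)
  then show "\<bar>(x - a) \<bullet> v\<bar> \<le> norm v * r + 0 * norm x"
    using inner_le_norm_mult[of "x - a" v] by simp
qed simp

lemma integrable_kern_scale:
  assumes r: "0 < r" shows "integrable lborel (\<lambda>x. (kern a r x \<bullet> v) *\<^sub>R (x - (a::'a::euclidean_space)))"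
proof -
  have "integrable lborel (\<lambda>x. (kern a r x \<bullet> v) *\<^sub>R x)"
    by (rule integrable_kgrad[OF r set_integrable_ball_id]) simp
  moreover have "integrable lborel (\<lambda>x. (kern a r x \<bullet> v) *\<^sub>R a)"
    using integrable_kern[OF r, of a] by simp
  ultimately have "integrable lborel (\<lambda>x. (kern a r x \<bullet> v) *\<^sub>R x - (kern a r x \<bullet> v) *\<^sub>R a)" by simp
  then show ?thesis by (simp add: algebra_simps)
qed

text \<open>The transposed moment identity: pairing with \<open>w\<close> exchanges the roles of
  \<open>v\<close> and \<open>w\<close> in \<open>integral_inner_kern\<close>, and the identity
  matrix is symmetric.\<close>

lemma integral_kern_scale:
  assumes r: "0 < r" shows "(\<integral>x. (kern a r x \<bullet> v) *\<^sub>R (x - (a::'a::euclidean_space)) \<partial>lborel) = v"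
proof (rule euclidean_eqI)
  fix w :: 'a assume "w \<in> Basis"
  have "(\<integral>x. (kern a r x \<bullet> v) *\<^sub>R (x - a) \<partial>lborel) \<bullet> w = (\<integral>x. ((kern a r x \<bullet> v) *\<^sub>R (x - a)) \<bullet> w \<partial>lborel)"
    by (rule integral_inner_left[symmetric]) (rule integrable_kern_scale[OF r])
  also have "\<dots> = (\<integral>x. (((x - a) \<bullet> w) *\<^sub>R kern a r x) \<bullet> v \<partial>lborel)"
    by (simp add: mult.commute)
  also have "\<dots> = w \<bullet> v"
    using integral_inner_left[OF integrable_inner_kern[OF r, of a w]] integral_inner_kern[OF r, of a w] by metis
  finally show "(\<integral>x. (kern a r x \<bullet> v) *\<^sub>R (x - a) \<partial>lborel) \<bullet> w = v \<bullet> w" by (simp add: inner_commute)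
qed

text \<open>Testing the strain against the kernel in its second argument recovers the field itself:
  up to the error term, it equals an affine map whose linear part is the transpose of the averaged gradient.\<close>
lemma kerr_representation:
  fixes u :: "'a::euclidean_space \<Rightarrow> 'a"
  assumes r: "0 < r" and u: "set_integrable lborel (ball a r) u" and [measurable]: "u \<in> borel_measurable borel"
  obtains b where "\<And>y. kerr u a r y = b - kadj u a r (y - a) - u y"
proof
  fix y
  let ?k = "kern a r"
  have i4: "integrable lborel (\<lambda>x. (u x \<bullet> (x - a)) *\<^sub>R ?k x)"
  proof (rule integrable_kern_mult[OF r u, where A=0 and B=r])
    fix x assume "x \<in> ball a r"
    then have "norm (x - a) * norm (u x) \<le> r * norm (u x)" by (intro mult_right_mono) (auto simp: dist_norm norm_minus_commute)
    then show "\<bar>u x \<bullet> (x - a)\<bar> \<le> 0 + r * norm (u x)" using inner_le_norm_mult[of "u x" "x - a"] by simp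
  qed simp
  \<comment> \<open>Both factors of the strain are expanded about the centre. Of the four terms the
    first has mean zero, the second reproduces u(y), the third is \<open>kadj\<close> at y - a, and
    the fourth does not depend on y and becomes the constant \<open>b\<close>.\<close>
  have "strain u y x *\<^sub>R ?k x = (u y \<bullet> (y - a)) *\<^sub>R ?k x - ((x - a) \<bullet> u y) *\<^sub>R ?k x
      - (u x \<bullet> (y - a)) *\<^sub>R ?k x + (u x \<bullet> (x - a)) *\<^sub>R ?k x" for x
    by (simp add: strain_def inner_diff_left inner_diff_right inner_commute scaleR_left_diff_distrib)
  then have "kerr u a r y = (\<integral>x. (u y \<bullet> (y - a)) *\<^sub>R ?k x - ((x - a) \<bullet> u y) *\<^sub>R ?k x
      - (u x \<bullet> (y - a)) *\<^sub>R ?k x + (u x \<bullet> (x - a)) *\<^sub>R ?k x \<partial>lborel)"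
    by (simp only: kerr_def)
  also have "\<dots> = (u y \<bullet> (y - a)) *\<^sub>R (\<integral>x. ?k x \<partial>lborel) - (\<integral>x. ((x - a) \<bullet> u y) *\<^sub>R ?k x \<partial>lborel)
      - kadj u a r (y - a) + (\<integral>x. (u x \<bullet> (x - a)) *\<^sub>R ?k x \<partial>lborel)"
    unfolding kadj_def
    using i4 integrable_kern[OF r, of a] integrable_inner_kern[OF r, of a "u y"]
      integrable_kadj[OF r u, of "y - a"]
    by simp
  also have "\<dots> = (\<integral>x. (u x \<bullet> (x - a)) *\<^sub>R ?k x \<partial>lborel) - kadj u a r (y - a) - u y"
    by (simp add: integral_kern[OF r] integral_inner_kern[OF r])
  finally show "kerr u a r y = (\<integral>x. (u x \<bullet> (x - a)) *\<^sub>R ?k x \<partial>lborel) - kadj u a r (y - a) - u y" .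
qed

text \<open>Averaging the affine representation on the larger ball against the kernel of the smaller one.
  The case of equal balls shows that averaged gradients are almost skew; the general case compares
  the averaged gradients of two balls.\<close>
lemma kgrad_plus_kadj:
  fixes u :: "'a::euclidean_space \<Rightarrow> 'a"
  assumes r: "0 < r" "0 < r'" and sub: "ball a r \<subseteq> ball a' r'"
    and u': "set_integrable lborel (ball a' r') u" and [measurable]: "u \<in> borel_measurable borel"
  shows "kgrad u a r v + kadj u a' r' v = - (\<integral>x. (kern a r x \<bullet> v) *\<^sub>R kerr u a' r' x \<partial>lborel)"
proof -
  let ?k = "\<lambda>x. kern a r x \<bullet> v" let ?T = "kadj u a' r'"
  have u: "set_integrable lborel (ball a r) u" by (rule set_integrable_subset[OF u' _ sub]) simp
  obtain b where b: "\<And>y. kerr u a' r' y = b - ?T (y - a') - u y"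
    using kerr_representation[OF r(2) u'] by auto
  have T: "linear ?T" by (rule linear_kadj[OF r(2) u']) simp
  then have bT: "bounded_linear ?T" by (rule linear_conv_bounded_linear[THEN iffD1])
  \<comment> \<open>The affine field is split into a part constant in x, which the mean-zero kernel
    kills, and \<open>?T\<close> of x - a, from which the kernel reproduces
    \<open>v\<close>.\<close>
  have "?k x *\<^sub>R kerr u a' r' x = ?k x *\<^sub>R (b - ?T (a - a')) - ?T (?k x *\<^sub>R (x - a)) - ?k x *\<^sub>R u x" for x
  proof -
    have "?T (x - a') = ?T (x - a) + ?T (a - a')" using linear_add[OF T, of "x - a" "a - a'"] by simp
    then show ?thesis by (simp only: b linear_scale[OF T]) (simp add: algebra_simps)
  qed
  then have "(\<integral>x. ?k x *\<^sub>R kerr u a' r' x \<partial>lborel)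
      = (\<integral>x. ?k x *\<^sub>R (b - ?T (a - a')) - ?T (?k x *\<^sub>R (x - a)) - ?k x *\<^sub>R u x \<partial>lborel)" by simp
  also have "\<dots> = (\<integral>x. ?k x *\<^sub>R (b - ?T (a - a')) \<partial>lborel) - (\<integral>x. ?T (?k x *\<^sub>R (x - a)) \<partial>lborel) - kgrad u a r v"
    using integrable_kern[OF r(1), of a] integrable_bounded_linear[OF bT integrable_kern_scale[OF r(1), of a v]] integrable_kgrad[OF r(1) u, of v]
    unfolding kgrad_def by (simp del: integral_bounded_linear)
  also have "(\<integral>x. ?k x *\<^sub>R (b - ?T (a - a')) \<partial>lborel) = 0"
    using integrable_kern[OF r(1), of a] by (simp add: integral_kern[OF r(1)])
  also have "(\<integral>x. ?T (?k x *\<^sub>R (x - a)) \<partial>lborel) = ?T v"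
    using integral_bounded_linear[OF bT integrable_kern_scale[OF r(1), of a v]] by (simp add: integral_kern_scale[OF r(1)])
  finally show ?thesis by simp
qed

section \<open>Bounds for p-th powers of the averaged quantities\<close>

lemma ennreal_norm_integral_le:
  fixes f :: "'b \<Rightarrow> 'c::{banach, second_countable_topology}"
  shows "ennreal (norm (integral\<^sup>L M f)) \<le> (\<integral>\<^sup>+x. ennreal (norm (f x)) \<partial>M)"
  by (cases "integrable M f") (auto simp: integral_norm_bound_ennreal not_integrable_integral_eq)

lemma ennreal_powr_add3_le:
  fixes p :: real assumes "1 < p"
  obtains C where "0 < C" "\<And>a b c. 0 \<le> a \<Longrightarrow> 0 \<le> b \<Longrightarrow> 0 \<le> c \<Longrightarrow>
    ennreal ((a + b + c) powr p) \<le> ennreal C * (ennreal (a powr p) + ennreal (b powr p) + ennreal (c powr p))"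
proof -
  obtain D where D: "0 < D" "\<And>a b. 0 \<le> a \<Longrightarrow> 0 \<le> b \<Longrightarrow> (a + b) powr p \<le> 2 * a powr p + D * b powr p"
    using powr_add_le_weighted[OF assms, of 2] by auto
  define C where "C = 4 + 2 * D + D"
  show thesis
  proof (rule that[of C])
    show "0 < C" using D by (simp add: C_def)
    fix a b c :: real assume abc: "0 \<le> a" "0 \<le> b" "0 \<le> c"
    have "(a + b + c) powr p \<le> 2 * (a + b) powr p + D * c powr p" using D abc by simp
    also have "\<dots> \<le> 2 * (2 * a powr p + D * b powr p) + D * c powr p"
      using D(2)[OF abc(1,2)] by (intro add_right_mono mult_left_mono) auto
    also have "\<dots> = 4 * a powr p + (2 * D) * b powr p + D * c powr p" by simp
    also have "\<dots> \<le> C * a powr p + C * b powr p + C * c powr p"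
      using D by (intro add_mono mult_right_mono) (auto simp: C_def)
    finally have "(a + b + c) powr p \<le> C * (a powr p + b powr p + c powr p)" by (simp add: algebra_simps)
    then show "ennreal ((a + b + c) powr p) \<le> ennreal C * (ennreal (a powr p) + ennreal (b powr p) + ennreal (c powr p))"
      using D by (simp add: C_def ennreal_leI flip: ennreal_mult ennreal_plus)
  qed
qed

lemma emeasure_ball_eq:
  fixes a :: "'a::euclidean_space" assumes "0 \<le> r"
  shows "emeasure lborel (ball a r) = ennreal (r ^ DIM('a) * measure lborel (ball (0::'a) 1))"
proof (cases "r = 0")
  case False
  then have "emeasure lborel (ball a r) = ennreal (measure lborel (ball a r))"
    using emeasure_lborel_ball_finite[of a r] by (subst emeasure_eq_ennreal_measure) auto
  then show ?thesis using content_ball_conv_unit_ball[of r a] assms by simp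
qed simp

text \<open>A kernel of size r^-(n+1) on a ball of volume proportional to r^n: Jensen gives the
  exponent n (p - 1) - (n + 1) p = -(n + p). An arbitrary number \<open>X\<close> on the left makes
  the bound applicable to norms of vector-valued integrals.\<close>

lemma kern_powr_bound:
  fixes p :: real assumes p: "1 < p"
  obtains C where "0 < C"
    "\<And>(a::'a::euclidean_space) r g X. 0 < r \<Longrightarrow> g \<in> borel_measurable borel \<Longrightarrow> (\<And>x. 0 \<le> g x) \<Longrightarrow> 0 \<le> X \<Longrightarrow>
      ennreal X \<le> (\<integral>\<^sup>+x. ennreal (norm (kern a r x) * g x) \<partial>lborel) \<Longrightarrow>
      ennreal (X powr p) \<le> ennreal (C * r powr (- (DIM('a) + p))) * (\<integral>\<^sup>+x\<in>ball a r. ennreal (g x powr p) \<partial>lborel)"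
proof -
  obtain K where K: "0 < K" "\<And>(a::'a) r x. 0 < r \<Longrightarrow> norm (kern a r x) \<le> K / r ^ (DIM('a) + 1) * indicator (ball a r) x"
    using kern_bound by blast
  define w where "w = measure lborel (ball (0::'a) 1)"
  have w: "0 < w" by (simp add: w_def content_ball_pos)
  show thesis
  proof (rule that[of "2 powr p * w powr (p - 1) * K powr p"])
    show "0 < 2 powr p * w powr (p - 1) * K powr p" using w K by simp
    fix a :: 'a and r X :: real and g :: "'a \<Rightarrow> real"
    assume r: "0 < r" and [measurable]: "g \<in> borel_measurable borel" and g: "\<And>x. 0 \<le> g x" and X: "0 \<le> X"
      "ennreal X \<le> (\<integral>\<^sup>+x. ennreal (norm (kern a r x) * g x) \<partial>lborel)"
    define M where "M = K / r ^ (DIM('a) + 1)"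
    have M: "0 < M" using K r by (simp add: M_def)
    have "norm (kern a r x) * g x \<le> (M * g x) * indicator (ball a r) x" for x
      using mult_right_mono[OF K(2)[OF r, of a x] g[of x]] by (simp add: M_def mult_ac)
    then have "ennreal (norm (kern a r x) * g x) \<le> ennreal (M * g x) * indicator (ball a r) x" for x
      using ennreal_leI[of "norm (kern a r x) * g x" "M * g x * indicator (ball a r) x"] by (cases "x \<in> ball a r") auto
    then have "ennreal X \<le> (\<integral>\<^sup>+x\<in>ball a r. ennreal (M * g x) \<partial>lborel)"
      by (intro order_trans[OF X(2)] nn_integral_mono)
    then have "ennreal (X powr p) \<le> ennreal (2 powr p * (r ^ DIM('a) * w) powr (p - 1)) * (\<integral>\<^sup>+x\<in>ball a r. ennreal ((M * g x) powr p) \<partial>lborel)"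
      using r X(1) M g w by (intro powr_nn_integral_le p) (auto simp: emeasure_ball_eq w_def)
    also have "(\<integral>\<^sup>+x\<in>ball a r. ennreal ((M * g x) powr p) \<partial>lborel) = ennreal (M powr p) * (\<integral>\<^sup>+x\<in>ball a r. ennreal (g x powr p) \<partial>lborel)"
      using M g by (simp add: powr_mult ennreal_mult mult.assoc nn_integral_cmult)
    also have "ennreal (2 powr p * (r ^ DIM('a) * w) powr (p - 1)) * (ennreal (M powr p) * (\<integral>\<^sup>+x\<in>ball a r. ennreal (g x powr p) \<partial>lborel))
       = ennreal (2 powr p * (r ^ DIM('a) * w) powr (p - 1) * M powr p) * (\<integral>\<^sup>+x\<in>ball a r. ennreal (g x powr p) \<partial>lborel)"
      by (simp add: ennreal_mult mult.assoc)
    also have "2 powr p * (r ^ DIM('a) * w) powr (p - 1) * M powr p = 2 powr p * w powr (p - 1) * K powr p * r powr (- (DIM('a) + p))"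
    proof -
      have "(r ^ DIM('a)) powr (p - 1) = r powr (DIM('a) * (p - 1))"
        using r by (simp add: powr_powr flip: powr_realpow)
      moreover have "M powr p = K powr p * r powr (- (real DIM('a) + 1) * p)"
      proof -
        have "M = K * r powr (- (real DIM('a) + 1))"
          using r by (simp add: M_def powr_minus powr_diff powr_realpow field_simps)
        then show ?thesis using K by (simp add: powr_mult powr_powr)
      qed
      moreover have "r powr (DIM('a) * (p - 1)) * r powr (- (real DIM('a) + 1) * p) = r powr (- (DIM('a) + p))"
        by (simp add: algebra_simps flip: powr_add)
      ultimately show ?thesis using r w by (simp add: powr_mult mult_ac)
    qed
    finally show "ennreal (X powr p) \<le> ennreal (2 powr p * w powr (p - 1) * K powr p * r powr (- (DIM('a) + p))) * (\<integral>\<^sup>+x\<in>ball a r. ennreal (g x powr p) \<partial>lborel)" .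
  qed
qed

text \<open>Should the integrand of \<open>kerr\<close> fail to be integrable, its Bochner integral
  is 0 and \<open>ennreal_norm_integral_le\<close> still holds, so the strain may be
  infinite.\<close>

lemma kerr_powr_bound:
  fixes p :: real assumes p: "1 < p"
  obtains C where "0 < C"
    "\<And>u (a::'a::euclidean_space) r y. 0 < r \<Longrightarrow> u \<in> borel_measurable borel \<Longrightarrow>
      ennreal (norm (kerr u a r y) powr p) \<le> ennreal (C * r powr (- (DIM('a) + p))) * strain_at u p a r y"
proof -
  obtain C where C: "0 < C"
    "\<And>(a::'a) r g X. 0 < r \<Longrightarrow> g \<in> borel_measurable borel \<Longrightarrow> (\<And>x. 0 \<le> g x) \<Longrightarrow> 0 \<le> X \<Longrightarrow>
      ennreal X \<le> (\<integral>\<^sup>+x. ennreal (norm (kern a r x) * g x) \<partial>lborel) \<Longrightarrow>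
      ennreal (X powr p) \<le> ennreal (C * r powr (- (DIM('a) + p))) * (\<integral>\<^sup>+x\<in>ball a r. ennreal (g x powr p) \<partial>lborel)"
    using kern_powr_bound[OF p] by blast
  show thesis
  proof (rule that[OF C(1)])
    fix u :: "'a \<Rightarrow> 'a" and a y :: 'a and r :: real assume r: "0 < r" and [measurable]: "u \<in> borel_measurable borel"
    show "ennreal (norm (kerr u a r y) powr p) \<le> ennreal (C * r powr (- (DIM('a) + p))) * strain_at u p a r y"
      unfolding strain_at_def
    proof (rule C(2)[OF r])
      show "ennreal (norm (kerr u a r y)) \<le> (\<integral>\<^sup>+x. ennreal (norm (kern a r x) * \<bar>strain u y x\<bar>) \<partial>lborel)"
        unfolding kerr_def by (rule order_trans[OF ennreal_norm_integral_le]) (simp add: mult.commute)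
    qed auto
  qed
qed

text \<open>The kernel bound is applied twice, to the outer average and inside \<open>kerr\<close>,
  which doubles the exponent n + p. The ratio condition on the radii lets powers of r be traded for
  powers of r'.\<close>

lemma kgrad_kadj_powr_bound:
  fixes p :: real assumes p: "1 < p"
  obtains C where "0 < C"
    "\<And>u (a::'a::euclidean_space) r a' r' v. 0 < r \<Longrightarrow> r' \<le> 4 * r \<Longrightarrow> ball a r \<subseteq> ball a' r' \<Longrightarrow>
      set_integrable lborel (ball a' r') u \<Longrightarrow> u \<in> borel_measurable borel \<Longrightarrow>
      ennreal (norm (kgrad u a r v + kadj u a' r' v) powr p)
        \<le> ennreal (C * r' powr (- (2 * DIM('a) + 2 * p)) * norm v powr p) * strain_on u p a' r'"
proof -
  obtain C where C: "0 < C"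
    "\<And>(a::'a) r g X. 0 < r \<Longrightarrow> g \<in> borel_measurable borel \<Longrightarrow> (\<And>x. 0 \<le> g x) \<Longrightarrow> 0 \<le> X \<Longrightarrow>
      ennreal X \<le> (\<integral>\<^sup>+x. ennreal (norm (kern a r x) * g x) \<partial>lborel) \<Longrightarrow>
      ennreal (X powr p) \<le> ennreal (C * r powr (- (DIM('a) + p))) * (\<integral>\<^sup>+x\<in>ball a r. ennreal (g x powr p) \<partial>lborel)"
    using kern_powr_bound[OF p] by blast
  obtain D where D: "0 < D"
    "\<And>u (a::'a) r y. 0 < r \<Longrightarrow> u \<in> borel_measurable borel \<Longrightarrow>
      ennreal (norm (kerr u a r y) powr p) \<le> ennreal (D * r powr (- (DIM('a) + p))) * strain_at u p a r y"
    using kerr_powr_bound[OF p] by blast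
  show thesis
  proof (rule that[of "C * 4 powr (DIM('a) + p) * D"])
    show "0 < C * 4 powr (DIM('a) + p) * D" using C D by simp
    fix u :: "'a \<Rightarrow> 'a" and a a' v :: 'a and r r' :: real
    assume r: "0 < r" "r' \<le> 4 * r" and sub: "ball a r \<subseteq> ball a' r'" and u: "set_integrable lborel (ball a' r') u"
      and [measurable]: "u \<in> borel_measurable borel"
    have r': "0 < r'" using sub r by (metis ball_eq_empty linorder_not_le subset_empty)
    let ?X = "norm (kgrad u a r v + kadj u a' r' v)"
    have "ennreal ?X \<le> (\<integral>\<^sup>+x. ennreal (norm ((kern a r x \<bullet> v) *\<^sub>R kerr u a' r' x)) \<partial>lborel)"
      using ennreal_norm_integral_le[of lborel "\<lambda>x. (kern a r x \<bullet> v) *\<^sub>R kerr u a' r' x"]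
      by (simp add: kgrad_plus_kadj[OF r(1) r' sub u])
    also have "\<dots> \<le> (\<integral>\<^sup>+x. ennreal (norm (kern a r x) * (norm v * norm (kerr u a' r' x))) \<partial>lborel)"
    proof (intro nn_integral_mono ennreal_leI)
      fix x show "norm ((kern a r x \<bullet> v) *\<^sub>R kerr u a' r' x) \<le> norm (kern a r x) * (norm v * norm (kerr u a' r' x))"
        using mult_right_mono[OF inner_le_norm_mult[of "kern a r x" v] norm_ge_zero[of "kerr u a' r' x"]]
        by (simp add: mult_ac)
    qed
    finally have "ennreal (?X powr p) \<le> ennreal (C * r powr (- (DIM('a) + p))) *
        (\<integral>\<^sup>+x\<in>ball a r. ennreal ((norm v * norm (kerr u a' r' x)) powr p) \<partial>lborel)"
      by (intro C(2)[OF r(1)]) auto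
    also have "\<dots> \<le> ennreal (C * r powr (- (DIM('a) + p))) *
        (\<integral>\<^sup>+x. ennreal (norm v powr p) * ennreal (D * r' powr (- (DIM('a) + p))) * (strain_at u p a' r' x * indicator (ball a' r') x) \<partial>lborel)"
      using sub D(2)[OF r', of u a']
      by (intro mult_left_mono nn_integral_mono) (auto simp: indicator_def powr_mult ennreal_mult mult.assoc intro!: mult_left_mono)
    also have "(\<integral>\<^sup>+x. ennreal (norm v powr p) * ennreal (D * r' powr (- (DIM('a) + p))) * (strain_at u p a' r' x * indicator (ball a' r') x) \<partial>lborel)
        = ennreal (norm v powr p) * ennreal (D * r' powr (- (DIM('a) + p))) * strain_on u p a' r'"
      unfolding strain_on_def by (rule nn_integral_cmult) auto
    also have "ennreal (C * r powr (- (DIM('a) + p))) * (ennreal (norm v powr p) * ennreal (D * r' powr (- (DIM('a) + p))) * strain_on u p a' r')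
       = ennreal (C * r powr (- (DIM('a) + p)) * norm v powr p * (D * r' powr (- (DIM('a) + p)))) * strain_on u p a' r'"
      using C D by (simp add: ennreal_mult mult.assoc)
    also have "\<dots> \<le> ennreal (C * 4 powr (DIM('a) + p) * D * r' powr (- (2 * DIM('a) + 2 * p)) * norm v powr p) * strain_on u p a' r'"
    proof (intro mult_right_mono ennreal_leI)
      have "r powr (- (DIM('a) + p)) \<le> (r' / 4) powr (- (DIM('a) + p))"
        using r r' p by (intro powr_mono2') auto
      also have "\<dots> = 4 powr (DIM('a) + p) * r' powr (- (DIM('a) + p))"
      proof -
        have "(r' / 4) powr (- t) = 4 powr t * r' powr (- t)" for t
          using r' by (simp add: powr_divide powr_minus field_simps)
        then show ?thesis .
      qed
      finally have "C * r powr (- (DIM('a) + p)) * norm v powr p * (D * r' powr (- (DIM('a) + p)))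
         \<le> C * (4 powr (DIM('a) + p) * r' powr (- (DIM('a) + p))) * norm v powr p * (D * r' powr (- (DIM('a) + p)))"
        using C D by (intro mult_right_mono mult_left_mono) auto
      also have "\<dots> = C * 4 powr (DIM('a) + p) * D * (r' powr (- (DIM('a) + p)) * r' powr (- (DIM('a) + p))) * norm v powr p"
        by (simp add: mult_ac)
      also have "r' powr (- (DIM('a) + p)) * r' powr (- (DIM('a) + p)) = r' powr (- (2 * DIM('a) + 2 * p))"
        by (simp flip: powr_add)
      finally show "C * r powr (- (DIM('a) + p)) * norm v powr p * (D * r' powr (- (DIM('a) + p)))
        \<le> C * 4 powr (DIM('a) + p) * D * r' powr (- (2 * DIM('a) + 2 * p)) * norm v powr p" .
    qed simp
    finally show "ennreal (?X powr p) \<le> ennreal (C * 4 powr (DIM('a) + p) * D * r' powr (- (2 * DIM('a) + 2 * p)) * norm v powr p) * strain_on u p a' r'" .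
  qed
qed

text \<open>Both averaged gradients are close to minus \<open>kadj\<close> of the larger ball: one
  by the estimate for two balls, the other by its case of equal balls.\<close>

lemma kgrad_diff_powr_bound:
  fixes p :: real assumes p: "1 < p"
  obtains C where "0 < C"
    "\<And>u (a::'a::euclidean_space) r a' r' v. 0 < r \<Longrightarrow> r' \<le> 4 * r \<Longrightarrow> ball a r \<subseteq> ball a' r' \<Longrightarrow>
      set_integrable lborel (ball a' r') u \<Longrightarrow> u \<in> borel_measurable borel \<Longrightarrow>
      ennreal (norm (kgrad u a r v - kgrad u a' r' v) powr p)
        \<le> ennreal (C * r' powr (- (2 * DIM('a) + 2 * p)) * norm v powr p) * strain_on u p a' r'"
proof -
  obtain C where C: "0 < C"
    "\<And>u (a::'a) r a' r' v. 0 < r \<Longrightarrow> r' \<le> 4 * r \<Longrightarrow> ball a r \<subseteq> ball a' r' \<Longrightarrow>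
      set_integrable lborel (ball a' r') u \<Longrightarrow> u \<in> borel_measurable borel \<Longrightarrow>
      ennreal (norm (kgrad u a r v + kadj u a' r' v) powr p)
        \<le> ennreal (C * r' powr (- (2 * DIM('a) + 2 * p)) * norm v powr p) * strain_on u p a' r'"
    using kgrad_kadj_powr_bound[OF p] by blast
  obtain D where D: "0 < D" "\<And>a b c. 0 \<le> a \<Longrightarrow> 0 \<le> b \<Longrightarrow> 0 \<le> c \<Longrightarrow>
    ennreal ((a + b + c) powr p) \<le> ennreal D * (ennreal (a powr p) + ennreal (b powr p) + ennreal (c powr p))"
    using ennreal_powr_add3_le[OF p] by blast
  show thesis
  proof (rule that[of "2 * D * C"])
    show "0 < 2 * D * C" using C D by simp
    fix u :: "'a \<Rightarrow> 'a" and a a' v :: 'a and r r' :: real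
    assume r: "0 < r" "r' \<le> 4 * r" and sub: "ball a r \<subseteq> ball a' r'" and u: "set_integrable lborel (ball a' r') u"
      and [measurable]: "u \<in> borel_measurable borel"
    have r': "0 < r'" using sub r by (metis ball_eq_empty linorder_not_le subset_empty)
    let ?R = "ennreal (C * r' powr (- (2 * DIM('a) + 2 * p)) * norm v powr p) * strain_on u p a' r'"
    let ?x = "norm (kgrad u a r v + kadj u a' r' v)" and ?y = "norm (kgrad u a' r' v + kadj u a' r' v)"
    have "norm (kgrad u a r v - kgrad u a' r' v) \<le> ?x + ?y + 0"
      using norm_triangle_ineq4[of "kgrad u a r v + kadj u a' r' v" "kgrad u a' r' v + kadj u a' r' v"] by simp
    then have "ennreal (norm (kgrad u a r v - kgrad u a' r' v) powr p) \<le> ennreal ((?x + ?y + 0) powr p)"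
      using p by (intro ennreal_leI powr_mono2) auto
    also have "\<dots> \<le> ennreal D * (ennreal (?x powr p) + ennreal (?y powr p) + ennreal (0 powr p))"
      by (intro D(2)) auto
    also have "\<dots> \<le> ennreal D * (?R + ?R + 0)"
      using r r' sub u by (intro mult_left_mono add_mono C(2)) auto
    also have "\<dots> = ennreal (2 * D * C * r' powr (- (2 * DIM('a) + 2 * p)) * norm v powr p) * strain_on u p a' r'"
      using D C by (simp add: ennreal_mult mult.assoc distrib_left flip: mult_2) (simp add: mult_ac)
    finally show "ennreal (norm (kgrad u a r v - kgrad u a' r' v) powr p)
        \<le> ennreal (2 * D * C * r' powr (- (2 * DIM('a) + 2 * p)) * norm v powr p) * strain_on u p a' r'" .
  qed
qed

text \<open>By \<open>kerr_representation\<close>, u(y) - u(x) is minus \<open>kadj\<close> at y - x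
  plus a difference of two values of \<open>kerr\<close>; almost-skewness turns minus
  \<open>kadj\<close> into \<open>kgrad\<close>. In that last error |y - x| <= 2 r gains a factor
  r^p, hence 2 n + p in place of 2 n + 2 p.\<close>

lemma local_korn:
  fixes p :: real assumes p: "1 < p"
  obtains C where "0 < C"
    "\<And>u (a::'a::euclidean_space) r x y. 0 < r \<Longrightarrow> x \<in> ball a r \<Longrightarrow> y \<in> ball a r \<Longrightarrow>
      set_integrable lborel (ball a r) u \<Longrightarrow> u \<in> borel_measurable borel \<Longrightarrow>
      ennreal (norm (u y - u x - kgrad u a r (y - x)) powr p)
        \<le> ennreal C * (ennreal (r powr (- (DIM('a) + p))) * (strain_at u p a r y + strain_at u p a r x)
            + ennreal (r powr (- (2 * DIM('a) + p))) * strain_on u p a r)"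
proof -
  obtain C where C: "0 < C"
    "\<And>u (a::'a) r a' r' v. 0 < r \<Longrightarrow> r' \<le> 4 * r \<Longrightarrow> ball a r \<subseteq> ball a' r' \<Longrightarrow>
      set_integrable lborel (ball a' r') u \<Longrightarrow> u \<in> borel_measurable borel \<Longrightarrow>
      ennreal (norm (kgrad u a r v + kadj u a' r' v) powr p)
        \<le> ennreal (C * r' powr (- (2 * DIM('a) + 2 * p)) * norm v powr p) * strain_on u p a' r'"
    using kgrad_kadj_powr_bound[OF p] by blast
  obtain D where D: "0 < D" "\<And>a b c. 0 \<le> a \<Longrightarrow> 0 \<le> b \<Longrightarrow> 0 \<le> c \<Longrightarrow>
    ennreal ((a + b + c) powr p) \<le> ennreal D * (ennreal (a powr p) + ennreal (b powr p) + ennreal (c powr p))"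
    using ennreal_powr_add3_le[OF p] by blast
  obtain E where E: "0 < E"
    "\<And>u (a::'a) r y. 0 < r \<Longrightarrow> u \<in> borel_measurable borel \<Longrightarrow>
      ennreal (norm (kerr u a r y) powr p) \<le> ennreal (E * r powr (- (DIM('a) + p))) * strain_at u p a r y"
    using kerr_powr_bound[OF p] by blast
  define F where "F = E + C * 2 powr p"
  have F: "0 < F" "E \<le> F" "C * 2 powr p \<le> F" using E C by (auto simp: F_def add_pos_pos)
  show thesis
  proof (rule that[of "D * F"])
    show "0 < D * F" using F D by simp
    fix u :: "'a \<Rightarrow> 'a" and a x y :: 'a and r :: real
    assume r: "0 < r" and xy: "x \<in> ball a r" "y \<in> ball a r" and u: "set_integrable lborel (ball a r) u"
      and [measurable]: "u \<in> borel_measurable borel"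
    let ?v = "y - x"
    let ?m = "norm (kgrad u a r ?v + kadj u a r ?v)"
    obtain b where b: "\<And>y. kerr u a r y = b - kadj u a r (y - a) - u y"
      using kerr_representation[OF r u] by auto
    have T: "kadj u a r (y - a) - kadj u a r (x - a) = kadj u a r (y - x)"
      using linear_diff[OF linear_kadj[OF r u], of "y - a" "x - a"] by simp
    have "u y - u x - kgrad u a r ?v = kerr u a r x - kerr u a r y - (kgrad u a r ?v + kadj u a r ?v)"
      unfolding b T[symmetric] by (simp add: algebra_simps)
    then have "norm (u y - u x - kgrad u a r ?v) \<le> norm (kerr u a r y) + norm (kerr u a r x) + ?m"
      by (smt (verit) norm_triangle_ineq4)
    then have "ennreal (norm (u y - u x - kgrad u a r ?v) powr p) \<le> ennreal ((norm (kerr u a r y) + norm (kerr u a r x) + ?m) powr p)"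
      using p by (intro ennreal_leI powr_mono2) auto
    also have "\<dots> \<le> ennreal D * (ennreal (norm (kerr u a r y) powr p) + ennreal (norm (kerr u a r x) powr p) + ennreal (?m powr p))"
      by (intro D(2)) auto
    also have "\<dots> \<le> ennreal D * (ennreal F * (ennreal (r powr (- (DIM('a) + p))) * strain_at u p a r y)
        + ennreal F * (ennreal (r powr (- (DIM('a) + p))) * strain_at u p a r x)
        + ennreal F * (ennreal (r powr (- (2 * DIM('a) + p))) * strain_on u p a r))"
    proof (intro mult_left_mono add_mono)
      have EF: "ennreal (norm (kerr u a r z) powr p) \<le> ennreal F * (ennreal (r powr (- (DIM('a) + p))) * strain_at u p a r z)" for z
      proof -
        have "ennreal (E * r powr (- (DIM('a) + p))) * strain_at u p a r z \<le> ennreal (F * r powr (- (DIM('a) + p))) * strain_at u p a r z"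
          using F by (intro mult_right_mono ennreal_leI) auto
        also have "\<dots> = ennreal F * (ennreal (r powr (- (DIM('a) + p))) * strain_at u p a r z)"
          using F by (simp add: ennreal_mult mult.assoc)
        finally show ?thesis using E(2)[OF r, of u a z] by (auto intro: order_trans)
      qed
      then show "ennreal (norm (kerr u a r y) powr p) \<le> ennreal F * (ennreal (r powr (- (DIM('a) + p))) * strain_at u p a r y)"
        "ennreal (norm (kerr u a r x) powr p) \<le> ennreal F * (ennreal (r powr (- (DIM('a) + p))) * strain_at u p a r x)" by auto
      have "norm ?v \<le> 2 * r" using xy dist_triangle3[of y x a] by (simp add: dist_norm)
      then have "norm ?v powr p \<le> (2 * r) powr p" using p by (intro powr_mono2) auto
      then have "C * r powr (- (2 * DIM('a) + 2 * p)) * norm ?v powr p \<le> C * r powr (- (2 * DIM('a) + 2 * p)) * (2 * r) powr p"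
        using C by (intro mult_left_mono) auto
      also have "\<dots> = (C * 2 powr p) * (r powr (- (2 * DIM('a) + 2 * p)) * r powr p)"
        using r by (simp add: powr_mult)
      also have "r powr (- (2 * DIM('a) + 2 * p)) * r powr p = r powr (- (2 * DIM('a) + p))"
        by (simp add: algebra_simps flip: powr_add)
      also have "(C * 2 powr p) * r powr (- (2 * DIM('a) + p)) \<le> F * r powr (- (2 * DIM('a) + p))"
        using F by (intro mult_right_mono) auto
      finally have "ennreal (C * r powr (- (2 * DIM('a) + 2 * p)) * norm ?v powr p) * strain_on u p a r
          \<le> ennreal (F * r powr (- (2 * DIM('a) + p))) * strain_on u p a r"
        by (intro mult_right_mono ennreal_leI) auto
      also have "\<dots> = ennreal F * (ennreal (r powr (- (2 * DIM('a) + p))) * strain_on u p a r)"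
        using F by (simp add: ennreal_mult mult.assoc)
      finally show "ennreal (?m powr p) \<le> ennreal F * (ennreal (r powr (- (2 * DIM('a) + p))) * strain_on u p a r)"
        using C(2)[of r r a a u ?v] r u by (auto intro: order_trans)
    qed auto
    also have "\<dots> = ennreal (D * F) * (ennreal (r powr (- (DIM('a) + p))) * (strain_at u p a r y + strain_at u p a r x)
            + ennreal (r powr (- (2 * DIM('a) + p))) * strain_on u p a r)"
      using D F by (simp add: ennreal_mult distrib_left mult_ac)
    finally show "ennreal (norm (u y - u x - kgrad u a r (y - x)) powr p) \<le> \<dots>" .
  qed
qed

section \<open>Summation over dyadic scales\<close>

lemma powr_half:
  fixes r t :: real assumes "0 < r"
  shows "(r / 2) powr t = 2 powr (- t) * r powr t" "(r / 2) powr (- t) = 2 powr t * r powr (- t)"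
  using assms by (auto simp: powr_divide powr_minus field_simps)

text \<open>Solving the recurrence for the sum would need a subtraction, which
  \<open>ennreal\<close> does not support well. Instead the invariant (1 - q) (z 0 + ... + z (K-1))
  + z K <= z 0 + g 0 + ... + g (K-1) is carried along; it survives infinite values.\<close>

lemma ennreal_suminf_geometric_recurrence:
  fixes z g :: "nat \<Rightarrow> ennreal"
  assumes q: "0 \<le> q" "q < 1" and rec: "\<And>k. z (Suc k) \<le> ennreal q * z k + g k"
  shows "(\<Sum>k. z k) \<le> ennreal (1 / (1 - q)) * (z 0 + (\<Sum>k. g k))"
proof -
  have one: "ennreal (1 - q) + ennreal q = 1" using q by (simp flip: ennreal_plus)
  have part: "ennreal (1 - q) * (\<Sum>k<K. z k) + z K \<le> z 0 + (\<Sum>k<K. g k)" for K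
  proof (induction K)
    case (Suc K)
    have "ennreal (1 - q) * (\<Sum>k<Suc K. z k) + z (Suc K)
      \<le> ennreal (1 - q) * (\<Sum>k<Suc K. z k) + (ennreal q * z K + g K)"
      by (intro add_left_mono rec)
    also have "\<dots> = ennreal (1 - q) * (\<Sum>k<K. z k) + (ennreal (1 - q) + ennreal q) * z K + g K"
      by (simp add: distrib_left distrib_right add_ac)
    also have "\<dots> \<le> z 0 + (\<Sum>k<K. g k) + g K" unfolding one using Suc.IH by (simp add: add_right_mono)
    finally show ?case by (simp add: add_ac)
  qed simp
  have "(\<Sum>k<K. z k) \<le> ennreal (1 / (1 - q)) * (z 0 + (\<Sum>k. g k))" for K
  proof -
    have "(\<Sum>k<K. z k) = ennreal (1 / (1 - q)) * (ennreal (1 - q) * (\<Sum>k<K. z k))"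
      using q by (simp add: mult.assoc[symmetric] flip: ennreal_mult)
    also have "\<dots> \<le> ennreal (1 / (1 - q)) * (z 0 + (\<Sum>k<K. g k))"
      using part[of K] by (intro mult_left_mono) (auto intro: order_trans[OF _ part[of K]])
    also have "\<dots> \<le> ennreal (1 / (1 - q)) * (z 0 + (\<Sum>k. g k))"
      by (intro mult_left_mono add_left_mono sum_le_suminf) auto
    finally show ?thesis .
  qed
  then show ?thesis unfolding suminf_eq_SUP by (intro SUP_least)
qed

lemma ennreal_le_suminf: "f k \<le> (\<Sum>k. f k :: ennreal)"
  using sum_le_suminf[of f "{k}"] by simp

lemma obtain_dyadic:
  fixes d R :: real assumes "0 < d" "d < R"
  obtains k where "R / 2 ^ Suc k \<le> d" "d < R / 2 ^ k"
proof -
  obtain m where "(1/2::real) ^ m < d / R" using real_arch_pow_inv[of "d/R" "1/2"] assms by auto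
  then have m: "R / 2 ^ m \<le> d" using assms by (simp add: field_simps)
  define j where "j = (LEAST m. R / 2 ^ m \<le> d)"
  have j: "R / 2 ^ j \<le> d" unfolding j_def by (rule LeastI[of _ m]) (rule m)
  have "j \<noteq> 0" using j assms by (intro notI) simp
  then obtain k where k: "j = Suc k" by (cases j) auto
  then have "\<not> R / 2 ^ k \<le> d" using not_less_Least[of k "\<lambda>m. R / 2 ^ m \<le> d"] by (auto simp: j_def[symmetric])
  with j k show thesis by (intro that[of k]) auto
qed

text \<open>Passing to the next smaller ball multiplies the bound by a factor \<mu> > 1 and adds a
  strain term, while the weight, a positive power (1 - s) p of the radius, shrinks by a fixed
  factor. \<open>Z k\<close> is valid for all v at once and stands in for the p-th power of an
  operator norm.\<close>

lemma dyadic_gradient_bound: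
  fixes p s :: real assumes p: "1 < p" and s: "0 < s" "s < 1"
  obtains C where "0 < C"
   "\<And>u (x::'a::euclidean_space) R A F. 0 < R \<Longrightarrow> set_integrable lborel (ball x R) u \<Longrightarrow> u \<in> borel_measurable borel \<Longrightarrow>
     (\<And>v. ennreal (norm (kgrad u x R v - A v) powr p) \<le> F * ennreal (norm v powr p)) \<Longrightarrow>
     \<exists>Z. (\<forall>k v. ennreal (norm (kgrad u x (R / 2 ^ k) v - A v) powr p) \<le> Z k * ennreal (norm v powr p)) \<and>
       (\<Sum>k. ennreal ((R / 2 ^ k) powr ((1 - s) * p)) * Z k)
         \<le> ennreal C * (ennreal (R powr ((1 - s) * p)) * F
              + (\<Sum>k. ennreal ((R / 2 ^ k) powr (- (2 * DIM('a) + p + s * p))) * strain_on u p x (R / 2 ^ k)))"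
proof -
  obtain B where B: "0 < B"
    "\<And>u (a::'a) r a' r' v. 0 < r \<Longrightarrow> r' \<le> 4 * r \<Longrightarrow> ball a r \<subseteq> ball a' r' \<Longrightarrow>
      set_integrable lborel (ball a' r') u \<Longrightarrow> u \<in> borel_measurable borel \<Longrightarrow>
      ennreal (norm (kgrad u a r v - kgrad u a' r' v) powr p)
        \<le> ennreal (B * r' powr (- (2 * DIM('a) + 2 * p)) * norm v powr p) * strain_on u p a' r'"
    using kgrad_diff_powr_bound[OF p] by blast
  define \<theta> where "\<theta> = (1 - s) * p"
  have \<theta>: "\<theta> > 0" using p s by (simp add: \<theta>_def)
  \<comment> \<open>Half of the decay 2^(-\<theta>) of the weight per step is spent on \<mu>; the
    other half, q < 1, makes the series converge.\<close>
  define \<mu> where "\<mu> = 2 powr (\<theta> / 2)"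
  define q where "q = 2 powr (- \<theta> / 2)"
  have \<mu>: "1 < \<mu>" using \<theta> by (simp add: \<mu>_def)
  have q: "0 \<le> q" "q < 1" using \<theta> powr_less_mono[of "-\<theta>/2" 0 "2::real"] by (auto simp: q_def)
  have \<mu>q: "2 powr (- \<theta>) * \<mu> = q" by (simp add: \<mu>_def q_def flip: powr_add)
  obtain D where D: "0 < D" "\<And>a b. 0 \<le> a \<Longrightarrow> 0 \<le> b \<Longrightarrow> (a + b) powr p \<le> \<mu> * a powr p + D * b powr p"
    using powr_add_le_weighted[OF p \<mu>] by blast
  define C where "C = 1 / (1 - q) * (1 + D * B)"
  have DB: "0 < D * B" using D B by simp
  have C: "0 < C" unfolding C_def using q DB by (intro mult_pos_pos) auto
  show thesis
  proof (rule that[OF C])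
    fix u :: "'a \<Rightarrow> 'a" and x :: 'a and R A F
    assume R: "0 < R" and u: "set_integrable lborel (ball x R) u" and [measurable]: "u \<in> borel_measurable borel"
      and F: "\<And>v. ennreal (norm (kgrad u x R v - A v) powr p) \<le> F * ennreal (norm v powr p)"
    define \<rho> where "\<rho> k = R / 2 ^ k" for k :: nat
    have \<rho>: "0 < \<rho> k" "\<rho> k \<le> R" "\<rho> (Suc k) = \<rho> k / 2" for k
      using R by (auto simp: \<rho>_def field_simps)
    define h where "h k = ennreal (\<rho> k powr (- (2 * DIM('a) + 2 * p))) * strain_on u p x (\<rho> k)" for k
    define Z where "Z = rec_nat F (\<lambda>k z. ennreal \<mu> * z + ennreal (D * B) * h k)"
    have Z: "Z 0 = F" "Z (Suc k) = ennreal \<mu> * Z k + ennreal (D * B) * h k" for k by (auto simp: Z_def)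
    have grad: "ennreal (norm (kgrad u x (\<rho> k) v - A v) powr p) \<le> Z k * ennreal (norm v powr p)" for k v
    proof (induction k)
      case 0 show ?case using F by (simp add: \<rho>_def Z)
    next
      case (Suc k)
      let ?a = "norm (kgrad u x (\<rho> k) v - A v)" and ?b = "norm (kgrad u x (\<rho> (Suc k)) v - kgrad u x (\<rho> k) v)"
      have "norm (kgrad u x (\<rho> (Suc k)) v - A v) \<le> ?a + ?b"
        using norm_triangle_ineq[of "kgrad u x (\<rho> k) v - A v" "kgrad u x (\<rho> (Suc k)) v - kgrad u x (\<rho> k) v"] by simp
      then have "norm (kgrad u x (\<rho> (Suc k)) v - A v) powr p \<le> (?a + ?b) powr p"
        using p by (intro powr_mono2) auto
      also have "\<dots> \<le> \<mu> * ?a powr p + D * ?b powr p" by (intro D(2)) auto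
      finally have "ennreal (norm (kgrad u x (\<rho> (Suc k)) v - A v) powr p) \<le> ennreal (\<mu> * ?a powr p + D * ?b powr p)"
        by (rule ennreal_leI)
      also have "\<dots> = ennreal \<mu> * ennreal (?a powr p) + ennreal D * ennreal (?b powr p)"
        using \<mu> D by (simp add: ennreal_mult)
      also have "\<dots> \<le> ennreal \<mu> * (Z k * ennreal (norm v powr p))
          + ennreal D * (ennreal (B * \<rho> k powr (- (2 * DIM('a) + 2 * p)) * norm v powr p) * strain_on u p x (\<rho> k))"
      proof (intro add_mono mult_left_mono Suc.IH B(2))
        show "set_integrable lborel (ball x (\<rho> k)) u"
          by (rule set_integrable_subset[OF u]) (simp_all add: subset_ball \<rho>(2))
      qed (use \<rho>[of k] in auto)
      also have "\<dots> = Z (Suc k) * ennreal (norm v powr p)"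
        using D B by (simp add: Z h_def ennreal_mult distrib_left distrib_right mult_ac)
      finally show ?case .
    qed
    define z where "z k = ennreal (\<rho> k powr \<theta>) * Z k" for k
    define G where "G k = ennreal (\<rho> k powr (- (2 * DIM('a) + p + s * p))) * strain_on u p x (\<rho> k)" for k
    have rec: "z (Suc k) \<le> ennreal q * z k + ennreal (D * B) * G k" for k
    proof -
      have e: "\<rho> (Suc k) powr \<theta> = 2 powr (- \<theta>) * \<rho> k powr \<theta>"
        unfolding \<rho>(3) by (rule powr_half[OF \<rho>(1)])
      have "z (Suc k) = ennreal (\<rho> (Suc k) powr \<theta> * \<mu>) * Z k + ennreal (\<rho> (Suc k) powr \<theta> * (D * B) * \<rho> k powr (- (2 * DIM('a) + 2 * p))) * strain_on u p x (\<rho> k)"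
        using D B \<mu> by (simp add: z_def Z h_def distrib_left ennreal_mult mult_ac)
      also have "\<rho> (Suc k) powr \<theta> * \<mu> = q * \<rho> k powr \<theta>" using \<mu>q by (simp add: e mult_ac)
      also have "\<rho> (Suc k) powr \<theta> * (D * B) * \<rho> k powr (- (2 * DIM('a) + 2 * p))
         = 2 powr (- \<theta>) * (D * B * (\<rho> k powr \<theta> * \<rho> k powr (- (2 * DIM('a) + 2 * p))))" by (simp add: e mult_ac)
      also have "\<rho> k powr \<theta> * \<rho> k powr (- (2 * DIM('a) + 2 * p)) = \<rho> k powr (- (2 * DIM('a) + p + s * p))"
        by (simp add: \<theta>_def algebra_simps flip: powr_add)
      also have "ennreal (q * \<rho> k powr \<theta>) * Z k + ennreal (2 powr (- \<theta>) * (D * B * \<rho> k powr (- (2 * DIM('a) + p + s * p)))) * strain_on u p x (\<rho> k)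
        \<le> ennreal (q * \<rho> k powr \<theta>) * Z k + ennreal (1 * (D * B * \<rho> k powr (- (2 * DIM('a) + p + s * p)))) * strain_on u p x (\<rho> k)"
        using D B \<theta> powr_mono[of "-\<theta>" 0 "2::real"] by (intro add_left_mono mult_right_mono ennreal_leI) auto
      also have "\<dots> = ennreal q * z k + ennreal (D * B) * G k"
        using q D B by (simp add: z_def G_def ennreal_mult mult_ac)
      finally show ?thesis .
    qed
    have "(\<Sum>k. z k) \<le> ennreal (1 / (1 - q)) * (z 0 + (\<Sum>k. ennreal (D * B) * G k))"
      by (intro ennreal_suminf_geometric_recurrence q rec)
    also have "\<dots> \<le> ennreal (1 / (1 - q)) * (ennreal (1 + D * B) * z 0 + ennreal (1 + D * B) * (\<Sum>k. G k))"
    proof (intro mult_left_mono add_mono)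
      show "z 0 \<le> ennreal (1 + D * B) * z 0" using DB mult_right_mono[of 1 "ennreal (1 + D * B)" "z 0"] by simp
      show "(\<Sum>k. ennreal (D * B) * G k) \<le> ennreal (1 + D * B) * (\<Sum>k. G k)"
        by (simp only: ennreal_suminf_cmult) (intro mult_right_mono ennreal_leI, auto)
    qed auto
    also have "\<dots> = ennreal C * (z 0 + (\<Sum>k. G k))"
      using q DB unfolding C_def by (subst ennreal_mult) (auto simp: distrib_left distrib_right mult.assoc)
    finally have "(\<Sum>k. z k) \<le> ennreal C * (z 0 + (\<Sum>k. G k))" .
    moreover have "z 0 = ennreal (R powr \<theta>) * F" by (simp add: z_def Z \<rho>_def)
    ultimately show "\<exists>Z. (\<forall>k v. ennreal (norm (kgrad u x (R / 2 ^ k) v - A v) powr p) \<le> Z k * ennreal (norm v powr p)) \<and>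
       (\<Sum>k. ennreal ((R / 2 ^ k) powr ((1 - s) * p)) * Z k)
         \<le> ennreal C * (ennreal (R powr ((1 - s) * p)) * F
              + (\<Sum>k. ennreal ((R / 2 ^ k) powr (- (2 * DIM('a) + p + s * p))) * strain_on u p x (R / 2 ^ k)))"
      using grad by (intro exI[of _ Z]) (simp add: z_def G_def \<rho>_def \<theta>_def)
  qed
qed

text \<open>The ball is split into annuli between consecutive radii \<rho>. On the k-th one the
  singular weight is at most \<open>e k\<close>, and the numerator is handled by the local Korn
  inequality on the ball of radius \<open>\<rho> k\<close> together with the deviation bound
  \<open>Z k\<close>. Integration in y turns the pointwise strain into the double integral.\<close>

lemma dyadic_estimate:
  fixes p s :: real assumes p: "1 < p" and s: "0 < s" "s < 1"
  obtains C where "0 < C"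
   "\<And>u (x::'a::euclidean_space) R A F. 0 < R \<Longrightarrow> set_integrable lborel (ball x R) u \<Longrightarrow> u \<in> borel_measurable borel \<Longrightarrow>
     (\<And>v. ennreal (norm (kgrad u x R v - A v) powr p) \<le> F * ennreal (norm v powr p)) \<Longrightarrow>
     (\<integral>\<^sup>+y\<in>ball x R. ennreal (norm (u y - u x - A (y - x)) powr p / norm (y - x) powr (DIM('a) + s * p)) \<partial>lborel)
      \<le> ennreal C * (ennreal (R powr ((1 - s) * p)) * F
          + (\<Sum>k. ennreal ((R / 2 ^ k) powr (- (2 * DIM('a) + p + s * p))) * strain_on u p x (R / 2 ^ k))
          + (\<Sum>k. ennreal ((R / 2 ^ k) powr (- (DIM('a) + p + s * p))) * strain_at u p x (R / 2 ^ k) x))"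
proof -
  obtain C1 where C1: "0 < C1"
    "\<And>u (x::'a::euclidean_space) R A F. 0 < R \<Longrightarrow> set_integrable lborel (ball x R) u \<Longrightarrow> u \<in> borel_measurable borel \<Longrightarrow>
     (\<And>v. ennreal (norm (kgrad u x R v - A v) powr p) \<le> F * ennreal (norm v powr p)) \<Longrightarrow>
     \<exists>Z. (\<forall>k v. ennreal (norm (kgrad u x (R / 2 ^ k) v - A v) powr p) \<le> Z k * ennreal (norm v powr p)) \<and>
       (\<Sum>k. ennreal ((R / 2 ^ k) powr ((1 - s) * p)) * Z k)
         \<le> ennreal C1 * (ennreal (R powr ((1 - s) * p)) * F
              + (\<Sum>k. ennreal ((R / 2 ^ k) powr (- (2 * DIM('a) + p + s * p))) * strain_on u p x (R / 2 ^ k)))"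
    using dyadic_gradient_bound[OF p s] by blast
  obtain C2 where C2: "0 < C2"
    "\<And>u (a::'a::euclidean_space) r x y. 0 < r \<Longrightarrow> x \<in> ball a r \<Longrightarrow> y \<in> ball a r \<Longrightarrow>
      set_integrable lborel (ball a r) u \<Longrightarrow> u \<in> borel_measurable borel \<Longrightarrow>
      ennreal (norm (u y - u x - kgrad u a r (y - x)) powr p)
        \<le> ennreal C2 * (ennreal (r powr (- (DIM('a) + p))) * (strain_at u p a r y + strain_at u p a r x)
            + ennreal (r powr (- (2 * DIM('a) + p))) * strain_on u p a r)"
    using local_korn[OF p] by blast
  obtain D where D: "0 < D" "\<And>a b c. 0 \<le> a \<Longrightarrow> 0 \<le> b \<Longrightarrow> 0 \<le> c \<Longrightarrow>
    ennreal ((a + b + c) powr p) \<le> ennreal D * (ennreal (a powr p) + ennreal (b powr p) + ennreal (c powr p))"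
    using ennreal_powr_add3_le[OF p] by blast
  define w where "w = measure lborel (ball (0::'a) 1)"
  have w: "0 < w" by (simp add: w_def content_ball_pos)
  define E where "E = D * (1 + C2) * (1 + w) * 2 powr (DIM('a) + s * p)"
  have E: "0 < E" unfolding E_def using D C2 w by (intro mult_pos_pos) auto
  define C where "C = E * (2 + C1)"
  have C: "0 < C" using E C1 by (simp add: C_def add_pos_pos)
  show thesis
  proof (rule that[OF C])
    fix u :: "'a \<Rightarrow> 'a" and x :: 'a and R A F
    assume R: "0 < R" and u: "set_integrable lborel (ball x R) u" and [measurable]: "u \<in> borel_measurable borel"
      and F: "\<And>v. ennreal (norm (kgrad u x R v - A v) powr p) \<le> F * ennreal (norm v powr p)"
    define \<rho> where "\<rho> k = R / 2 ^ k" for k :: nat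
    have \<rho>: "0 < \<rho> k" "\<rho> k \<le> R" "\<rho> (Suc k) = \<rho> k / 2" for k
      using R by (auto simp: \<rho>_def field_simps)
    obtain Z where Z: "\<And>k v. ennreal (norm (kgrad u x (\<rho> k) v - A v) powr p) \<le> Z k * ennreal (norm v powr p)"
      "(\<Sum>k. ennreal (\<rho> k powr ((1 - s) * p)) * Z k) \<le> ennreal C1 * (ennreal (R powr ((1 - s) * p)) * F
              + (\<Sum>k. ennreal (\<rho> k powr (- (2 * DIM('a) + p + s * p))) * strain_on u p x (\<rho> k)))"
      using C1(2)[OF R u _ F] by (auto simp: \<rho>_def)
    define S where "S k = strain_on u p x (\<rho> k)" for k
    define P where "P k = strain_at u p x (\<rho> k) x" for k
    \<comment> \<open>\<open>\<alpha> k\<close> collects the part of the bound on the k-th ball that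
      does not depend on y; \<open>\<gamma> k\<close> is the coefficient of the part that
      does.\<close>
    define \<alpha> where "\<alpha> k = ennreal D * (Z k * ennreal (\<rho> k powr p))
        + ennreal D * (ennreal C2 * (ennreal (\<rho> k powr (- (DIM('a) + p))) * P k + ennreal (\<rho> k powr (- (2 * DIM('a) + p))) * S k))" for k
    define \<gamma> where "\<gamma> k = ennreal D * (ennreal C2 * ennreal (\<rho> k powr (- (DIM('a) + p))))" for k
    define e where "e k = \<rho> (Suc k) powr (- (DIM('a) + s * p))" for k
    have U: "ennreal (norm (u y - u x - A (y - x)) powr p) \<le> \<alpha> k + \<gamma> k * strain_at u p x (\<rho> k) y"
      if y: "y \<in> ball x (\<rho> k)" for y k
    proof -
      let ?a = "norm (kgrad u x (\<rho> k) (y - x) - A (y - x))" and ?b = "norm (u y - u x - kgrad u x (\<rho> k) (y - x))"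
      have "norm (u y - u x - A (y - x)) \<le> ?a + ?b + 0"
        using norm_triangle_ineq[of "kgrad u x (\<rho> k) (y - x) - A (y - x)" "u y - u x - kgrad u x (\<rho> k) (y - x)"] by simp
      then have "ennreal (norm (u y - u x - A (y - x)) powr p) \<le> ennreal ((?a + ?b + 0) powr p)"
        using p by (intro ennreal_leI powr_mono2) auto
      also have "\<dots> \<le> ennreal D * (ennreal (?a powr p) + ennreal (?b powr p) + ennreal (0 powr p))"
        by (intro D(2)) auto
      also have "\<dots> \<le> ennreal D * (Z k * ennreal (\<rho> k powr p) + ennreal C2 * (ennreal (\<rho> k powr (- (DIM('a) + p))) * (strain_at u p x (\<rho> k) y + P k)
            + ennreal (\<rho> k powr (- (2 * DIM('a) + p))) * S k) + 0)"
      proof (intro mult_left_mono add_mono)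
        have "norm (y - x) powr p \<le> \<rho> k powr p"
          using y p by (intro powr_mono2) (auto simp: dist_norm norm_minus_commute)
        then show "ennreal (?a powr p) \<le> Z k * ennreal (\<rho> k powr p)"
          by (intro order_trans[OF Z(1)] mult_left_mono ennreal_leI) auto
        have "set_integrable lborel (ball x (\<rho> k)) u"
          by (rule set_integrable_subset[OF u]) (simp_all add: subset_ball \<rho>(2))
        then show "ennreal (?b powr p) \<le> ennreal C2 * (ennreal (\<rho> k powr (- (DIM('a) + p))) * (strain_at u p x (\<rho> k) y + P k)
            + ennreal (\<rho> k powr (- (2 * DIM('a) + p))) * S k)"
          unfolding P_def S_def using \<rho>[of k] y by (intro C2(2)) auto
      qed auto
      also have "\<dots> = \<alpha> k + \<gamma> k * strain_at u p x (\<rho> k) y"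
        by (simp add: \<alpha>_def \<gamma>_def distrib_left mult_ac add_ac)
      finally show ?thesis .
    qed
    \<comment> \<open>Integrating over the ball adds n to the exponents of the terms free of y, and
      the weight subtracts n + s p. The double integral \<open>S k\<close> arises twice with the
      same exponent, from the local Korn inequality and from integrating the strain at y; hence the
      factor 2.\<close>
    have scale_term: "ennreal (e k) * (\<alpha> k * emeasure lborel (ball x (\<rho> k)) + \<gamma> k * S k)
        \<le> ennreal E * (ennreal (\<rho> k powr ((1 - s) * p)) * Z k + 2 * (ennreal (\<rho> k powr (- (2 * DIM('a) + p + s * p))) * S k)
           + ennreal (\<rho> k powr (- (DIM('a) + p + s * p))) * P k)" for k
    proof -
      let ?r = "\<rho> k" and ?n = "real DIM('a)"
      have r: "0 < ?r" by (rule \<rho>)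
      have ek: "e k = 2 powr (?n + s * p) * ?r powr (- (?n + s * p))"
        unfolding e_def \<rho>(3) by (rule powr_half[OF r])
      have em: "emeasure lborel (ball x ?r) = ennreal (?r powr ?n * w)"
        using r by (simp add: emeasure_ball_eq w_def powr_realpow)
      have "ennreal (e k) * (\<alpha> k * emeasure lborel (ball x ?r) + \<gamma> k * S k)
        = ennreal (e k * D * w * (?r powr p * ?r powr ?n)) * Z k
          + ennreal (e k * D * C2 * w * (?r powr (- (?n + p)) * ?r powr ?n)) * P k
          + (ennreal (e k * D * C2 * w * (?r powr (- (2 * ?n + p)) * ?r powr ?n)) * S k
          + ennreal (e k * D * C2 * ?r powr (- (?n + p))) * S k)"
        using D C2 w by (simp add: em \<alpha>_def \<gamma>_def e_def ennreal_mult distrib_left distrib_right mult_ac add_ac)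
      also have "\<dots> \<le> ennreal (E * ?r powr ((1 - s) * p)) * Z k
          + ennreal (E * ?r powr (- (?n + p + s * p))) * P k
          + (ennreal (E * ?r powr (- (2 * ?n + p + s * p))) * S k
          + ennreal (E * ?r powr (- (2 * ?n + p + s * p))) * S k)"
      proof (intro add_mono mult_right_mono ennreal_leI)
        have a1: "D * w \<le> D * (1 + C2) * (1 + w)" and a2: "D * C2 * w \<le> D * (1 + C2) * (1 + w)"
          and a3: "D * C2 \<le> D * (1 + C2) * (1 + w)"
          using D C2 w by (auto simp: algebra_simps)
        have key: "e k * c * ?r powr t \<le> E * ?r powr t'" if "c \<le> D * (1 + C2) * (1 + w)" "t' = t - (?n + s * p)" for c t t'
        proof -
          have "e k * c * ?r powr t = (c * 2 powr (?n + s * p)) * (?r powr (- (?n + s * p)) * ?r powr t)" by (simp add: ek mult_ac)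
          also have "?r powr (- (?n + s * p)) * ?r powr t = ?r powr t'"
          proof -
            have "- (?n + s * p) + t = t'" using that(2) by simp
            then show ?thesis by (simp only: powr_add[symmetric])
          qed
          also have "(c * 2 powr (?n + s * p)) * ?r powr t' \<le> E * ?r powr t'"
            unfolding E_def using that by (intro mult_right_mono) auto
          finally show ?thesis .
        qed
        show "e k * D * w * (?r powr p * ?r powr ?n) \<le> E * ?r powr ((1 - s) * p)"
          using key[of "D * w" "(1 - s) * p" "p + ?n"] a1 by (simp add: algebra_simps powr_add)
        show "e k * D * C2 * w * (?r powr (- (?n + p)) * ?r powr ?n) \<le> E * ?r powr (- (?n + p + s * p))"
          using key[of "D * C2 * w" "- (?n + p + s * p)" "- (?n + p) + ?n"] a2 unfolding powr_add[symmetric] by (simp add: mult.assoc)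
        show "e k * D * C2 * w * (?r powr (- (2 * ?n + p)) * ?r powr ?n) \<le> E * ?r powr (- (2 * ?n + p + s * p))"
          using key[of "D * C2 * w" "- (2 * ?n + p + s * p)" "- (2 * ?n + p) + ?n"] a2 unfolding powr_add[symmetric] by (simp add: mult.assoc)
        show "e k * D * C2 * ?r powr (- (?n + p)) \<le> E * ?r powr (- (2 * ?n + p + s * p))"
          using key[of "D * C2" "- (2 * ?n + p + s * p)" "- (?n + p)"] a3 by (simp add: mult.assoc)
      qed auto
      also have "\<dots> = ennreal E * (ennreal (\<rho> k powr ((1 - s) * p)) * Z k + 2 * (ennreal (\<rho> k powr (- (2 * DIM('a) + p + s * p))) * S k)
           + ennreal (\<rho> k powr (- (DIM('a) + p + s * p))) * P k)"
        using E by (simp add: ennreal_mult distrib_left mult_ac add_ac mult_2[symmetric])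
      finally show ?thesis .
    qed
    have "(\<integral>\<^sup>+y\<in>ball x R. ennreal (norm (u y - u x - A (y - x)) powr p / norm (y - x) powr (DIM('a) + s * p)) \<partial>lborel)
      \<le> (\<integral>\<^sup>+y. (\<Sum>k. ennreal (e k) * ((\<alpha> k + \<gamma> k * strain_at u p x (\<rho> k) y) * indicator (ball x (\<rho> k)) y)) \<partial>lborel)"
    proof (rule nn_integral_mono)
      fix y
      show "ennreal (norm (u y - u x - A (y - x)) powr p / norm (y - x) powr (DIM('a) + s * p)) * indicator (ball x R) y
        \<le> (\<Sum>k. ennreal (e k) * ((\<alpha> k + \<gamma> k * strain_at u p x (\<rho> k) y) * indicator (ball x (\<rho> k)) y))"
      \<comment> \<open>At y = x the quotient has denominator 0 and is 0 by convention, whatever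
        \<open>A 0\<close> is.\<close>
      proof (cases "y \<in> ball x R \<and> y \<noteq> x")
        case True
        then have "0 < norm (y - x)" "norm (y - x) < R" by (auto simp: dist_norm norm_minus_commute)
        then obtain k where k: "\<rho> (Suc k) \<le> norm (y - x)" "norm (y - x) < \<rho> k"
          using obtain_dyadic unfolding \<rho>_def by metis
        have yk: "y \<in> ball x (\<rho> k)" using k by (simp add: dist_norm norm_minus_commute)
        have "0 \<le> s * p" using p s by simp
        then have "- (DIM('a) + s * p) \<le> 0" using of_nat_0_le_iff[of "DIM('a)", where 'a=real] by linarith
        then have "norm (y - x) powr (- (DIM('a) + s * p)) \<le> e k"
          unfolding e_def using k(1) \<rho>(1)[of "Suc k"] by - (rule powr_mono2')
        then have "inverse (norm (y - x) powr (DIM('a) + s * p)) \<le> e k" by (simp only: powr_minus)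
        then have "norm (u y - u x - A (y - x)) powr p * inverse (norm (y - x) powr (DIM('a) + s * p)) \<le> norm (u y - u x - A (y - x)) powr p * e k"
          by (intro mult_left_mono) auto
        then have "norm (u y - u x - A (y - x)) powr p / norm (y - x) powr (DIM('a) + s * p) \<le> e k * norm (u y - u x - A (y - x)) powr p"
          by (simp only: divide_inverse mult.commute)
        then have "ennreal (norm (u y - u x - A (y - x)) powr p / norm (y - x) powr (DIM('a) + s * p))
           \<le> ennreal (e k) * ennreal (norm (u y - u x - A (y - x)) powr p)"
          by (simp add: e_def ennreal_leI flip: ennreal_mult)
        also have "\<dots> \<le> ennreal (e k) * ((\<alpha> k + \<gamma> k * strain_at u p x (\<rho> k) y) * indicator (ball x (\<rho> k)) y)"
          using U[OF yk] yk by (intro mult_left_mono) auto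
        also have "\<dots> \<le> (\<Sum>k. ennreal (e k) * ((\<alpha> k + \<gamma> k * strain_at u p x (\<rho> k) y) * indicator (ball x (\<rho> k)) y))"
          by (rule ennreal_le_suminf)
        finally show ?thesis using True by simp
      qed auto
    qed
    also have "\<dots> = (\<Sum>k. \<integral>\<^sup>+y. ennreal (e k) * ((\<alpha> k + \<gamma> k * strain_at u p x (\<rho> k) y) * indicator (ball x (\<rho> k)) y) \<partial>lborel)"
      by (rule nn_integral_suminf) measurable
    also have "\<dots> = (\<Sum>k. ennreal (e k) * (\<alpha> k * emeasure lborel (ball x (\<rho> k)) + \<gamma> k * S k))"
    proof (intro suminf_cong)
      fix k
      have "(\<integral>\<^sup>+y. ennreal (e k) * ((\<alpha> k + \<gamma> k * strain_at u p x (\<rho> k) y) * indicator (ball x (\<rho> k)) y) \<partial>lborel)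
        = ennreal (e k) * (\<integral>\<^sup>+y. \<alpha> k * indicator (ball x (\<rho> k)) y + \<gamma> k * (strain_at u p x (\<rho> k) y * indicator (ball x (\<rho> k)) y) \<partial>lborel)"
        by (subst nn_integral_cmult[symmetric]) (auto simp: distrib_right mult.assoc)
      also have "(\<integral>\<^sup>+y. \<alpha> k * indicator (ball x (\<rho> k)) y + \<gamma> k * (strain_at u p x (\<rho> k) y * indicator (ball x (\<rho> k)) y) \<partial>lborel)
        = \<alpha> k * emeasure lborel (ball x (\<rho> k)) + \<gamma> k * S k"
        unfolding S_def strain_on_def
        by (subst nn_integral_add) (auto simp: nn_integral_cmult_indicator nn_integral_cmult)
      finally show "(\<integral>\<^sup>+y. ennreal (e k) * ((\<alpha> k + \<gamma> k * strain_at u p x (\<rho> k) y) * indicator (ball x (\<rho> k)) y) \<partial>lborel)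
        = ennreal (e k) * (\<alpha> k * emeasure lborel (ball x (\<rho> k)) + \<gamma> k * S k)" .
    qed
    also have "\<dots> \<le> (\<Sum>k. ennreal E * (ennreal (\<rho> k powr ((1 - s) * p)) * Z k + 2 * (ennreal (\<rho> k powr (- (2 * DIM('a) + p + s * p))) * S k)
           + ennreal (\<rho> k powr (- (DIM('a) + p + s * p))) * P k))"
      by (intro suminf_le scale_term) auto
    also have "\<dots> = ennreal E * ((\<Sum>k. ennreal (\<rho> k powr ((1 - s) * p)) * Z k) + 2 * (\<Sum>k. ennreal (\<rho> k powr (- (2 * DIM('a) + p + s * p))) * S k)
           + (\<Sum>k. ennreal (\<rho> k powr (- (DIM('a) + p + s * p))) * P k))"
      by (simp only: ennreal_suminf_cmult suminf_add[symmetric] summableI)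
    also have "\<dots> \<le> ennreal E * ((ennreal C1 * (ennreal (R powr ((1 - s) * p)) * F
              + (\<Sum>k. ennreal (\<rho> k powr (- (2 * DIM('a) + p + s * p))) * S k))) + 2 * (\<Sum>k. ennreal (\<rho> k powr (- (2 * DIM('a) + p + s * p))) * S k)
           + (\<Sum>k. ennreal (\<rho> k powr (- (DIM('a) + p + s * p))) * P k))"
      using Z(2) unfolding S_def by (intro mult_left_mono add_right_mono) auto
    also have "\<dots> \<le> ennreal E * (ennreal (2 + C1) * (ennreal (R powr ((1 - s) * p)) * F
              + (\<Sum>k. ennreal (\<rho> k powr (- (2 * DIM('a) + p + s * p))) * S k)
           + (\<Sum>k. ennreal (\<rho> k powr (- (DIM('a) + p + s * p))) * P k)))"
    proof (rule mult_left_mono)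
      have gen: "c * (f + a) + 2 * a + b \<le> (2 + c) * (f + a + b)" for a b c f :: ennreal
      proof -
        have "c * (f + a) + 2 * a + b \<le> c * (f + a) + 2 * a + (b + (b + (2 * f + c * b)))"
          by (intro add_left_mono) simp
        also have "\<dots> = (2 + c) * (f + a + b)" by (simp add: distrib_left distrib_right mult_2 add_ac)
        finally show ?thesis .
      qed
      have c: "ennreal (2 + C1) = 2 + ennreal C1" using C1 by simp
      show "(ennreal C1 * (ennreal (R powr ((1 - s) * p)) * F
              + (\<Sum>k. ennreal (\<rho> k powr (- (2 * DIM('a) + p + s * p))) * S k))) + 2 * (\<Sum>k. ennreal (\<rho> k powr (- (2 * DIM('a) + p + s * p))) * S k)
           + (\<Sum>k. ennreal (\<rho> k powr (- (DIM('a) + p + s * p))) * P k) \<le> ennreal (2 + C1) * (ennreal (R powr ((1 - s) * p)) * F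
              + (\<Sum>k. ennreal (\<rho> k powr (- (2 * DIM('a) + p + s * p))) * S k)
           + (\<Sum>k. ennreal (\<rho> k powr (- (DIM('a) + p + s * p))) * P k))"
        unfolding c by (rule gen)
    qed simp
    also have "\<dots> = ennreal C * (ennreal (R powr ((1 - s) * p)) * F
              + (\<Sum>k. ennreal (\<rho> k powr (- (2 * DIM('a) + p + s * p))) * S k)
           + (\<Sum>k. ennreal (\<rho> k powr (- (DIM('a) + p + s * p))) * P k))"
      using E C1 unfolding C_def by (subst ennreal_mult) (auto simp: mult.assoc)
    finally show "(\<integral>\<^sup>+y\<in>ball x R. ennreal (norm (u y - u x - A (y - x)) powr p / norm (y - x) powr (DIM('a) + s * p)) \<partial>lborel)
      \<le> ennreal C * (ennreal (R powr ((1 - s) * p)) * F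
          + (\<Sum>k. ennreal ((R / 2 ^ k) powr (- (2 * DIM('a) + p + s * p))) * strain_on u p x (R / 2 ^ k))
          + (\<Sum>k. ennreal ((R / 2 ^ k) powr (- (DIM('a) + p + s * p))) * strain_at u p x (R / 2 ^ k) x))"
      by (simp only: S_def P_def \<rho>_def)
  qed
qed

section \<open>Integrals of powers of the distance to a set\<close>

lemma infdist_measurable [measurable (raw)]:
  fixes f :: "'b \<Rightarrow> 'a::euclidean_space"
  assumes [measurable]: "f \<in> borel_measurable M"
  shows "(\<lambda>x. infdist (f x) E) \<in> borel_measurable M"
proof -
  have "(\<lambda>x. infdist x E) \<in> borel_measurable borel"
    by (intro borel_measurable_continuous_onI continuous_intros)
  from measurable_compose[OF assms this] show ?thesis .
qed

section \<open>Covering numbers and the Assouad dimension\<close>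

lemma cover_number_le_card:
  assumes "finite S" "F \<subseteq> (\<Union>c\<in>S. ball c r)"
  shows "cover_number r F \<le> card S"
  unfolding cover_number_def using assms by (intro Least_le) auto

text \<open>Boundedness makes the set under \<open>LEAST\<close> nonempty; for a set without finite
  covers the value of \<open>cover_number\<close> would be unspecified.\<close>

lemma cover_number_attained:
  fixes F :: "'a::euclidean_space set"
  assumes "bounded F" "0 < r"
  obtains S where "finite S" "card S = cover_number r F" "F \<subseteq> (\<Union>c\<in>S. ball c r)"
proof -
  have "compact (closure F)" using assms by (simp add: compact_closure)
  then obtain S where "finite S" "closure F \<subseteq> (\<Union>c\<in>S. ball c r)"
    using assms(2) by (metis compact_eq_totally_bounded)
  then have "\<exists>k. \<exists>S. finite S \<and> card S = k \<and> F \<subseteq> (\<Union>c\<in>S. ball c r)"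
    using closure_subset by blast
  then have "\<exists>S. finite S \<and> card S = cover_number r F \<and> F \<subseteq> (\<Union>c\<in>S. ball c r)"
    unfolding cover_number_def by (rule LeastI_ex)
  then show thesis using that by blast
qed

text \<open>Volume packing: balls of radius r/2 about the points are disjoint and lie in the ball of
  radius R + r/2, and (R + r/2) / (r/2) <= 3 R / r because r < R.\<close>

lemma card_separated_le:
  fixes x :: "'a::euclidean_space"
  assumes P: "finite P" "P \<subseteq> ball x R" and sep: "\<And>a b. a \<in> P \<Longrightarrow> b \<in> P \<Longrightarrow> a \<noteq> b \<Longrightarrow> r \<le> dist a b"
    and r: "0 < r" "r < R"
  shows "real (card P) \<le> (3 * (R / r)) ^ DIM('a)"
proof -
  define w where "w = measure lborel (ball (0::'a) 1)"
  have w: "0 < w" by (simp add: w_def content_ball_pos)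
  have dj: "disjoint_family_on (\<lambda>c. ball c (r/2)) P"
    unfolding disjoint_family_on_def
  proof (intro ballI impI)
    fix a b assume "a \<in> P" "b \<in> P" "a \<noteq> b"
    then show "ball a (r/2) \<inter> ball b (r/2) = {}"
      using sep[of a b] by (auto simp: disjoint_ballI)
  qed
  have "real (card P) * ((r/2) ^ DIM('a) * w) = (\<Sum>c\<in>P. measure lborel (ball c (r/2)))"
    using r by (simp add: content_ball_conv_unit_ball[of "r/2"] w_def)
  also have "\<dots> = measure lborel (\<Union>c\<in>P. ball c (r/2))"
    using P(1) dj emeasure_lborel_ball_finite by (intro measure_finite_Union[symmetric]) (auto simp: less_top[symmetric])
  also have "\<dots> \<le> measure lborel (ball x (R + r/2))"
  proof (rule measure_mono_fmeasurable)
    show "(\<Union>c\<in>P. ball c (r/2)) \<subseteq> ball x (R + r/2)"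
    proof (intro UN_least subsetI)
      fix c y assume "c \<in> P" "y \<in> ball c (r/2)"
      then show "y \<in> ball x (R + r/2)" using P(2) dist_triangle[of x y c] by auto
    qed
  qed (use P(1) in \<open>auto simp: fmeasurable_def emeasure_lborel_ball_finite[unfolded infinity_ennreal_def]\<close>)
  also have "\<dots> = (R + r/2) ^ DIM('a) * w"
    using r by (subst content_ball_conv_unit_ball) (auto simp: w_def)
  finally have "real (card P) * (r/2) ^ DIM('a) \<le> (R + r/2) ^ DIM('a)"
    using w by (simp add: mult.assoc[symmetric])
  then have "real (card P) \<le> (R + r/2) ^ DIM('a) / (r/2) ^ DIM('a)" using r by (simp add: field_simps)
  also have "\<dots> = ((R + r/2) / (r/2)) ^ DIM('a)" by (rule power_divide[symmetric])
  also have "\<dots> \<le> (3 * (R / r)) ^ DIM('a)"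
    using r by (intro power_mono) (auto simp: field_simps)
  finally show ?thesis .
qed

text \<open>The packing bound yields an r-separated subset of largest cardinality. Its r-balls
  cover, since an uncovered point could be added to it.\<close>

lemma cover_number_ball_le:
  fixes x :: "'a::euclidean_space"
  assumes r: "0 < r" "r < R"
  shows "real (cover_number r (ball x R \<inter> E)) \<le> (3 * (R / r)) ^ DIM('a)"
proof -
  let ?sep = "\<lambda>P. finite P \<and> P \<subseteq> ball x R \<inter> E \<and> (\<forall>a\<in>P. \<forall>b\<in>P. a \<noteq> b \<longrightarrow> r \<le> dist a b)"
  have bd: "card P \<le> nat \<lfloor>(3 * (R / r)) ^ DIM('a)\<rfloor>" if "?sep P" for P
  proof (rule le_nat_floor)
    show "real (card P) \<le> (3 * (R / r)) ^ DIM('a)"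
      by (rule card_separated_le[OF _ _ _ r]) (use that in blast)+
  qed
  have "\<exists>P. ?sep P \<and> (\<forall>Q. ?sep Q \<longrightarrow> card Q \<le> card P)"
  proof (rule ex_has_greatest_nat)
    show "?sep {}" by simp
    show "\<forall>P. ?sep P \<longrightarrow> card P < Suc (nat \<lfloor>(3 * (R / r)) ^ DIM('a)\<rfloor>)"
      using bd le_imp_less_Suc by blast
  qed
  then obtain P where P: "?sep P" "\<And>Q. ?sep Q \<Longrightarrow> card Q \<le> card P" by blast
  have "ball x R \<inter> E \<subseteq> (\<Union>c\<in>P. ball c r)"
  proof (rule ccontr)
    assume "\<not> ?thesis"
    then obtain y where y: "y \<in> ball x R \<inter> E" "\<And>c. c \<in> P \<Longrightarrow> r \<le> dist c y" by force
    have "?sep (insert y P)"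
    proof (intro conjI ballI impI)
      show "finite (insert y P)" "insert y P \<subseteq> ball x R \<inter> E" using P(1) y(1) by auto
      fix a b assume "a \<in> insert y P" "b \<in> insert y P" "a \<noteq> b"
      then show "r \<le> dist a b" using P(1) y(2)[of a] y(2)[of b] by (metis dist_commute insertE)
    qed
    then have "card (insert y P) \<le> card P" by (rule P(2))
    moreover have "y \<notin> P" using y(2)[of y] r by (metis dist_self linorder_not_le)
    ultimately show False using P(1) by simp
  qed
  then have "cover_number r (ball x R \<inter> E) \<le> card P" using P(1) by (intro cover_number_le_card) auto
  also have "real (card P) \<le> (3 * (R / r)) ^ DIM('a)"
    by (rule card_separated_le[OF _ _ _ r]) (use P(1) in blast)+
  finally show ?thesis by simp
qed

text \<open>The covering bound puts \<open>DIM('a)\<close> among the admissible exponents. So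
  \<open>Inf\<close> is taken over a nonempty set, and below every number exceeding it there is an
  admissible exponent.\<close>

lemma assouad_dim_lessD:
  fixes E :: "'a::euclidean_space set"
  assumes "assouad_dim E < t"
  obtains l C where "0 \<le> l" "l < t" "0 < C"
    "\<And>r R x. 0 < r \<Longrightarrow> r < R \<Longrightarrow> x \<in> E \<Longrightarrow> real (cover_number r (ball x R \<inter> E)) \<le> C * (R / r) powr l"
proof -
  let ?L = "{lam. lam \<ge> 0 \<and> (\<exists>C>0. \<forall>r R. 0 < r \<longrightarrow> r < R \<longrightarrow>
        (\<forall>x\<in>E. real (cover_number r (ball x R \<inter> E)) \<le> C * (R / r) powr lam))}"
  have "real DIM('a) \<in> ?L"
  proof (intro CollectI conjI exI[of _ "3 ^ DIM('a)"] allI impI ballI)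
    fix r R :: real and x assume "0 < r" "r < R" "x \<in> E"
    then show "real (cover_number r (ball x R \<inter> E)) \<le> 3 ^ DIM('a) * (R / r) powr DIM('a)"
      using cover_number_ball_le[of r R x E] by (simp add: power_mult_distrib powr_realpow power_divide)
  qed auto
  then have "?L \<noteq> {}" by blast
  moreover have "Inf ?L < t" using assms by (simp add: assouad_dim_def)
  ultimately obtain l where "l \<in> ?L" "l < t" by (metis (no_types, lifting) cInf_lessD)
  then show thesis using that by blast
qed

text \<open>The centre \<open>w\<close> is arbitrary, while the covering bound needs a centre in E.
  If the tube is nonempty, some \<xi>0 in E lies within 3 M of w, the nearest points of E to the
  tube lie in the ball of radius 6 M around it, and doubling the radii of a cover of that part of E
  covers the tube.\<close>

lemma emeasure_infdist_less_le:
  fixes E :: "'a::euclidean_space set"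
  assumes E: "closed E" "E \<noteq> {}" and C: "0 < C" and l: "0 \<le> l"
    and cov: "\<And>r R x. 0 < r \<Longrightarrow> r < R \<Longrightarrow> x \<in> E \<Longrightarrow> real (cover_number r (ball x R \<inter> E)) \<le> C * (R / r) powr l"
    and r: "0 < r" "r \<le> 2 * M"
  shows "emeasure lborel {x \<in> ball w M. infdist x E < r}
    \<le> ennreal (C * (6 * M / r) powr l * ((2 * r) ^ DIM('a) * measure lborel (ball (0::'a) 1)))"
proof (cases "{x \<in> ball w M. infdist x E < r} = {}")
  case True then show ?thesis by (simp only: emeasure_empty) simp
next
  case False
  have near: "\<exists>\<xi>\<in>E. dist x \<xi> < r \<and> dist w \<xi> < 3 * M" if "x \<in> ball w M" "infdist x E < r" for x
  proof -
    obtain \<xi> where "\<xi> \<in> E" "infdist x E = dist x \<xi>" using infdist_attains_inf[OF E] by blast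
    moreover then have "dist w \<xi> < 3 * M" using that dist_triangle[of w \<xi> x] r by auto
    ultimately show ?thesis using that by auto
  qed
  obtain \<xi>0 where \<xi>0: "\<xi>0 \<in> E" "dist w \<xi>0 < 3 * M" using False near by blast
  obtain S where S: "finite S" "card S = cover_number r (ball \<xi>0 (6 * M) \<inter> E)" "ball \<xi>0 (6 * M) \<inter> E \<subseteq> (\<Union>c\<in>S. ball c r)"
    using cover_number_attained[OF bounded_Int[OF disjI1[OF bounded_ball]] r(1)] by metis
  have M: "0 < M" "r < 6 * M" using r by auto
  have sub: "{x \<in> ball w M. infdist x E < r} \<subseteq> (\<Union>c\<in>S. ball c (2 * r))"
  proof
    fix x assume "x \<in> {x \<in> ball w M. infdist x E < r}"
    then obtain \<xi> where \<xi>: "\<xi> \<in> E" "dist x \<xi> < r" "dist w \<xi> < 3 * M" using near by blast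
    have "dist \<xi>0 \<xi> < 6 * M" using \<xi> \<xi>0 dist_triangle3[of \<xi>0 \<xi> w] by auto
    then obtain c where "c \<in> S" "dist c \<xi> < r" using S(3) \<xi> by auto
    moreover then have "dist c x < 2 * r" using \<xi> dist_triangle2[of c x \<xi>] by auto
    ultimately show "x \<in> (\<Union>c\<in>S. ball c (2 * r))" by auto
  qed
  have "emeasure lborel {x \<in> ball w M. infdist x E < r} \<le> emeasure lborel (\<Union>c\<in>S. ball c (2 * r))"
    using S(1) by (intro emeasure_mono sub) auto
  also have "\<dots> \<le> (\<Sum>c\<in>S. emeasure lborel (ball c (2 * r)))"
    using S(1) by (intro emeasure_subadditive_finite) auto
  also have "\<dots> = ennreal (real (card S) * ((2 * r) ^ DIM('a) * measure lborel (ball (0::'a) 1)))"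
    using r by (simp add: emeasure_ball_eq ennreal_mult ennreal_of_nat_eq_real_of_nat)
  also have "\<dots> \<le> ennreal (C * (6 * M / r) powr l * ((2 * r) ^ DIM('a) * measure lborel (ball (0::'a) 1)))"
    using cov[OF r(1) M(2) \<xi>0(1)] S(2) r by (intro ennreal_leI mult_right_mono) auto
  finally show ?thesis .
qed

text \<open>Decompose by distance into dyadic layers. With a covering exponent l, the k-th layer has
  measure at most a multiple of M^n 2^(k (l - n)), and the integrand there is at most a multiple of
  M^q 2^(-k q). The terms decay geometrically because l < n + q.\<close>

lemma nn_integral_infdist_powr_le:
  fixes E :: "'a::euclidean_space set" and q :: real
  assumes E: "closed E" "E \<noteq> {}" and dim: "assouad_dim E < DIM('a) + q"
  obtains C where "0 < C" "\<And>w M. 0 < M \<Longrightarrow>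
    (\<integral>\<^sup>+x\<in>{x \<in> ball w M. 0 < infdist x E \<and> infdist x E \<le> M}. ennreal (infdist x E powr q) \<partial>lborel)
      \<le> ennreal (C * M powr (DIM('a) + q))"
proof -
  obtain l C where l: "0 \<le> l" "l < DIM('a) + q" and C: "0 < C" and
    cov: "\<And>r R x. 0 < r \<Longrightarrow> r < R \<Longrightarrow> x \<in> E \<Longrightarrow> real (cover_number r (ball x R \<inter> E)) \<le> C * (R / r) powr l"
    using assouad_dim_lessD[OF dim] by blast
  define w1 where "w1 = measure lborel (ball (0::'a) 1)"
  have w1: "0 < w1" by (simp add: w1_def content_ball_pos)
  \<comment> \<open>One constant for both signs of q: the power is largest at the outer end of a
    layer if q >= 0 and at the inner end otherwise.\<close>
  define cq where "cq = max 1 (2 powr (- q))"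
  have cq: "1 \<le> cq" "2 powr (- q) \<le> cq" by (auto simp: cq_def)
  define t where "t = 2 powr (l - (DIM('a) + q))"
  have t: "0 \<le> t" "t < 1" using l powr_less_mono[of "l - (DIM('a) + q)" 0 "2::real"] by (auto simp: t_def)
  define B where "B = cq * C * 3 powr l * 2 ^ DIM('a) * w1"
  have B: "0 < B" using cq C w1 by (simp add: B_def)
  show thesis
  proof (rule that[of "B * 2 powr (DIM('a) + q) / (1 - t)"])
    show "0 < B * 2 powr (DIM('a) + q) / (1 - t)" using B t by simp
    fix w :: 'a and M :: real assume M: "0 < M"
    \<comment> \<open>Starting at 2 M makes a distance of at most M strictly smaller than the first
      scale, as \<open>obtain_dyadic\<close> demands.\<close>
    define \<rho> where "\<rho> k = 2 * M / 2 ^ k" for k :: nat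
    have \<rho>: "0 < \<rho> k" "\<rho> k \<le> 2 * M" "\<rho> (Suc k) = \<rho> k / 2" for k using M by (auto simp: \<rho>_def field_simps)
    define A where "A k = {x \<in> ball w M. infdist x E < \<rho> k}" for k
    have [measurable]: "A k \<in> sets borel" for k unfolding A_def by measurable
    have "(\<integral>\<^sup>+x\<in>{x \<in> ball w M. 0 < infdist x E \<and> infdist x E \<le> M}. ennreal (infdist x E powr q) \<partial>lborel)
      \<le> (\<integral>\<^sup>+x. (\<Sum>k. ennreal (cq * \<rho> k powr q) * indicator (A k) x) \<partial>lborel)"
    proof (rule nn_integral_mono)
      fix x
      show "ennreal (infdist x E powr q) * indicator {x \<in> ball w M. 0 < infdist x E \<and> infdist x E \<le> M} x
        \<le> (\<Sum>k. ennreal (cq * \<rho> k powr q) * indicator (A k) x)"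
      proof (cases "x \<in> {x \<in> ball w M. 0 < infdist x E \<and> infdist x E \<le> M}")
        case True
        then obtain k where k: "\<rho> (Suc k) \<le> infdist x E" "infdist x E < \<rho> k"
          using obtain_dyadic[of "infdist x E" "2 * M"] M unfolding \<rho>_def by auto
        have "infdist x E powr q \<le> cq * \<rho> k powr q"
        proof (cases "0 \<le> q")
          case True
          then have "infdist x E powr q \<le> 1 * \<rho> k powr q" using k by (simp add: powr_mono2 infdist_nonneg)
          also have "\<dots> \<le> cq * \<rho> k powr q" using cq by (intro mult_right_mono) auto
          finally show ?thesis .
        next
          case False
          then have "infdist x E powr q \<le> \<rho> (Suc k) powr q" using k \<rho>[of "Suc k"] by (intro powr_mono2') auto
          also have "\<dots> = 2 powr (- q) * \<rho> k powr q" unfolding \<rho>(3) by (rule powr_half[OF \<rho>(1)])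
          also have "\<dots> \<le> cq * \<rho> k powr q" using cq by (intro mult_right_mono) auto
          finally show ?thesis .
        qed
        moreover have "x \<in> A k" using True k by (simp add: A_def)
        ultimately have "ennreal (infdist x E powr q) \<le> ennreal (cq * \<rho> k powr q) * indicator (A k) x"
          by (simp add: ennreal_leI)
        also have "\<dots> \<le> (\<Sum>k. ennreal (cq * \<rho> k powr q) * indicator (A k) x)" by (rule ennreal_le_suminf)
        finally show ?thesis using True by simp
      qed auto
    qed
    also have "\<dots> = (\<Sum>k. ennreal (cq * \<rho> k powr q) * emeasure lborel (A k))"
      by (subst nn_integral_suminf) (auto simp: nn_integral_cmult_indicator)
    also have "\<dots> \<le> (\<Sum>k. ennreal (B * (2 * M) powr (DIM('a) + q) * t ^ k))"
    proof (intro suminf_le)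
      fix k
      have "ennreal (cq * \<rho> k powr q) * emeasure lborel (A k) \<le> ennreal (cq * \<rho> k powr q) * ennreal (C * (6 * M / \<rho> k) powr l * ((2 * \<rho> k) ^ DIM('a) * w1))"
        unfolding A_def w1_def using \<rho>[of k] by (intro mult_left_mono emeasure_infdist_less_le[OF E C l(1) cov]) auto
      also have "\<dots> = ennreal (cq * \<rho> k powr q * (C * (6 * M / \<rho> k) powr l * ((2 * \<rho> k) ^ DIM('a) * w1)))"
        using cq C w1 \<rho>(1)[of k] by (intro ennreal_mult[symmetric]) (auto simp: less_imp_le)
      also have "cq * \<rho> k powr q * (C * (6 * M / \<rho> k) powr l * ((2 * \<rho> k) ^ DIM('a) * w1)) = B * (2 * M) powr (DIM('a) + q) * t ^ k"
      proof -
        have 1: "6 * M / \<rho> k = 3 * 2 powr k" using M by (simp add: \<rho>_def powr_realpow)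
        have 2: "\<rho> k = (2 * M) * 2 powr (- real k)" by (simp add: \<rho>_def powr_minus powr_realpow divide_inverse)
        have 3: "t ^ k = 2 powr (real k * (l - (DIM('a) + q)))" by (simp add: t_def powr_powr mult.commute flip: powr_realpow)
        have 4: "\<rho> k powr q * \<rho> k ^ DIM('a) = \<rho> k powr (DIM('a) + q)" using \<rho>(1)[of k] by (simp add: powr_add powr_realpow)
        have "cq * \<rho> k powr q * (C * (6 * M / \<rho> k) powr l * ((2 * \<rho> k) ^ DIM('a) * w1))
          = cq * C * 2 ^ DIM('a) * w1 * (6 * M / \<rho> k) powr l * (\<rho> k powr q * \<rho> k ^ DIM('a))"
          by (simp add: power_mult_distrib mult_ac)
        also have "\<dots> = B * (2 powr k) powr l * ((2 * M) powr (DIM('a) + q) * (2 powr (- real k)) powr (DIM('a) + q))"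
          unfolding 4 unfolding 1 unfolding 2 using M by (simp add: powr_mult B_def mult_ac)
        also have "\<dots> = B * (2 * M) powr (DIM('a) + q) * (2 powr (real k * l) * 2 powr (- real k * (DIM('a) + q)))"
          by (simp add: powr_powr mult_ac)
        also have "2 powr (real k * l) * 2 powr (- real k * (DIM('a) + q)) = t ^ k"
          unfolding 3 powr_add[symmetric] by (simp add: algebra_simps)
        finally show ?thesis .
      qed
      finally show "ennreal (cq * \<rho> k powr q) * emeasure lborel (A k) \<le> ennreal (B * (2 * M) powr (DIM('a) + q) * t ^ k)" .
    qed auto
    \<comment> \<open>The recurrence lemma with zero forcing term serves as the geometric series in
      \<open>ennreal\<close>.\<close>
    also have "\<dots> \<le> ennreal (1 / (1 - t)) * (ennreal (B * (2 * M) powr (DIM('a) + q) * t ^ 0) + (\<Sum>k. 0))"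
      using t B by (intro ennreal_suminf_geometric_recurrence) (auto simp: mult_ac simp flip: ennreal_mult)
    also have "\<dots> = ennreal (1 / (1 - t) * (B * (2 * M) powr (DIM('a) + q)))"
      using t B by (simp flip: ennreal_mult)
    also have "1 / (1 - t) * (B * (2 * M) powr (DIM('a) + q)) = B * 2 powr (DIM('a) + q) / (1 - t) * M powr (DIM('a) + q)"
      using M by (simp add: powr_mult)
    finally show "(\<integral>\<^sup>+x\<in>{x \<in> ball w M. 0 < infdist x E \<and> infdist x E \<le> M}. ennreal (infdist x E powr q) \<partial>lborel)
      \<le> ennreal (B * 2 powr (DIM('a) + q) / (1 - t) * M powr (DIM('a) + q))" .
  qed
qed

section \<open>Chains along John curves\<close>

lemma bdist_measurable [measurable (raw)]:
  fixes f :: "'b \<Rightarrow> 'a::euclidean_space"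
  assumes [measurable]: "f \<in> borel_measurable M"
  shows "(\<lambda>x. bdist \<Omega> (f x)) \<in> borel_measurable M"
  unfolding bdist_def by measurable

lemma bdist_nonneg: "0 \<le> bdist \<Omega> x" by (simp add: bdist_def infdist_nonneg)

lemma bdist_lipschitz: "bdist \<Omega> x \<le> bdist \<Omega> y + dist x y"
  unfolding bdist_def by (rule infdist_triangle)

lemma frontier_nonempty:
  fixes \<Omega> :: "'a::euclidean_space set"
  assumes "bounded \<Omega>" "\<Omega> \<noteq> {}" shows "frontier \<Omega> \<noteq> {}"
  using assms not_bounded_UNIV frontier_eq_empty by metis

lemma bdist_pos:
  fixes \<Omega> :: "'a::euclidean_space set"
  assumes "open \<Omega>" "bounded \<Omega>" "x \<in> \<Omega>" shows "0 < bdist \<Omega> x"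
proof -
  have "frontier \<Omega> \<noteq> {}" using assms by (intro frontier_nonempty) auto
  moreover have "x \<notin> frontier \<Omega>" using assms by (simp add: frontier_def interior_open)
  ultimately show ?thesis unfolding bdist_def using infdist_pos_not_in_closed[of "frontier \<Omega>" x] by simp
qed

text \<open>A connected set meeting \<Omega> and its complement meets the boundary, but the open
  ball of radius \<delta>(x) contains no boundary point.\<close>

lemma ball_bdist_subset:
  fixes \<Omega> :: "'a::euclidean_space set"
  assumes "x \<in> \<Omega>" shows "ball x (bdist \<Omega> x) \<subseteq> \<Omega>"
proof (rule ccontr)
  assume not: "\<not> ?thesis"
  then have "ball x (bdist \<Omega> x) \<inter> \<Omega> \<noteq> {}" using assms by (metis IntI ball_eq_empty centre_in_ball empty_iff empty_subsetI linorder_not_le)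
  then have "ball x (bdist \<Omega> x) \<inter> frontier \<Omega> \<noteq> {}"
    using connected_Int_frontier[of "ball x (bdist \<Omega> x)" \<Omega>] not by auto
  then obtain z where "z \<in> frontier \<Omega>" "dist x z < bdist \<Omega> x" by auto
  then show False using infdist_le[of z "frontier \<Omega>" x] by (simp add: bdist_def)
qed

lemma strain_at_mono: "ball a r \<subseteq> ball b t \<Longrightarrow> strain_at u p a r y \<le> strain_at u p b t y"
  unfolding strain_at_def by (intro nn_set_integral_set_mono)

lemma strain_at_measurable_var [measurable (raw)]:
  fixes u :: "'a::euclidean_space \<Rightarrow> 'a"
  assumes [measurable]: "u \<in> borel_measurable borel" "f \<in> borel_measurable M" "g \<in> borel_measurable M" "h \<in> borel_measurable M"
  shows "(\<lambda>x. strain_at u p (f x) (g x) (h x)) \<in> borel_measurable M"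
  unfolding strain_at_def by measurable

text \<open>The points y form a cone of aperture \<open>K\<close> with vertex x, wide enough to
  contain neighbourhoods of the John curves from x. Replacing a sum along a chosen curve by an
  integral over a set free of choices is what makes Fubini applicable later.\<close>

definition strain_cone :: "'a::euclidean_space set \<Rightarrow> real \<Rightarrow> real \<Rightarrow> ('a \<Rightarrow> 'a) \<Rightarrow> real \<Rightarrow> 'a \<Rightarrow> ennreal" where
  "strain_cone \<Omega> K t u p x = (\<integral>\<^sup>+y\<in>{y\<in>\<Omega>. dist y x \<le> K * bdist \<Omega> y}.
      ennreal (bdist \<Omega> y powr t) * strain_at u p y (2/5 * bdist \<Omega> y) y \<partial>lborel)"

section \<open>Geometrically spaced points on a John curve\<close>

lemma arc_length_param_dist_le:
  assumes "arc_length_param \<gamma> l" "0 \<le> a" "a \<le> b" "b \<le> l"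
  shows "dist (\<gamma> a) (\<gamma> b) \<le> b - a"
proof -
  have "ereal (dist (\<gamma> a) (\<gamma> b)) = ereal (\<Sum>i<length [a,b] - 1. dist (\<gamma> ([a,b] ! Suc i)) (\<gamma> ([a,b] ! i)))"
    by (simp add: dist_commute)
  also have "\<dots> \<le> curve_length \<gamma> a b"
    unfolding curve_length_def by (rule SUP_upper) (use assms in auto)
  also have "\<dots> = ereal (b - a)" using assms by (simp add: arc_length_param_def)
  finally show ?thesis by simp
qed

text \<open>The indices that count form a window: from the smallest one, N further steps multiply by
  \<open>lam ^ N\<close> and overshoot \<open>B\<close>. This becomes the bounded overlap of the
  balls along a chain.\<close>

lemma sum_indicator_geometric_le:
  fixes lam d A B :: real
  assumes lam: "1 < lam" and N: "B < lam ^ N * A" and A: "0 < A" and d: "0 < d"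
  shows "(\<Sum>i<m. of_bool (A \<le> d * lam ^ i \<and> d * lam ^ i \<le> B)) \<le> (of_nat N :: ennreal)"
proof -
  let ?I = "{i. i < m \<and> A \<le> d * lam ^ i \<and> d * lam ^ i \<le> B}"
  have "card ?I \<le> N"
  proof (cases "?I = {}")
    case True then show ?thesis by (simp only: card.empty)
  next
    case False
    define i0 where "i0 = Min ?I"
    have fin: "finite ?I" by simp
    have i0: "i0 \<in> ?I" unfolding i0_def by (rule Min_in[OF fin False])
    have "?I \<subseteq> {i0..<i0 + N}"
    proof
      fix i assume i: "i \<in> ?I"
      have "i0 \<le> i" unfolding i0_def by (rule Min_le[OF fin i])
      moreover have "i < i0 + N"
      proof (rule ccontr)
        assume "\<not> i < i0 + N"
        then have "lam ^ (i0 + N) \<le> lam ^ i" using lam by (intro power_increasing) auto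
        then have "d * lam ^ (i0 + N) \<le> d * lam ^ i" using d by simp
        also have "\<dots> \<le> B" using i by simp
        also have "\<dots> < lam ^ N * A" by (rule N)
        also have "\<dots> \<le> lam ^ N * (d * lam ^ i0)" using i0 lam by (intro mult_left_mono) auto
        finally show False by (simp add: power_add mult_ac)
      qed
      ultimately show "i \<in> {i0..<i0 + N}" by simp
    qed
    then have "card ?I \<le> card {i0..<i0 + N}" by (intro card_mono) auto
    then show ?thesis by simp
  qed
  moreover have "(\<Sum>i<m. of_bool (A \<le> d * lam ^ i \<and> d * lam ^ i \<le> B) :: ennreal) = of_nat (card ?I)"
  proof -
    have "(\<Sum>i<m. of_bool (A \<le> d * lam ^ i \<and> d * lam ^ i \<le> B) :: ennreal) = (\<Sum>i\<in>?I. 1)"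
      by (rule sum.mono_neutral_cong_right) auto
    then show ?thesis by simp
  qed
  ultimately show ?thesis by simp
qed

text \<open>A substitute for Hoelder's inequality on chains: the geometric weights \<open>\<mu>\<^sup>i\<close> with \<open>\<mu> > 1\<close> absorb the loss
  in \<open>(a + b)\<^sup>p \<le> \<mu> a\<^sup>p + D b\<^sup>p\<close> at every step.\<close>
lemma telescoping_powr_bound:
  fixes f :: "nat \<Rightarrow> 'a::real_normed_vector" and b :: "nat \<Rightarrow> ennreal"
  assumes p: "1 < p" and \<mu>: "0 < \<mu>" and D: "0 < D" "\<And>a b. 0 \<le> a \<Longrightarrow> 0 \<le> b \<Longrightarrow> (a + b) powr p \<le> \<mu> * a powr p + D * b powr p"
    and b: "\<And>i. i < m \<Longrightarrow> ennreal (norm (f (Suc i) - f i) powr p) \<le> b i"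
  shows "ennreal (norm (f 0 - f m) powr p) \<le> ennreal D * (\<Sum>i<m. ennreal (\<mu> ^ i) * b i)"
proof -
  \<comment> \<open>Induction on the number of links already split off; the undivided rest f j - f m
    carries the accumulated factor \<mu>^j.\<close>
  have "ennreal (norm (f 0 - f m) powr p) \<le> ennreal (\<mu> ^ j) * ennreal (norm (f j - f m) powr p) + ennreal D * (\<Sum>i<j. ennreal (\<mu> ^ i) * b i)"
    if "j \<le> m" for j
    using that
  proof (induction j)
    case (Suc j)
    let ?a = "norm (f (Suc j) - f m)" and ?b = "norm (f (Suc j) - f j)"
    have "norm (f j - f m) \<le> ?a + ?b"
      using norm_triangle_ineq4[of "f (Suc j) - f m" "f (Suc j) - f j"] by simp
    then have "norm (f j - f m) powr p \<le> (?a + ?b) powr p" using p by (intro powr_mono2) auto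
    also have "\<dots> \<le> \<mu> * ?a powr p + D * ?b powr p" by (intro D(2)) auto
    finally have "ennreal (norm (f j - f m) powr p) \<le> ennreal \<mu> * ennreal (?a powr p) + ennreal D * ennreal (?b powr p)"
      using \<mu> D by (simp add: ennreal_leI flip: ennreal_mult ennreal_plus)
    also have "\<dots> \<le> ennreal \<mu> * ennreal (?a powr p) + ennreal D * b j"
      using Suc.prems by (intro add_left_mono mult_left_mono b) auto
    finally have st: "ennreal (norm (f j - f m) powr p) \<le> ennreal \<mu> * ennreal (?a powr p) + ennreal D * b j" .
    have "ennreal (norm (f 0 - f m) powr p) \<le> ennreal (\<mu> ^ j) * ennreal (norm (f j - f m) powr p) + ennreal D * (\<Sum>i<j. ennreal (\<mu> ^ i) * b i)"
      using Suc by simp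
    also have "\<dots> \<le> ennreal (\<mu> ^ j) * (ennreal \<mu> * ennreal (?a powr p) + ennreal D * b j) + ennreal D * (\<Sum>i<j. ennreal (\<mu> ^ i) * b i)"
      by (intro add_right_mono mult_left_mono st) auto
    also have "\<dots> = ennreal (\<mu> ^ Suc j) * ennreal (?a powr p) + ennreal D * (\<Sum>i<Suc j. ennreal (\<mu> ^ i) * b i)"
      using \<mu> by (simp add: ennreal_mult distrib_left mult_ac add_ac)
    finally show ?case .
  qed simp
  from this[of m] show ?thesis using p by simp
qed

text \<open>The constant \<open>c\<close> and the base point come before \<eta> in the quantifiers
  because the step ratio is later chosen as a multiple of \<open>c\<close>. The scale \<delta>(x) (1
  + \<eta>)^i is elapsed arc length plus \<delta>(x); unlike arc length alone, this sum is
  comparable to \<delta> from the very start of the curve.\<close>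

lemma john_chain_points:
  fixes \<Omega> :: "'a::euclidean_space set"
  assumes J: "john_domain \<Omega>"
  obtains c x0 where "0 < c" "c \<le> 1" "x0 \<in> \<Omega>"
    "\<And>\<eta> x. 0 < \<eta> \<Longrightarrow> x \<in> \<Omega> \<Longrightarrow> \<exists>m z. z 0 = x \<and> z m = x0 \<and> (\<forall>i. z i \<in> \<Omega>) \<and>
      (\<forall>i<m. c * (bdist \<Omega> x * (1 + \<eta>) ^ i) \<le> bdist \<Omega> (z i) \<and> bdist \<Omega> (z i) \<le> bdist \<Omega> x * (1 + \<eta>) ^ i \<and>
        dist x (z i) \<le> bdist \<Omega> x * (1 + \<eta>) ^ i \<and> dist (z i) (z (Suc i)) \<le> \<eta> * (bdist \<Omega> x * (1 + \<eta>) ^ i))"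
proof -
  from J have "\<exists>C \<ge> 1. \<exists>x0 \<in> \<Omega>. \<forall>x \<in> \<Omega>. \<exists>\<gamma> l. arc_length_param \<gamma> l \<and> \<gamma> ` {0..l} \<subseteq> \<Omega> \<and>
        \<gamma> 0 = x \<and> \<gamma> l = x0 \<and> (\<forall>t \<in> {0..l}. infdist (\<gamma> t) (frontier \<Omega>) \<ge> t / C)"
    unfolding john_domain_def by (elim conjE)
  then obtain C x0 where C: "C \<ge> 1" and x0: "x0 \<in> \<Omega>" and curve: "\<forall>x \<in> \<Omega>. \<exists>\<gamma> l. arc_length_param \<gamma> l \<and> \<gamma> ` {0..l} \<subseteq> \<Omega> \<and>
        \<gamma> 0 = x \<and> \<gamma> l = x0 \<and> (\<forall>t \<in> {0..l}. infdist (\<gamma> t) (frontier \<Omega>) \<ge> t / C)"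
    by (elim exE conjE bexE)
  have op: "open \<Omega>" "bounded \<Omega>" using J by (auto simp: john_domain_def)
  show thesis
  \<comment> \<open>Two regimes give this constant. While at most \<delta>(x)/2 has been traversed,
    the Lipschitz bound keeps \<delta> above \<delta>(x)/2 and the scale is at most 3/2 \<delta>(x);
    afterwards the scale is at most three times the arc length t, and the John condition gives t /
    C.\<close>
  proof (rule that[of "1 / (3 * C)" x0])
    show "0 < 1 / (3 * C)" "1 / (3 * C) \<le> 1" using C by (auto simp: field_simps)
    show "x0 \<in> \<Omega>" by (rule x0)
    fix \<eta> :: real and x :: 'a assume \<eta>: "0 < \<eta>" and x: "x \<in> \<Omega>"
    obtain \<gamma> l where g: "arc_length_param \<gamma> l" "\<gamma> ` {0..l} \<subseteq> \<Omega>" "\<gamma> 0 = x" "\<gamma> l = x0"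
      and far: "\<And>t. 0 \<le> t \<Longrightarrow> t \<le> l \<Longrightarrow> t / C \<le> bdist \<Omega> (\<gamma> t)"
      using bspec[OF curve x] unfolding bdist_def by (elim exE conjE) (simp add: Ball_def)
    have l: "0 \<le> l" using g(1) by (simp add: arc_length_param_def)
    define d where "d = bdist \<Omega> x"
    have d: "0 < d" unfolding d_def by (rule bdist_pos[OF op x])
    define s where "s i = d * (1 + \<eta>) ^ i" for i :: nat
    have smono: "s i \<le> s (Suc i)" "d \<le> s i" "s (Suc i) - s i = \<eta> * s i" for i
    proof -
      have "1 \<le> (1 + \<eta>) ^ i" using \<eta> by (intro one_le_power) auto
      then show "d \<le> s i" using d by (simp add: s_def)
      show "s (Suc i) - s i = \<eta> * s i" by (simp add: s_def algebra_simps)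
      moreover have "0 \<le> \<eta> * s i" using \<eta> d by (simp add: s_def)
      ultimately show "s i \<le> s (Suc i)" by simp
    qed
    \<comment> \<open>The shift by \<open>d\<close> makes the chain start at x. The cut-off at
      \<open>l\<close> keeps every sample point on the curve and shortens the last link.\<close>
    define t where "t i = min (s i - d) l" for i
    have t: "0 \<le> t i" "t i \<le> l" "t i \<le> s i - d" "t i \<le> t (Suc i)" for i
      using smono[of i] l by (auto simp: t_def min_def)
    obtain m0 where "(l + d) / d < (1 + \<eta>) ^ m0" using real_arch_pow[of "1 + \<eta>" "(l + d) / d"] \<eta> by auto
    then have m0: "l \<le> s m0 - d" using d by (simp add: s_def field_simps)
    define m where "m = (LEAST m. l \<le> s m - d)"
    have m: "l \<le> s m - d" unfolding m_def by (rule LeastI[of _ m0]) (rule m0)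
    have lt: "s i - d < l" if "i < m" for i using not_less_Least[of i "\<lambda>m. l \<le> s m - d"] that by (simp add: m_def)
    define z where "z i = \<gamma> (t i)" for i
    show "\<exists>m z. z 0 = x \<and> z m = x0 \<and> (\<forall>i. z i \<in> \<Omega>) \<and>
      (\<forall>i<m. 1 / (3 * C) * (bdist \<Omega> x * (1 + \<eta>) ^ i) \<le> bdist \<Omega> (z i) \<and> bdist \<Omega> (z i) \<le> bdist \<Omega> x * (1 + \<eta>) ^ i \<and>
        dist x (z i) \<le> bdist \<Omega> x * (1 + \<eta>) ^ i \<and> dist (z i) (z (Suc i)) \<le> \<eta> * (bdist \<Omega> x * (1 + \<eta>) ^ i))"
      unfolding d_def[symmetric] s_def[symmetric]
    proof (intro exI[of _ m] exI[of _ z] conjI allI impI)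
      show "z 0 = x" using l g(3) by (simp add: z_def t_def s_def min_def)
      show "z m = x0" using m g(4) by (simp add: z_def t_def min_def)
      show "z i \<in> \<Omega>" for i using g(2) t[of i] by (auto simp: z_def)
      fix i assume i: "i < m"
      have ti: "t i = s i - d" using lt[OF i] by (simp add: t_def)
      have dx: "dist x (z i) \<le> t i"
        using arc_length_param_dist_le[OF g(1), of 0 "t i"] t[of i] g(3) by (simp add: z_def)
      then show "dist x (z i) \<le> s i" using t(3)[of i] d by simp
      show "bdist \<Omega> (z i) \<le> s i"
        using bdist_lipschitz[of \<Omega> "z i" x] dx ti by (simp add: d_def dist_commute)
      have "dist (z i) (z (Suc i)) \<le> t (Suc i) - t i"
        unfolding z_def by (rule arc_length_param_dist_le[OF g(1)]) (use t in auto)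
      also have "\<dots> \<le> s (Suc i) - s i" using t(3)[of "Suc i"] ti by simp
      finally show "dist (z i) (z (Suc i)) \<le> \<eta> * s i" by (simp add: smono)
      show "1 / (3 * C) * s i \<le> bdist \<Omega> (z i)"
      proof (cases "t i \<le> d / 2")
        case True
        have si: "0 \<le> s i" using smono(2)[of i] d by simp
        have "1 / (3 * C) * s i \<le> 1 / 3 * s i" using C si by (intro mult_right_mono) (auto simp: field_simps)
        also have "\<dots> \<le> d / 2" using ti True by simp
        also have "\<dots> \<le> bdist \<Omega> (z i)"
          using bdist_lipschitz[of \<Omega> x "z i"] dx True by (simp add: d_def)
        finally show ?thesis .
      next
        case False
        then have "s i \<le> 3 * t i" using ti by simp
        then have "1 / (3 * C) * s i \<le> t i / C" using C by (simp add: field_simps)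
        also have "\<dots> \<le> bdist \<Omega> (z i)" unfolding z_def by (rule far) (use t in auto)
        finally show ?thesis .
      qed
    qed
  qed
qed

section \<open>Change of the averaged gradient along a chain\<close>

lemma kgrad_step_bound:
  fixes p :: real assumes p: "1 < p"
  obtains B where "0 < B"
    "\<And>u (z::'a::euclidean_space) z' d d' v. 0 < d \<Longrightarrow> dist z z' \<le> d / 80 \<Longrightarrow> \<bar>d' - d\<bar> \<le> d / 80 \<Longrightarrow>
      set_integrable lborel (ball z (d / 10)) u \<Longrightarrow> u \<in> borel_measurable borel \<Longrightarrow>
      ennreal (norm (kgrad u z' (d' / 20) v - kgrad u z (d / 20) v) powr p)
        \<le> ennreal (B * (d / 10) powr (- (2 * DIM('a) + 2 * p)) * norm v powr p) * strain_on u p z (d / 10)"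
proof -
  obtain C where C: "0 < C"
    "\<And>u (a::'a) r a' r' v. 0 < r \<Longrightarrow> r' \<le> 4 * r \<Longrightarrow> ball a r \<subseteq> ball a' r' \<Longrightarrow>
      set_integrable lborel (ball a' r') u \<Longrightarrow> u \<in> borel_measurable borel \<Longrightarrow>
      ennreal (norm (kgrad u a r v - kgrad u a' r' v) powr p)
        \<le> ennreal (C * r' powr (- (2 * DIM('a) + 2 * p)) * norm v powr p) * strain_on u p a' r'"
    using kgrad_diff_powr_bound[OF p] by blast
  obtain D where D: "0 < D" "\<And>a b c. 0 \<le> a \<Longrightarrow> 0 \<le> b \<Longrightarrow> 0 \<le> c \<Longrightarrow>
    ennreal ((a + b + c) powr p) \<le> ennreal D * (ennreal (a powr p) + ennreal (b powr p) + ennreal (c powr p))"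
    using ennreal_powr_add3_le[OF p] by blast
  show thesis
  proof (rule that[of "2 * D * C"])
    show "0 < 2 * D * C" using C D by simp
    fix u :: "'a \<Rightarrow> 'a" and z z' v :: 'a and d d' :: real
    assume d: "0 < d" "dist z z' \<le> d / 80" "\<bar>d' - d\<bar> \<le> d / 80" and u: "set_integrable lborel (ball z (d / 10)) u"
      and [measurable]: "u \<in> borel_measurable borel"
    let ?R = "ennreal (C * (d / 10) powr (- (2 * DIM('a) + 2 * p)) * norm v powr p) * strain_on u p z (d / 10)"
    let ?k = "kgrad u z (d / 10) v"
    let ?x = "norm (kgrad u z' (d' / 20) v - ?k)" and ?y = "norm (kgrad u z (d / 20) v - ?k)"
    have d': "0 < d'" "d \<le> 2 * d'" "d' \<le> 81 / 80 * d" using d(1) d(3)[unfolded abs_le_iff] by linarith+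
    \<comment> \<open>d / 80 + (81/80) d / 20 is below d / 10. Both gradients on small balls are
      then compared with the one on this common larger ball.\<close>
    have sub: "ball z' (d' / 20) \<subseteq> ball z (d / 10)"
    proof
      fix w assume "w \<in> ball z' (d' / 20)"
      then show "w \<in> ball z (d / 10)" using d d' dist_triangle[of z w z'] by simp
    qed
    have "norm (kgrad u z' (d' / 20) v - kgrad u z (d / 20) v) \<le> ?x + ?y + 0"
      using norm_triangle_ineq4[of "kgrad u z' (d' / 20) v - ?k" "kgrad u z (d / 20) v - ?k"] by simp
    then have "ennreal (norm (kgrad u z' (d' / 20) v - kgrad u z (d / 20) v) powr p) \<le> ennreal ((?x + ?y + 0) powr p)"
      using p by (intro ennreal_leI powr_mono2) auto
    also have "\<dots> \<le> ennreal D * (ennreal (?x powr p) + ennreal (?y powr p) + ennreal (0 powr p))"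
      by (intro D(2)) auto
    also have "\<dots> \<le> ennreal D * (?R + ?R + 0)"
      using d d' sub u by (intro mult_left_mono add_mono C(2)) (auto intro!: subset_ball)
    also have "\<dots> = ennreal (2 * D * C * (d / 10) powr (- (2 * DIM('a) + 2 * p)) * norm v powr p) * strain_on u p z (d / 10)"
      using D C by (simp add: ennreal_mult mult.assoc distrib_left flip: mult_2) (simp add: mult_ac)
    finally show "ennreal (norm (kgrad u z' (d' / 20) v - kgrad u z (d / 20) v) powr p)
        \<le> ennreal (2 * D * C * (d / 10) powr (- (2 * DIM('a) + 2 * p)) * norm v powr p) * strain_on u p z (d / 10)" .
  qed
qed

lemma bdist_comparable:
  assumes "y \<in> ball z (bdist \<Omega> z / 10)"
  shows "9/10 * bdist \<Omega> z \<le> bdist \<Omega> y" "bdist \<Omega> y \<le> 11/10 * bdist \<Omega> z"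
  using assms bdist_lipschitz[of \<Omega> y z] bdist_lipschitz[of \<Omega> z y] by (auto simp: dist_commute)

text \<open>The reason for the radius 2/5: points of the ball around z are within \<delta>(z)/5 of
  y, and \<delta>(z) <= 10/9 \<delta>(y). The right side no longer refers to z.\<close>

lemma strain_at_le_centered:
  fixes z :: "'a::euclidean_space"
  assumes "y \<in> ball z (bdist \<Omega> z / 10)" "r \<le> bdist \<Omega> z / 10"
  shows "strain_at u p z r y \<le> strain_at u p y (2/5 * bdist \<Omega> y) y"
proof (rule strain_at_mono)
  show "ball z r \<subseteq> ball y (2/5 * bdist \<Omega> y)"
  proof
    fix w assume "w \<in> ball z r"
    then show "w \<in> ball y (2/5 * bdist \<Omega> y)"
      using assms bdist_comparable(1)[OF assms(1)] dist_triangle[of y w z] bdist_nonneg[of \<Omega> z]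
      by (simp add: dist_commute)
  qed
qed

text \<open>For y in the i-th ball the scale, \<delta>(z i) and \<delta>(y) are comparable with
  constants depending on \<open>c\<close>, so the weights become powers of \<delta>(y) and y lies in
  the cone at x. Conversely y confines the scale to a window of bounded ratio, so each y is counted
  boundedly often.\<close>

lemma chain_sum_le_strain_cone:
  fixes \<Omega> :: "'a::euclidean_space set" and c \<eta> e p :: real
  assumes c: "0 < c" "c \<le> 1" and \<eta>: "0 < \<eta>" and e: "0 < e" and p: "1 < p"
  obtains C where "0 < C"
    "\<And>d m z x u. 0 < d \<Longrightarrow> open \<Omega> \<Longrightarrow> u \<in> borel_measurable borel \<Longrightarrow> (\<And>i. z i \<in> \<Omega>) \<Longrightarrow>
      (\<And>i. i < m \<Longrightarrow> c * (d * (1 + \<eta>) ^ i) \<le> bdist \<Omega> (z i) \<and> bdist \<Omega> (z i) \<le> d * (1 + \<eta>) ^ i \<and>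
        dist x (z i) \<le> d * (1 + \<eta>) ^ i) \<Longrightarrow>
      (\<Sum>i<m. ennreal ((d * (1 + \<eta>) ^ i) powr e * (bdist \<Omega> (z i) / 10) powr (- (2 * DIM('a) + 2 * p))) * strain_on u p (z i) (bdist \<Omega> (z i) / 10))
        \<le> ennreal C * strain_cone \<Omega> (3 / c) (e - (2 * DIM('a) + 2 * p)) u p x"
proof -
  define N where "N = 2 * DIM('a) + 2 * p"
  have N: "0 < N" using p by (simp add: N_def add_nonneg_pos)
  \<comment> \<open>4 / c is the ratio of the ends 2 / c \<delta>(y) and \<delta>(y) / 2 of the
    window for the scale.\<close>
  obtain n0 where n0: "4 / c < (1 + \<eta>) ^ n0" using real_arch_pow[of "1 + \<eta>" "4 / c"] \<eta> by auto
  \<comment> \<open>The two factors come from s i <= 2 / c \<delta>(y) and from \<delta>(z i) / 10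
    >= \<delta>(y) / 20.\<close>
  define B where "B = (2 / c) powr e * 20 powr N"
  have B: "0 < B" using c by (simp add: B_def)
  show thesis
  proof (rule that[of "B * (real n0 + 1)"])
    show "0 < B * (real n0 + 1)" using B by (simp add: add_nonneg_pos)
    fix d :: real and m :: nat and z :: "nat \<Rightarrow> 'a" and x :: 'a and u :: "'a \<Rightarrow> 'a"
    assume d: "0 < d" and [measurable]: "u \<in> borel_measurable borel" and zO: "\<And>i. z i \<in> \<Omega>" and "open \<Omega>"
      and chain: "\<And>i. i < m \<Longrightarrow> c * (d * (1 + \<eta>) ^ i) \<le> bdist \<Omega> (z i) \<and> bdist \<Omega> (z i) \<le> d * (1 + \<eta>) ^ i \<and>
        dist x (z i) \<le> d * (1 + \<eta>) ^ i"
    have [measurable]: "\<Omega> \<in> sets borel" using \<open>open \<Omega>\<close> by simp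
    define s where "s i = d * (1 + \<eta>) ^ i" for i :: nat
    have s: "0 < s i" for i using d \<eta> by (simp add: s_def)
    define Q where "Q y = ennreal (bdist \<Omega> y powr (e - N)) * strain_at u p y (2/5 * bdist \<Omega> y) y
        * indicator {y\<in>\<Omega>. dist y x \<le> 3 / c * bdist \<Omega> y} y" for y
    have [measurable]: "Q \<in> borel_measurable borel" unfolding Q_def by measurable
    define I where "I i y = (bdist \<Omega> y / 2 \<le> s i \<and> s i \<le> 2 / c * bdist \<Omega> y)" for i y
    have [measurable]: "Measurable.pred borel (I i)" for i unfolding I_def by measurable
    have each: "ennreal (s i powr e * (bdist \<Omega> (z i) / 10) powr (- N)) * strain_on u p (z i) (bdist \<Omega> (z i) / 10)
       \<le> (\<integral>\<^sup>+y. ennreal B * (Q y * of_bool (I i y)) \<partial>lborel)" if i: "i < m" for i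
    proof -
      let ?d = "bdist \<Omega> (z i)"
      have ch: "c * s i \<le> ?d" "?d \<le> s i" "dist x (z i) \<le> s i" using chain[OF i] by (auto simp: s_def)
      have d0: "0 < ?d" using ch(1) s[of i] c by (smt (verit) mult_pos_pos)
      have "ennreal (s i powr e * (?d / 10) powr (- N)) * strain_on u p (z i) (?d / 10)
        = (\<integral>\<^sup>+y. ennreal (s i powr e * (?d / 10) powr (- N)) * (strain_at u p (z i) (?d / 10) y * indicator (ball (z i) (?d / 10)) y) \<partial>lborel)"
        unfolding strain_on_def by (rule nn_integral_cmult[symmetric]) measurable
      also have "\<dots> \<le> (\<integral>\<^sup>+y. ennreal B * (Q y * of_bool (I i y)) \<partial>lborel)"
      proof (rule nn_integral_mono)
        fix y
        show "ennreal (s i powr e * (?d / 10) powr (- N)) * (strain_at u p (z i) (?d / 10) y * indicator (ball (z i) (?d / 10)) y)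
          \<le> ennreal B * (Q y * of_bool (I i y))"
        proof (cases "y \<in> ball (z i) (?d / 10)")
          case True
          note cmp = bdist_comparable[OF True]
          have dy: "0 < bdist \<Omega> y" using cmp d0 by simp
          have "ball (z i) (?d / 10) \<subseteq> ball (z i) ?d" using d0 by (intro subset_ball) simp
          then have yO: "y \<in> \<Omega>" using ball_bdist_subset[OF zO[of i]] True by blast
          have si: "s i \<le> ?d / c" using ch(1) c by (simp add: field_simps)
          have dc: "?d / c \<le> 10/9 * bdist \<Omega> y / c" using cmp(1) c by (intro divide_right_mono) auto
          have "0 \<le> bdist \<Omega> y / c" using dy c by simp
          then have si2: "s i \<le> 2 / c * bdist \<Omega> y" using si dc by simp
          have Iy: "I i y" unfolding I_def using si2 cmp(2) ch(2) d0 by auto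
          have "dist y x \<le> ?d / 10 + s i" using True ch(3) dist_triangle[of y x "z i"] by (simp add: dist_commute)
          also have "\<dots> \<le> 11/10 * s i" using ch(2) by simp
          also have "\<dots> \<le> 11/10 * (10/9 * bdist \<Omega> y / c)" using si dc by simp
          also have "\<dots> \<le> 3 / c * bdist \<Omega> y" using \<open>0 \<le> bdist \<Omega> y / c\<close> by simp
          finally have cone: "dist y x \<le> 3 / c * bdist \<Omega> y" .
          have "s i powr e * (?d / 10) powr (- N) \<le> (2 / c * bdist \<Omega> y) powr e * (bdist \<Omega> y / 20) powr (- N)"
            using si2 s[of i] e N dy d0 cmp by (intro mult_mono powr_mono2 powr_mono2') auto
          also have "\<dots> = B * bdist \<Omega> y powr (e - N)"
          proof -
            have "(bdist \<Omega> y / 20) powr (- N) = 20 powr N * bdist \<Omega> y powr (- N)"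
              using dy by (simp add: powr_divide powr_minus field_simps)
            moreover have "bdist \<Omega> y powr (e - N) = bdist \<Omega> y powr e * bdist \<Omega> y powr (- N)"
              by (simp flip: powr_add)
            moreover have "(2 / c * bdist \<Omega> y) powr e = (2 / c) powr e * bdist \<Omega> y powr e"
              by (rule powr_mult)
            ultimately show ?thesis by (simp add: B_def)
          qed
          finally have "ennreal (s i powr e * (?d / 10) powr (- N)) \<le> ennreal B * ennreal (bdist \<Omega> y powr (e - N))"
            using B by (simp add: ennreal_leI flip: ennreal_mult)
          moreover have "strain_at u p (z i) (?d / 10) y \<le> strain_at u p y (2/5 * bdist \<Omega> y) y"
            by (rule strain_at_le_centered[OF True]) simp
          ultimately have "ennreal (s i powr e * (?d / 10) powr (- N)) * strain_at u p (z i) (?d / 10) y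
             \<le> ennreal B * ennreal (bdist \<Omega> y powr (e - N)) * strain_at u p y (2/5 * bdist \<Omega> y) y"
            by (intro mult_mono) auto
          then show ?thesis using True yO cone Iy by (simp add: Q_def mult.assoc)
        qed simp
      qed
      finally show ?thesis .
    qed
    have "(\<Sum>i<m. ennreal (s i powr e * (bdist \<Omega> (z i) / 10) powr (- N)) * strain_on u p (z i) (bdist \<Omega> (z i) / 10))
      \<le> (\<Sum>i<m. \<integral>\<^sup>+y. ennreal B * (Q y * of_bool (I i y)) \<partial>lborel)"
      by (intro sum_mono each) auto
    also have "\<dots> = (\<integral>\<^sup>+y. (\<Sum>i<m. ennreal B * (Q y * of_bool (I i y))) \<partial>lborel)"
      by (rule nn_integral_sum[symmetric]) measurable
    also have "\<dots> \<le> (\<integral>\<^sup>+y. ennreal (B * (real n0 + 1)) * Q y \<partial>lborel)"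
    proof (rule nn_integral_mono)
      fix y
      have "(\<Sum>i<m. ennreal B * (Q y * of_bool (I i y))) = ennreal B * (Q y * (\<Sum>i<m. of_bool (I i y)))"
        by (simp only: sum_distrib_left)
      also have "\<dots> \<le> ennreal B * (Q y * ennreal (real n0 + 1))"
      proof (cases "0 < bdist \<Omega> y")
        case True
        have "(\<Sum>i<m. of_bool (I i y)) \<le> (of_nat n0 :: ennreal)"
          unfolding I_def s_def
        proof (rule sum_indicator_geometric_le)
          show "2 / c * bdist \<Omega> y < (1 + \<eta>) ^ n0 * (bdist \<Omega> y / 2)"
            using mult_strict_right_mono[OF n0, of "bdist \<Omega> y / 2"] True by simp
        qed (use \<eta> d True in auto)
        also have "\<dots> \<le> ennreal (real n0 + 1)" by (simp add: ennreal_of_nat_eq_real_of_nat)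
        finally show ?thesis by (intro mult_left_mono) auto
      next
        case False
        \<comment> \<open>At distance 0 from the boundary the weight is 0, since \<open>powr\<close>
          with base 0 is 0 for every exponent.\<close>
        then have "bdist \<Omega> y = 0" using bdist_nonneg[of \<Omega> y] by simp
        then have "Q y = 0" by (simp add: Q_def)
        then show ?thesis by simp
      qed
      also have "\<dots> = ennreal (B * (real n0 + 1)) * Q y"
        using B by (subst ennreal_mult) (auto simp: mult_ac)
      finally show "(\<Sum>i<m. ennreal B * (Q y * of_bool (I i y))) \<le> ennreal (B * (real n0 + 1)) * Q y" .
    qed
    also have "\<dots> = ennreal (B * (real n0 + 1)) * strain_cone \<Omega> (3 / c) (e - N) u p x"
      unfolding strain_cone_def Q_def[symmetric] by (rule nn_integral_cmult) measurable
    finally show "(\<Sum>i<m. ennreal ((d * (1 + \<eta>) ^ i) powr e * (bdist \<Omega> (z i) / 10) powr (- (2 * DIM('a) + 2 * p))) * strain_on u p (z i) (bdist \<Omega> (z i) / 10))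
        \<le> ennreal (B * (real n0 + 1)) * strain_cone \<Omega> (3 / c) (e - (2 * DIM('a) + 2 * p)) u p x"
      by (simp only: s_def N_def)
  qed
qed

lemma john_gradient_diff:
  fixes \<Omega> :: "'a::euclidean_space set" and p e :: real
  assumes J: "john_domain \<Omega>" and p: "1 < p" and e: "0 < e"
  obtains x0 K C where "x0 \<in> \<Omega>" "0 < K" "0 < C"
    "\<And>u x v. u \<in> borel_measurable borel \<Longrightarrow> (\<And>x. x \<in> \<Omega> \<Longrightarrow> set_integrable lborel (ball x (bdist \<Omega> x / 10)) u) \<Longrightarrow> x \<in> \<Omega> \<Longrightarrow>
      ennreal (norm (kgrad u x (bdist \<Omega> x / 20) v - kgrad u x0 (bdist \<Omega> x0 / 20) v) powr p)
        \<le> ennreal (C * bdist \<Omega> x powr (- e)) * strain_cone \<Omega> K (e - (2 * DIM('a) + 2 * p)) u p x * ennreal (norm v powr p)"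
proof -
  have op: "open \<Omega>" "bounded \<Omega>" using J by (auto simp: john_domain_def)
  obtain c x0 where c: "0 < c" "c \<le> 1" and x0: "x0 \<in> \<Omega>" and chain:
    "\<And>\<eta> x. 0 < \<eta> \<Longrightarrow> x \<in> \<Omega> \<Longrightarrow> \<exists>m z. z 0 = x \<and> z m = x0 \<and> (\<forall>i. z i \<in> \<Omega>) \<and>
      (\<forall>i<m. c * (bdist \<Omega> x * (1 + \<eta>) ^ i) \<le> bdist \<Omega> (z i) \<and> bdist \<Omega> (z i) \<le> bdist \<Omega> x * (1 + \<eta>) ^ i \<and>
        dist x (z i) \<le> bdist \<Omega> x * (1 + \<eta>) ^ i \<and> dist (z i) (z (Suc i)) \<le> \<eta> * (bdist \<Omega> x * (1 + \<eta>) ^ i))"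
    using john_chain_points[OF J] by blast
  \<comment> \<open>A link then has length at most \<eta> s i <= \<delta>(z i) / 80, as
    \<open>kgrad_step_bound\<close> requires.\<close>
  define \<eta> where "\<eta> = c / 80"
  have \<eta>: "0 < \<eta>" using c by (simp add: \<eta>_def)
  \<comment> \<open>With this choice \<mu>^i is the e-th power of s i / \<delta>(x): the factor (s
    i)^e goes into the weight of the cone, and \<delta>(x)^(-e) remains outside as the loss.\<close>
  define \<mu> where "\<mu> = (1 + \<eta>) powr e"
  have \<mu>: "1 < \<mu>" using \<eta> e by (simp add: \<mu>_def)
  obtain D where D: "0 < D" "\<And>a b. 0 \<le> a \<Longrightarrow> 0 \<le> b \<Longrightarrow> (a + b) powr p \<le> \<mu> * a powr p + D * b powr p"
    using powr_add_le_weighted[OF p \<mu>] by blast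
  obtain B where B: "0 < B"
    "\<And>u (z::'a::euclidean_space) z' d d' v. 0 < d \<Longrightarrow> dist z z' \<le> d / 80 \<Longrightarrow> \<bar>d' - d\<bar> \<le> d / 80 \<Longrightarrow>
      set_integrable lborel (ball z (d / 10)) u \<Longrightarrow> u \<in> borel_measurable borel \<Longrightarrow>
      ennreal (norm (kgrad u z' (d' / 20) v - kgrad u z (d / 20) v) powr p)
        \<le> ennreal (B * (d / 10) powr (- (2 * DIM('a) + 2 * p)) * norm v powr p) * strain_on u p z (d / 10)"
    using kgrad_step_bound[OF p] by blast
  obtain E where E: "0 < E"
    "\<And>d m z x u. 0 < d \<Longrightarrow> open \<Omega> \<Longrightarrow> u \<in> borel_measurable borel \<Longrightarrow> (\<And>i. z i \<in> \<Omega>) \<Longrightarrow>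
      (\<And>i. i < m \<Longrightarrow> c * (d * (1 + \<eta>) ^ i) \<le> bdist \<Omega> (z i) \<and> bdist \<Omega> (z i) \<le> d * (1 + \<eta>) ^ i \<and>
        dist x (z i) \<le> d * (1 + \<eta>) ^ i) \<Longrightarrow>
      (\<Sum>i<m. ennreal ((d * (1 + \<eta>) ^ i) powr e * (bdist \<Omega> (z i) / 10) powr (- (2 * DIM('a) + 2 * p))) * strain_on u p (z i) (bdist \<Omega> (z i) / 10))
        \<le> ennreal E * strain_cone \<Omega> (3 / c) (e - (2 * DIM('a) + 2 * p)) u p x"
    using chain_sum_le_strain_cone[OF c \<eta> e p] by blast
  show thesis
  proof (rule that[OF x0, of "3 / c" "D * B * E"])
    show "0 < 3 / c" "0 < D * B * E" using c D B E by auto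
    fix u :: "'a \<Rightarrow> 'a" and x v :: 'a
    assume [measurable]: "u \<in> borel_measurable borel" and u: "\<And>x. x \<in> \<Omega> \<Longrightarrow> set_integrable lborel (ball x (bdist \<Omega> x / 10)) u" and x: "x \<in> \<Omega>"
    define d where "d = bdist \<Omega> x"
    have d: "0 < d" unfolding d_def by (rule bdist_pos[OF op x])
    define s where "s i = d * (1 + \<eta>) ^ i" for i :: nat
    obtain m z where z: "z 0 = x" "z m = x0" "\<And>i. z i \<in> \<Omega>"
      "\<And>i. i < m \<Longrightarrow> c * s i \<le> bdist \<Omega> (z i) \<and> bdist \<Omega> (z i) \<le> s i \<and> dist x (z i) \<le> s i \<and> dist (z i) (z (Suc i)) \<le> \<eta> * s i"
      using chain[OF \<eta> x] unfolding s_def d_def by blast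
    define N where "N = 2 * DIM('a) + 2 * p"
    define b where "b i = ennreal (B * (bdist \<Omega> (z i) / 10) powr (- N) * norm v powr p) * strain_on u p (z i) (bdist \<Omega> (z i) / 10)" for i
    define f where "f i = kgrad u (z i) (bdist \<Omega> (z i) / 20) v" for i
    have "ennreal (norm (f 0 - f m) powr p) \<le> ennreal D * (\<Sum>i<m. ennreal (\<mu> ^ i) * b i)"
    proof (rule telescoping_powr_bound[OF p _ D])
      show "0 < \<mu>" using \<mu> by simp
      fix i assume i: "i < m"
      let ?d = "bdist \<Omega> (z i)"
      have "dist (z i) (z (Suc i)) \<le> \<eta> * s i" using z(4)[OF i] by simp
      also have "\<dots> \<le> ?d / 80" using z(4)[OF i] by (simp add: \<eta>_def)
      finally have dz: "dist (z i) (z (Suc i)) \<le> ?d / 80" .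
      show "ennreal (norm (f (Suc i) - f i) powr p) \<le> b i"
        unfolding f_def b_def N_def
      proof (rule B(2))
        show "0 < ?d" by (rule bdist_pos[OF op z(3)])
        show "\<bar>bdist \<Omega> (z (Suc i)) - ?d\<bar> \<le> ?d / 80"
          using dz bdist_lipschitz[of \<Omega> "z i" "z (Suc i)"] bdist_lipschitz[of \<Omega> "z (Suc i)" "z i"]
          unfolding abs_le_iff dist_commute[of "z (Suc i)" "z i"] by linarith
      qed (use dz u z(3) in auto)
    qed
    also have "(\<Sum>i<m. ennreal (\<mu> ^ i) * b i) = ennreal (B * d powr (- e)) * ennreal (norm v powr p) *
       (\<Sum>i<m. ennreal (s i powr e * (bdist \<Omega> (z i) / 10) powr (- N)) * strain_on u p (z i) (bdist \<Omega> (z i) / 10))"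
      unfolding sum_distrib_left
    proof (intro sum.cong refl)
      fix i
      have "\<mu> ^ i = ((1 + \<eta>) powr i) powr e" using \<eta> \<mu> by (simp add: \<mu>_def powr_powr mult.commute flip: powr_realpow)
      also have "\<dots> = ((1 + \<eta>) ^ i) powr e" using \<eta> by (simp add: powr_realpow)
      also have "\<dots> = d powr (- e) * s i powr e" using d \<eta> by (simp add: s_def powr_mult powr_minus)
      finally have m: "\<mu> ^ i = d powr (- e) * s i powr e" .
      show "ennreal (\<mu> ^ i) * b i = ennreal (B * d powr (- e)) * ennreal (norm v powr p) *
        (ennreal (s i powr e * (bdist \<Omega> (z i) / 10) powr (- N)) * strain_on u p (z i) (bdist \<Omega> (z i) / 10))"
        using B by (simp add: m b_def ennreal_mult mult_ac)
    qed
    also have "ennreal D * (ennreal (B * d powr (- e)) * ennreal (norm v powr p) *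
       (\<Sum>i<m. ennreal (s i powr e * (bdist \<Omega> (z i) / 10) powr (- N)) * strain_on u p (z i) (bdist \<Omega> (z i) / 10)))
       \<le> ennreal D * (ennreal (B * d powr (- e)) * ennreal (norm v powr p) *
       (ennreal E * strain_cone \<Omega> (3 / c) (e - N) u p x))"
      unfolding s_def N_def using z(3,4) op d unfolding s_def by (intro mult_left_mono E(2)) auto
    also have "\<dots> = ennreal (D * B * E * d powr (- e)) * strain_cone \<Omega> (3 / c) (e - N) u p x * ennreal (norm v powr p)"
      using D B E by (simp add: ennreal_mult mult_ac)
    finally show "ennreal (norm (kgrad u x (bdist \<Omega> x / 20) v - kgrad u x0 (bdist \<Omega> x0 / 20) v) powr p)
        \<le> ennreal (D * B * E * bdist \<Omega> x powr (- e)) * strain_cone \<Omega> (3 / c) (e - (2 * DIM('a) + 2 * p)) u p x * ennreal (norm v powr p)"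
      by (simp add: f_def z d_def N_def)
  qed
qed

text \<open>Adding both end values spares a case distinction on the sign of t; exponents such as p
  \<beta> have no fixed sign.\<close>

lemma powr_le_endpoints:
  fixes a b x t :: real assumes "0 < a" "a \<le> x" "x \<le> b"
  shows "x powr t \<le> a powr t + b powr t"
proof (cases "0 \<le> t")
  case True
  then have "x powr t \<le> b powr t" using assms by (intro powr_mono2) auto
  then show ?thesis by (simp add: add_increasing)
next
  case False
  then have "x powr t \<le> a powr t" using assms by (intro powr_mono2') auto
  then show ?thesis by (simp add: add_increasing2)
qed

lemma powr_comparable:
  fixes t :: real
  obtains C where "0 < C" "\<And>x y :: real. 0 < y \<Longrightarrow> y / 2 \<le> x \<Longrightarrow> x \<le> 2 * y \<Longrightarrow> x powr t \<le> C * y powr t"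
proof (rule that[of "(1/2) powr t + 2 powr t"])
  fix x y :: real assume "0 < y" "y / 2 \<le> x" "x \<le> 2 * y"
  then have "x powr t \<le> (y / 2) powr t + (2 * y) powr t" by (intro powr_le_endpoints) auto
  also have "\<dots> = ((1/2) powr t + 2 powr t) * y powr t"
    using powr_mult[of "1/2" y t] powr_mult[of 2 y t] by (simp add: algebra_simps)
  finally show "x powr t \<le> ((1/2) powr t + 2 powr t) * y powr t" .
qed (simp add: add_pos_pos)

lemma strain_cone_mono:
  assumes "K \<le> K'" shows "strain_cone \<Omega> K t u p x \<le> strain_cone \<Omega> K' t u p x"
  unfolding strain_cone_def
  by (intro nn_set_integral_set_mono) (use assms bdist_nonneg mult_right_mono in \<open>fastforce intro: order_trans\<close>)

text \<open>Replacing the gradient at x0 by its skew part changes it by half of \<open>kgrad\<close>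
  plus \<open>kadj\<close>, a strain term on the central ball. To fit it under the cone at x, the
  aperture is enlarged until the cone from every x contains that ball; and as \<delta> is bounded,
  \<delta>(x)^(-e) is bounded below and may be inserted.\<close>

lemma john_gradient_skew:
  fixes \<Omega> :: "'a::euclidean_space set" and p e :: real
  assumes J: "john_domain \<Omega>" and p: "1 < p" and e: "0 < e"
  obtains x0 K C where "x0 \<in> \<Omega>" "0 < K" "0 < C"
    "\<And>u x v. u \<in> borel_measurable borel \<Longrightarrow> (\<And>x. x \<in> \<Omega> \<Longrightarrow> set_integrable lborel (ball x (bdist \<Omega> x / 10)) u) \<Longrightarrow> x \<in> \<Omega> \<Longrightarrow>
      ennreal (norm (kgrad u x (bdist \<Omega> x / 20) v - (1/2) *\<^sub>R (kgrad u x0 (bdist \<Omega> x0 / 20) v - kadj u x0 (bdist \<Omega> x0 / 20) v)) powr p)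
        \<le> ennreal (C * bdist \<Omega> x powr (- e)) * strain_cone \<Omega> K (e - (2 * DIM('a) + 2 * p)) u p x * ennreal (norm v powr p)"
proof -
  have op: "open \<Omega>" "bounded \<Omega>" using J by (auto simp: john_domain_def)
  define t where "t = e - (2 * DIM('a) + 2 * p)"
  obtain x0 K1 C1 where x0: "x0 \<in> \<Omega>" and K1: "0 < K1" and C1: "0 < C1"
    "\<And>u x v. u \<in> borel_measurable borel \<Longrightarrow> (\<And>x. x \<in> \<Omega> \<Longrightarrow> set_integrable lborel (ball x (bdist \<Omega> x / 10)) u) \<Longrightarrow> x \<in> \<Omega> \<Longrightarrow>
      ennreal (norm (kgrad u x (bdist \<Omega> x / 20) v - kgrad u x0 (bdist \<Omega> x0 / 20) v) powr p)
        \<le> ennreal (C1 * bdist \<Omega> x powr (- e)) * strain_cone \<Omega> K1 t u p x * ennreal (norm v powr p)"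
    using john_gradient_diff[OF J p e] unfolding t_def by metis
  obtain B where B: "0 < B"
    "\<And>u (a::'a) r a' r' v. 0 < r \<Longrightarrow> r' \<le> 4 * r \<Longrightarrow> ball a r \<subseteq> ball a' r' \<Longrightarrow>
      set_integrable lborel (ball a' r') u \<Longrightarrow> u \<in> borel_measurable borel \<Longrightarrow>
      ennreal (norm (kgrad u a r v + kadj u a' r' v) powr p)
        \<le> ennreal (B * r' powr (- (2 * DIM('a) + 2 * p)) * norm v powr p) * strain_on u p a' r'"
    using kgrad_kadj_powr_bound[OF p] by blast
  obtain D where D: "0 < D" "\<And>a b c. 0 \<le> a \<Longrightarrow> 0 \<le> b \<Longrightarrow> 0 \<le> c \<Longrightarrow>
    ennreal ((a + b + c) powr p) \<le> ennreal D * (ennreal (a powr p) + ennreal (b powr p) + ennreal (c powr p))"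
    using ennreal_powr_add3_le[OF p] by blast
  define d where "d = bdist \<Omega> x0"
  have d: "0 < d" unfolding d_def by (rule bdist_pos[OF op x0])
  obtain L where L: "\<And>x y. x \<in> \<Omega> \<Longrightarrow> y \<in> \<Omega> \<Longrightarrow> dist x y \<le> L"
    using op(2) bounded_two_points by metis
  have L0: "0 \<le> L" using L[OF x0 x0] by simp
  define G where "G = L + d"
  have G: "0 < G" "\<And>x. x \<in> \<Omega> \<Longrightarrow> bdist \<Omega> x \<le> G"
  proof -
    show "0 < G" using L0 d by (simp add: G_def)
    fix x assume "x \<in> \<Omega>"
    then show "bdist \<Omega> x \<le> G" using bdist_lipschitz[of \<Omega> x x0] L[of x x0] x0 by (simp add: G_def d_def)
  qed
  \<comment> \<open>For y in the central ball \<delta>(y) >= 9/10 d, so the added term makes K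
    \<delta>(y) at least L, which bounds all distances in \<Omega>.\<close>
  define K where "K = K1 + 10/9 * L / d"
  have K: "0 < K" "K1 \<le> K" "10/9 * L / d \<le> K" using K1 L0 d by (auto simp: K_def add_pos_nonneg)
  \<comment> \<open>Bounds \<delta>(y)^(-t) on the central ball for either sign of t.\<close>
  define \<kappa> where "\<kappa> = (9/10 * d) powr (- t) + (11/10 * d) powr (- t)"
  have \<kappa>: "0 < \<kappa>" using d by (simp add: \<kappa>_def add_pos_pos)
  define F where "F = B * (d/20) powr (- (2 * DIM('a) + 2 * p)) * \<kappa> * G powr e"
  have F: "0 < F" using B \<kappa> G d by (simp add: F_def)
  show thesis
  proof (rule that[OF x0 K(1), of "D * (C1 + F)"])
    show "0 < D * (C1 + F)" using D C1 F by simp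
    fix u :: "'a \<Rightarrow> 'a" and x v :: 'a
    assume [measurable]: "u \<in> borel_measurable borel" and u: "\<And>x. x \<in> \<Omega> \<Longrightarrow> set_integrable lborel (ball x (bdist \<Omega> x / 10)) u" and x: "x \<in> \<Omega>"
    have [measurable]: "\<Omega> \<in> sets borel" using op by simp
    let ?S = "strain_cone \<Omega> K t u p x" and ?dx = "bdist \<Omega> x"
    have dx: "0 < ?dx" by (rule bdist_pos[OF op x])
    have on: "strain_on u p x0 (d / 20) \<le> ennreal \<kappa> * ?S"
    proof -
      have "strain_on u p x0 (d / 20) \<le> (\<integral>\<^sup>+y. ennreal \<kappa> * (ennreal (bdist \<Omega> y powr t) * strain_at u p y (2/5 * bdist \<Omega> y) y
          * indicator {y\<in>\<Omega>. dist y x \<le> K * bdist \<Omega> y} y) \<partial>lborel)"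
        unfolding strain_on_def
      proof (rule nn_integral_mono)
        fix y
        show "strain_at u p x0 (d / 20) y * indicator (ball x0 (d / 20)) y
          \<le> ennreal \<kappa> * (ennreal (bdist \<Omega> y powr t) * strain_at u p y (2/5 * bdist \<Omega> y) y
          * indicator {y\<in>\<Omega>. dist y x \<le> K * bdist \<Omega> y} y)"
        proof (cases "y \<in> ball x0 (d / 20)")
          case True
          then have y: "y \<in> ball x0 (bdist \<Omega> x0 / 10)" using d by (auto simp: d_def)
          note cmp = bdist_comparable[OF y, folded d_def]
          have "y \<in> ball x0 (bdist \<Omega> x0)" using y d by (simp add: d_def)
          then have yO: "y \<in> \<Omega>" using ball_bdist_subset[OF x0] by blast
          have dy: "0 < bdist \<Omega> y" by (rule bdist_pos[OF op yO])
          have "dist y x \<le> L" by (rule L[OF yO x])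
          also have "\<dots> = 10/9 * L / d * (9/10 * d)" using d by simp
          also have "\<dots> \<le> K * bdist \<Omega> y" using K cmp d by (intro mult_mono) auto
          finally have cone: "dist y x \<le> K * bdist \<Omega> y" .
          have "bdist \<Omega> y powr (- t) \<le> \<kappa>" unfolding \<kappa>_def using cmp d by (intro powr_le_endpoints) auto
          then have "bdist \<Omega> y powr (- t) * bdist \<Omega> y powr t \<le> \<kappa> * bdist \<Omega> y powr t" by (rule mult_right_mono) simp
          then have "1 \<le> \<kappa> * bdist \<Omega> y powr t" using dy by (simp flip: powr_add)
          then have one: "1 \<le> ennreal \<kappa> * ennreal (bdist \<Omega> y powr t)" using \<kappa> by (simp flip: ennreal_mult)
          have "1 * strain_at u p x0 (d / 20) y \<le> (ennreal \<kappa> * ennreal (bdist \<Omega> y powr t)) * strain_at u p y (2/5 * bdist \<Omega> y) y"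
            using d by (intro mult_mono one strain_at_le_centered[OF y]) (auto simp: d_def)
          then show ?thesis using True yO cone by (simp add: mult.assoc)
        qed simp
      qed
      also have "\<dots> = ennreal \<kappa> * ?S" unfolding strain_cone_def by (rule nn_integral_cmult) measurable
      finally show ?thesis .
    qed
    let ?k = "kgrad u x0 (d/20) v" and ?T = "kadj u x0 (d/20) v"
    let ?a = "norm (kgrad u x (?dx / 20) v - ?k)" and ?b = "norm (?k + ?T)"
    have bb: "ennreal (?b powr p) \<le> ennreal (F * ?dx powr (- e)) * ?S * ennreal (norm v powr p)"
    proof -
      have "set_integrable lborel (ball x0 (d / 20)) u"
        by (rule set_integrable_subset[OF u[OF x0]]) (use d in \<open>auto simp: d_def\<close>)
      then have "ennreal (?b powr p) \<le> ennreal (B * (d/20) powr (- (2 * DIM('a) + 2 * p)) * norm v powr p) * strain_on u p x0 (d/20)"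
        using d by (intro B(2)) auto
      also have "\<dots> \<le> ennreal (B * (d/20) powr (- (2 * DIM('a) + 2 * p)) * norm v powr p) * (ennreal \<kappa> * ?S)"
        by (intro mult_left_mono on) auto
      also have "\<dots> = ennreal (B * (d/20) powr (- (2 * DIM('a) + 2 * p)) * \<kappa>) * ?S * ennreal (norm v powr p)"
        using B \<kappa> by (simp add: ennreal_mult mult_ac)
      also have "\<dots> \<le> ennreal (F * ?dx powr (- e)) * ?S * ennreal (norm v powr p)"
      proof (intro mult_right_mono ennreal_leI)
        have "?dx powr e * ?dx powr (- e) \<le> G powr e * ?dx powr (- e)"
          using G(2)[OF x] dx e by (intro mult_right_mono powr_mono2) auto
        then have "1 \<le> G powr e * ?dx powr (- e)" using dx by (simp flip: powr_add)
        then have "(B * (d/20) powr (- (2 * DIM('a) + 2 * p)) * \<kappa>) * 1 \<le> (B * (d/20) powr (- (2 * DIM('a) + 2 * p)) * \<kappa>) * (G powr e * ?dx powr (- e))"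
          using B \<kappa> by (intro mult_left_mono) auto
        then show "B * (d/20) powr (- (2 * DIM('a) + 2 * p)) * \<kappa> \<le> F * ?dx powr (- e)"
          by (simp add: F_def mult_ac)
      qed auto
      finally show ?thesis .
    qed
    have aa: "ennreal (?a powr p) \<le> ennreal (C1 * ?dx powr (- e)) * ?S * ennreal (norm v powr p)"
    proof -
      have "ennreal (?a powr p) \<le> ennreal (C1 * ?dx powr (- e)) * strain_cone \<Omega> K1 t u p x * ennreal (norm v powr p)"
        unfolding d_def using u x by (intro C1(2)) auto
      also have "\<dots> \<le> ennreal (C1 * ?dx powr (- e)) * ?S * ennreal (norm v powr p)"
        by (intro mult_right_mono mult_left_mono strain_cone_mono K(2)) auto
      finally show ?thesis .
    qed
    have "?k - (1/2) *\<^sub>R (?k - ?T) = (1/2) *\<^sub>R (?k + ?T)"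
      using scaleR_half_double[of ?k] by (simp add: algebra_simps)
    then have "norm (?k - (1/2) *\<^sub>R (?k - ?T)) = ?b / 2" by simp
    then have "norm (kgrad u x (?dx / 20) v - (1/2) *\<^sub>R (?k - ?T)) \<le> ?a + ?b + 0"
      using norm_triangle_ineq[of "kgrad u x (?dx / 20) v - ?k" "?k - (1/2) *\<^sub>R (?k - ?T)"] norm_ge_zero[of "?k + ?T"] by (simp del: norm_ge_zero)
    then have "ennreal (norm (kgrad u x (?dx / 20) v - (1/2) *\<^sub>R (?k - ?T)) powr p) \<le> ennreal ((?a + ?b + 0) powr p)"
      using p by (intro ennreal_leI powr_mono2) auto
    also have "\<dots> \<le> ennreal D * (ennreal (?a powr p) + ennreal (?b powr p) + ennreal (0 powr p))"
      by (intro D(2)) auto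
    also have "\<dots> \<le> ennreal D * (ennreal (C1 * ?dx powr (- e)) * ?S * ennreal (norm v powr p) + ennreal (F * ?dx powr (- e)) * ?S * ennreal (norm v powr p) + 0)"
      by (intro mult_left_mono add_mono aa bb) auto
    also have "\<dots> = ennreal (D * (C1 + F) * ?dx powr (- e)) * ?S * ennreal (norm v powr p)"
      using D C1 F by (simp add: ennreal_mult distrib_left distrib_right mult_ac)
    finally show "ennreal (norm (kgrad u x (bdist \<Omega> x / 20) v - (1/2) *\<^sub>R (kgrad u x0 (bdist \<Omega> x0 / 20) v - kadj u x0 (bdist \<Omega> x0 / 20) v)) powr p)
        \<le> ennreal (D * (C1 + F) * bdist \<Omega> x powr (- e)) * strain_cone \<Omega> K (e - (2 * DIM('a) + 2 * p)) u p x * ennreal (norm v powr p)"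
      unfolding d_def t_def .
  qed
qed

section \<open>Fubini estimates\<close>

text \<open>The terms grow geometrically in k, so the sum is dominated by the last scale still above
  d, whose power is at most d^(-\<alpha>). If R <= d, and in particular if R is not positive, both
  sides are 0.\<close>

lemma suminf_dyadic_le:
  fixes \<alpha> :: real assumes \<alpha>: "0 < \<alpha>"
  obtains C where "0 < C" "\<And>R d. 0 < d \<Longrightarrow>
    (\<Sum>k. ennreal ((R / 2 ^ k) powr (- \<alpha>)) * of_bool (d < R / 2 ^ k)) \<le> ennreal (C * d powr (- \<alpha>)) * of_bool (d < R)"
proof -
  define q where "q = 2 powr (- \<alpha>)"
  have q: "0 < q" "q < 1" using \<alpha> powr_less_mono[of "- \<alpha>" 0 "2::real"] by (auto simp: q_def)
  show thesis
  proof (rule that[of "1 / (1 - q)"])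
    show "0 < 1 / (1 - q)" using q by simp
    fix R d :: real assume d: "0 < d"
    have mono: "R / 2 ^ j \<le> R / 2 ^ i" if "0 < R" "i \<le> j" for i j :: nat
      using that by (intro divide_left_mono power_increasing) auto
    show "(\<Sum>k. ennreal ((R / 2 ^ k) powr (- \<alpha>)) * of_bool (d < R / 2 ^ k)) \<le> ennreal (1 / (1 - q) * d powr (- \<alpha>)) * of_bool (d < R)"
    proof (cases "d < R")
      case False
      have "\<not> d < R / 2 ^ k" for k :: nat
      proof (cases "0 < R")
        case True then show ?thesis using mono[of 0 k] False by simp
      next
        case F: False
        then have "R / 2 ^ k \<le> 0" by (simp add: divide_nonpos_pos)
        then show ?thesis using d by simp
      qed
      then show ?thesis by simp
    next
      case True
      then have R: "0 < R" using d by simp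
      define a where "a k = (R / 2 ^ k) powr (- \<alpha>)" for k :: nat
      have a: "0 \<le> a k" "a k = q * a (Suc k)" for k
      proof -
        have "a (Suc k) = ((R / 2 ^ k) / 2) powr (- \<alpha>)" by (simp add: a_def mult.commute)
        also have "\<dots> = 2 powr \<alpha> * a k" unfolding a_def using R by (intro powr_half) simp
        finally show "a k = q * a (Suc k)" by (simp add: q_def powr_minus)
      qed (simp add: a_def)
      have sum: "(\<Sum>i<Suc K. a i) \<le> a K / (1 - q)" for K
      proof (induction K)
        case 0 then show ?case using q a(1)[of 0] by (simp add: field_simps)
      next
        case (Suc K)
        have "(\<Sum>i<Suc (Suc K). a i) \<le> a K / (1 - q) + a (Suc K)" using Suc by simp
        also have "\<dots> = a (Suc K) / (1 - q)" using q by (simp add: a(2)[of K] field_simps)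
        finally show ?case .
      qed
      obtain K where K: "R / 2 ^ Suc K \<le> d" "d < R / 2 ^ K" using obtain_dyadic[OF d True] by blast
      have "(\<Sum>k. ennreal (a k) * of_bool (d < R / 2 ^ k)) = (\<Sum>k<Suc K. ennreal (a k) * of_bool (d < R / 2 ^ k))"
      proof (rule suminf_finite)
        fix k assume "k \<notin> {..<Suc K}"
        then have "R / 2 ^ k \<le> R / 2 ^ Suc K" by (intro mono R) simp
        then show "ennreal (a k) * of_bool (d < R / 2 ^ k) = 0" using K(1) by simp
      qed simp
      also have "\<dots> \<le> (\<Sum>k<Suc K. ennreal (a k))"
      proof (rule sum_mono)
        fix k show "ennreal (a k) * of_bool (d < R / 2 ^ k) \<le> ennreal (a k)"
          by (cases "d < R / 2 ^ k") (simp_all only: of_bool_eq mult_1_right mult_zero_right order_refl zero_le)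
      qed
      also have "\<dots> = ennreal (\<Sum>k<Suc K. a k)" by (rule sum_ennreal) (rule a(1))
      also have "\<dots> \<le> ennreal (a K / (1 - q))" by (intro ennreal_leI sum)
      also have "\<dots> \<le> ennreal (1 / (1 - q) * d powr (- \<alpha>))"
      proof (rule ennreal_leI)
        have "a K \<le> d powr (- \<alpha>)" unfolding a_def using K(2) d \<alpha> by (intro powr_mono2') auto
        then have "a K / (1 - q) \<le> d powr (- \<alpha>) / (1 - q)" using q by (intro divide_right_mono) auto
        then show "a K / (1 - q) \<le> 1 / (1 - q) * d powr (- \<alpha>)" by simp
      qed
      finally show ?thesis using True by (simp add: a_def)
    qed
  qed
qed

text \<open>For \<alpha> = n + p + s p this is the inner integral of the X-energy without the
  boundary weight.\<close>

definition strain_kern :: "('a::euclidean_space \<Rightarrow> 'a) \<Rightarrow> real \<Rightarrow> real \<Rightarrow> real \<Rightarrow> 'a \<Rightarrow> ennreal" where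
  "strain_kern u p \<alpha> r y = (\<integral>\<^sup>+z\<in>ball y r. ennreal (\<bar>strain u y z\<bar> powr p / norm (z - y) powr \<alpha>) \<partial>lborel)"

lemma strain_kern_measurable [measurable (raw)]:
  fixes u :: "'a::euclidean_space \<Rightarrow> 'a"
  assumes [measurable]: "u \<in> borel_measurable borel" "g \<in> borel_measurable M" "h \<in> borel_measurable M"
  shows "(\<lambda>x. strain_kern u p \<alpha> (g x) (h x)) \<in> borel_measurable M"
  unfolding strain_kern_def by measurable

lemma strain_kern_mono: "r \<le> r' \<Longrightarrow> strain_kern u p \<alpha> r y \<le> strain_kern u p \<alpha> r' y"
  unfolding strain_kern_def by (intro nn_set_integral_set_mono subset_ball)

text \<open>After exchanging sum and integral, only the scales above |z - y| remain for each z, and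
  their geometric sum is the singular weight. On the diagonal the strain is zero.\<close>

lemma suminf_strain_at_le:
  fixes \<alpha> p :: real assumes \<alpha>: "0 < \<alpha>"
  obtains C where "0 < C" "\<And>u (y::'a::euclidean_space) R. u \<in> borel_measurable borel \<Longrightarrow>
    (\<Sum>k. ennreal ((R / 2 ^ k) powr (- \<alpha>)) * strain_at u p y (R / 2 ^ k) y) \<le> ennreal C * strain_kern u p \<alpha> R y"
proof -
  obtain C where C: "0 < C" "\<And>R d. 0 < d \<Longrightarrow>
    (\<Sum>k. ennreal ((R / 2 ^ k) powr (- \<alpha>)) * of_bool (d < R / 2 ^ k)) \<le> ennreal (C * d powr (- \<alpha>)) * of_bool (d < R)"
    using suminf_dyadic_le[OF \<alpha>] by blast
  show thesis
  proof (rule that[OF C(1)])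
    fix u :: "'a \<Rightarrow> 'a" and y :: 'a and R :: real assume [measurable]: "u \<in> borel_measurable borel"
    let ?e = "\<lambda>z. ennreal (\<bar>strain u y z\<bar> powr p)"
    have "(\<Sum>k. ennreal ((R / 2 ^ k) powr (- \<alpha>)) * strain_at u p y (R / 2 ^ k) y)
      = (\<Sum>k. \<integral>\<^sup>+z. ennreal ((R / 2 ^ k) powr (- \<alpha>)) * (?e z * indicator (ball y (R / 2 ^ k)) z) \<partial>lborel)"
      unfolding strain_at_def by (intro suminf_cong nn_integral_cmult[symmetric]) measurable
    also have "\<dots> = (\<integral>\<^sup>+z. (\<Sum>k. ennreal ((R / 2 ^ k) powr (- \<alpha>)) * (?e z * indicator (ball y (R / 2 ^ k)) z)) \<partial>lborel)"
      by (rule nn_integral_suminf[symmetric]) measurable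
    also have "\<dots> \<le> (\<integral>\<^sup>+z. ennreal C * (ennreal (\<bar>strain u y z\<bar> powr p / norm (z - y) powr \<alpha>) * indicator (ball y R) z) \<partial>lborel)"
    proof (rule nn_integral_mono)
      fix z
      show "(\<Sum>k. ennreal ((R / 2 ^ k) powr (- \<alpha>)) * (?e z * indicator (ball y (R / 2 ^ k)) z))
        \<le> ennreal C * (ennreal (\<bar>strain u y z\<bar> powr p / norm (z - y) powr \<alpha>) * indicator (ball y R) z)"
      proof (cases "z = y")
        case True then show ?thesis by (simp add: strain_def)
      next
        case False
        then have d: "0 < norm (z - y)" by simp
        have ind: "indicator (ball y r) z = (of_bool (norm (z - y) < r) :: ennreal)" for r
          by (simp add: indicator_def dist_norm norm_minus_commute)
        have "(\<Sum>k. ennreal ((R / 2 ^ k) powr (- \<alpha>)) * (?e z * indicator (ball y (R / 2 ^ k)) z))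
          = (\<Sum>k. ?e z * (ennreal ((R / 2 ^ k) powr (- \<alpha>)) * of_bool (norm (z - y) < R / 2 ^ k)))"
          by (simp add: ind mult_ac)
        also have "\<dots> = ?e z * (\<Sum>k. ennreal ((R / 2 ^ k) powr (- \<alpha>)) * of_bool (norm (z - y) < R / 2 ^ k))"
          by (rule ennreal_suminf_cmult)
        also have "\<dots> \<le> ?e z * (ennreal (C * norm (z - y) powr (- \<alpha>)) * of_bool (norm (z - y) < R))"
          by (intro mult_left_mono C(2) d) auto
        also have "\<dots> = ennreal C * (ennreal (\<bar>strain u y z\<bar> powr p / norm (z - y) powr \<alpha>) * indicator (ball y R) z)"
          using C(1) by (simp add: ind powr_minus divide_inverse ennreal_mult mult_ac)
        finally show ?thesis .
      qed
    qed
    also have "\<dots> = ennreal C * strain_kern u p \<alpha> R y"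
      unfolding strain_kern_def by (rule nn_integral_cmult) measurable
    finally show "(\<Sum>k. ennreal ((R / 2 ^ k) powr (- \<alpha>)) * strain_at u p y (R / 2 ^ k) y) \<le> ennreal C * strain_kern u p \<alpha> R y" .
  qed
qed

text \<open>Inside the ball the constant r^(-\<alpha>) is below the singular weight; at the centre,
  where the weight divides by 0, the strain vanishes.\<close>

lemma strain_at_le_strain_kern:
  fixes u :: "'a::euclidean_space \<Rightarrow> 'a"
  assumes r: "0 < r" and \<alpha>: "0 \<le> \<alpha>" and [measurable]: "u \<in> borel_measurable borel"
  shows "ennreal (r powr (- \<alpha>)) * strain_at u p y r y \<le> strain_kern u p \<alpha> r y"
proof -
  have "ennreal (r powr (- \<alpha>)) * strain_at u p y r y
    = (\<integral>\<^sup>+z. ennreal (r powr (- \<alpha>)) * (ennreal (\<bar>strain u y z\<bar> powr p) * indicator (ball y r) z) \<partial>lborel)"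
    unfolding strain_at_def by (rule nn_integral_cmult[symmetric]) measurable
  also have "\<dots> \<le> strain_kern u p \<alpha> r y" unfolding strain_kern_def
  proof (rule nn_integral_mono)
    fix z
    show "ennreal (r powr (- \<alpha>)) * (ennreal (\<bar>strain u y z\<bar> powr p) * indicator (ball y r) z)
      \<le> ennreal (\<bar>strain u y z\<bar> powr p / norm (z - y) powr \<alpha>) * indicator (ball y r) z"
    proof (cases "z \<noteq> y \<and> z \<in> ball y r")
      case True
      then have "0 < norm (z - y)" "norm (z - y) \<le> r" by (auto simp: dist_norm norm_minus_commute)
      then have "r powr (- \<alpha>) \<le> norm (z - y) powr (- \<alpha>)" using \<alpha> by (intro powr_mono2') auto
      then have "r powr (- \<alpha>) * \<bar>strain u y z\<bar> powr p \<le> norm (z - y) powr (- \<alpha>) * \<bar>strain u y z\<bar> powr p"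
        by (rule mult_right_mono) simp
      then have "r powr (- \<alpha>) * \<bar>strain u y z\<bar> powr p \<le> \<bar>strain u y z\<bar> powr p / norm (z - y) powr \<alpha>"
        by (simp add: powr_minus divide_inverse mult.commute)
      then show ?thesis using True by (simp add: ennreal_leI flip: ennreal_mult)
    qed (auto simp: strain_def)
  qed
  finally show ?thesis .
qed

text \<open>Seen from y, the vertices x of all cones containing y lie in a ball of radius comparable
  to \<delta>(y), and \<delta>(x) is bounded by that radius. Integrating \<delta>(x)^q over it gives
  at most a multiple of \<delta>(y)^(n + q): this is where the dimension of the boundary
  enters.\<close>

lemma nn_integral_strain_cone_le:
  fixes \<Omega> :: "'a::euclidean_space set" and q t p K :: real
  assumes op: "open \<Omega>" "bounded \<Omega>" and K: "0 < K" and dim: "assouad_dim (frontier \<Omega>) < DIM('a) + q"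
  obtains C where "0 < C" "\<And>u. u \<in> borel_measurable borel \<Longrightarrow>
    (\<integral>\<^sup>+x\<in>\<Omega>. ennreal (bdist \<Omega> x powr q) * strain_cone \<Omega> K t u p x \<partial>lborel)
    \<le> ennreal C * (\<integral>\<^sup>+y\<in>\<Omega>. ennreal (bdist \<Omega> y powr (t + DIM('a) + q)) * strain_at u p y (2/5 * bdist \<Omega> y) y \<partial>lborel)"
proof (cases "\<Omega> = {}")
  case True
  \<comment> \<open>An empty domain has an empty boundary, to which the distance estimate does not
    apply; here both integrals are 0.\<close>
  then show thesis by (intro that[of 1]) auto
next
  case False
  have E: "closed (frontier \<Omega>)" "frontier \<Omega> \<noteq> {}" using frontier_nonempty[OF op(2) False] by auto
  obtain C where C: "0 < C" "\<And>w M. 0 < M \<Longrightarrow>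
    (\<integral>\<^sup>+x\<in>{x \<in> ball w M. 0 < infdist x (frontier \<Omega>) \<and> infdist x (frontier \<Omega>) \<le> M}. ennreal (infdist x (frontier \<Omega>) powr q) \<partial>lborel)
      \<le> ennreal (C * M powr (DIM('a) + q))"
    using nn_integral_infdist_powr_le[OF E dim] by blast
  show thesis
  proof (rule that[of "C * (K + 1) powr (DIM('a) + q)"])
    show "0 < C * (K + 1) powr (DIM('a) + q)" using C K by simp
    fix u :: "'a \<Rightarrow> 'a" assume [measurable]: "u \<in> borel_measurable borel"
    have [measurable]: "\<Omega> \<in> sets borel" using op by simp
    define g where "g y = ennreal (bdist \<Omega> y powr t) * strain_at u p y (2/5 * bdist \<Omega> y) y" for y
    have [measurable]: "g \<in> borel_measurable borel" unfolding g_def by measurable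
    define h where "h x y = ennreal (bdist \<Omega> x powr q) * indicator \<Omega> x * (g y * indicator \<Omega> y) * of_bool (dist y x \<le> K * bdist \<Omega> y)" for x y
    have [measurable]: "(\<lambda>(x, y). h x y) \<in> borel_measurable (borel \<Otimes>\<^sub>M borel)"
      unfolding h_def by measurable
    have "(\<integral>\<^sup>+x\<in>\<Omega>. ennreal (bdist \<Omega> x powr q) * strain_cone \<Omega> K t u p x \<partial>lborel) = (\<integral>\<^sup>+x. \<integral>\<^sup>+y. h x y \<partial>lborel \<partial>lborel)"
    proof (rule nn_integral_cong)
      fix x
      have "(\<integral>\<^sup>+y. h x y \<partial>lborel) = (\<integral>\<^sup>+y. (ennreal (bdist \<Omega> x powr q) * indicator \<Omega> x) * (g y * indicator {y\<in>\<Omega>. dist y x \<le> K * bdist \<Omega> y} y) \<partial>lborel)"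
        by (intro nn_integral_cong) (auto simp: h_def indicator_def)
      also have "\<dots> = (ennreal (bdist \<Omega> x powr q) * indicator \<Omega> x) * strain_cone \<Omega> K t u p x"
        unfolding strain_cone_def g_def by (rule nn_integral_cmult) measurable
      finally show "ennreal (bdist \<Omega> x powr q) * strain_cone \<Omega> K t u p x * indicator \<Omega> x = (\<integral>\<^sup>+y. h x y \<partial>lborel)"
        by (simp add: mult_ac)
    qed
    also have "\<dots> = (\<integral>\<^sup>+y. \<integral>\<^sup>+x. h x y \<partial>lborel \<partial>lborel)"
      by (rule lborel_pair.Fubini'[symmetric]) simp
    also have "\<dots> \<le> (\<integral>\<^sup>+y. ennreal (C * (K + 1) powr (DIM('a) + q)) *
        (ennreal (bdist \<Omega> y powr (t + DIM('a) + q)) * strain_at u p y (2/5 * bdist \<Omega> y) y * indicator \<Omega> y) \<partial>lborel)"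
    proof (rule nn_integral_mono)
      fix y
      show "(\<integral>\<^sup>+x. h x y \<partial>lborel) \<le> ennreal (C * (K + 1) powr (DIM('a) + q)) *
        (ennreal (bdist \<Omega> y powr (t + DIM('a) + q)) * strain_at u p y (2/5 * bdist \<Omega> y) y * indicator \<Omega> y)"
      proof (cases "y \<in> \<Omega>")
        case True
        have dy: "0 < bdist \<Omega> y" by (rule bdist_pos[OF op True])
        \<comment> \<open>K + 1 instead of K serves twice: it gives the strict inequality for the
          open ball, and it bounds \<delta>(x) <= \<delta>(y) + dist y x.\<close>
        define M where "M = (K + 1) * bdist \<Omega> y"
        have M: "0 < M" using K dy by (simp add: M_def)
        let ?B = "{x \<in> ball y M. 0 < infdist x (frontier \<Omega>) \<and> infdist x (frontier \<Omega>) \<le> M}"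
        have "(\<integral>\<^sup>+x. h x y \<partial>lborel) \<le> (\<integral>\<^sup>+x. g y * (ennreal (infdist x (frontier \<Omega>) powr q) * indicator ?B x) \<partial>lborel)"
        proof (rule nn_integral_mono)
          fix x
          show "h x y \<le> g y * (ennreal (infdist x (frontier \<Omega>) powr q) * indicator ?B x)"
          proof (cases "x \<in> \<Omega> \<and> dist y x \<le> K * bdist \<Omega> y")
            case xy: True
            have "dist y x < M" using xy dy by (simp add: M_def algebra_simps)
            moreover have "bdist \<Omega> x \<le> M" using bdist_lipschitz[of \<Omega> x y] xy by (simp add: M_def algebra_simps dist_commute)
            moreover have "0 < bdist \<Omega> x" using bdist_pos[OF op] xy by simp
            ultimately have "x \<in> ?B" by (simp add: bdist_def)
            then show ?thesis using xy True by (simp add: h_def bdist_def mult_ac)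
          qed (auto simp: h_def)
        qed
        also have "\<dots> = g y * (\<integral>\<^sup>+x\<in>?B. ennreal (infdist x (frontier \<Omega>) powr q) \<partial>lborel)"
          by (rule nn_integral_cmult) measurable
        also have "\<dots> \<le> g y * ennreal (C * M powr (DIM('a) + q))"
          by (intro mult_left_mono C(2) M) auto
        also have "C * M powr (DIM('a) + q) = C * (K + 1) powr (DIM('a) + q) * bdist \<Omega> y powr (DIM('a) + q)"
          by (simp add: M_def powr_mult)
        also have "g y * ennreal \<dots> = ennreal (C * (K + 1) powr (DIM('a) + q)) * (ennreal (bdist \<Omega> y powr t * bdist \<Omega> y powr (DIM('a) + q)) * strain_at u p y (2/5 * bdist \<Omega> y) y)"
          using C by (simp add: g_def ennreal_mult mult_ac)
        also have "bdist \<Omega> y powr t * bdist \<Omega> y powr (DIM('a) + q) = bdist \<Omega> y powr (t + DIM('a) + q)"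
          by (simp add: add.assoc flip: powr_add)
        finally show ?thesis using True by simp
      qed (simp add: h_def)
    qed
    also have "\<dots> = ennreal (C * (K + 1) powr (DIM('a) + q)) * (\<integral>\<^sup>+y\<in>\<Omega>. ennreal (bdist \<Omega> y powr (t + DIM('a) + q)) * strain_at u p y (2/5 * bdist \<Omega> y) y \<partial>lborel)"
      by (rule nn_integral_cmult) measurable
    finally show "(\<integral>\<^sup>+x\<in>\<Omega>. ennreal (bdist \<Omega> x powr q) * strain_cone \<Omega> K t u p x \<partial>lborel) \<le> \<dots>" .
  qed
qed

text \<open>At each scale the double integral around x is rewritten with radii depending on y.
  Integrating out x gains the volume \<sigma>^n, which lowers the exponent n + \<alpha> to \<alpha>,
  and what remains of the sum over k is \<open>suminf_strain_at_le\<close>.\<close>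

lemma nn_integral_suminf_strain_on_le:
  fixes \<Omega> :: "'a::euclidean_space set" and \<alpha> a p :: real
  assumes op: "open \<Omega>" "bounded \<Omega>" and \<alpha>: "0 < \<alpha>"
  obtains C where "0 < C" "\<And>u. u \<in> borel_measurable borel \<Longrightarrow>
    (\<integral>\<^sup>+x\<in>\<Omega>. ennreal (bdist \<Omega> x powr a) * (\<Sum>k. ennreal ((bdist \<Omega> x / 20 / 2 ^ k) powr (- (DIM('a) + \<alpha>))) * strain_on u p x (bdist \<Omega> x / 20 / 2 ^ k)) \<partial>lborel)
    \<le> ennreal C * (\<integral>\<^sup>+y\<in>\<Omega>. ennreal (bdist \<Omega> y powr a) * strain_kern u p \<alpha> (2/5 * bdist \<Omega> y) y \<partial>lborel)"
proof -
  obtain Ca where Ca: "0 < Ca" "\<And>x y :: real. 0 < y \<Longrightarrow> y / 2 \<le> x \<Longrightarrow> x \<le> 2 * y \<Longrightarrow> x powr a \<le> Ca * y powr a"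
    using powr_comparable by blast
  obtain Cs where Cs: "0 < Cs" "\<And>u (y::'a::euclidean_space) R. u \<in> borel_measurable borel \<Longrightarrow>
    (\<Sum>k. ennreal ((R / 2 ^ k) powr (- \<alpha>)) * strain_at u p y (R / 2 ^ k) y) \<le> ennreal Cs * strain_kern u p \<alpha> R y"
    using suminf_strain_at_le[OF \<alpha>] by blast
  define w where "w = measure lborel (ball (0::'a) 1)"
  have w: "0 < w" by (simp add: w_def content_ball_pos)
  define n where "n = real DIM('a)"
  have n: "0 \<le> n" by (simp add: n_def)
  define B where "B = Ca * 4 powr (n + \<alpha>)"
  have B: "0 < B" using Ca by (simp add: B_def)
  show thesis
  proof (rule that[of "B * w * 2 powr \<alpha> * Cs"])
    show "0 < B * w * 2 powr \<alpha> * Cs" using B w Cs by simp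
    fix u :: "'a \<Rightarrow> 'a" assume [measurable]: "u \<in> borel_measurable borel"
    have [measurable]: "\<Omega> \<in> sets borel" using op by simp
    \<comment> \<open>\<delta>(y) is within ten per cent of \<delta>(x), so the radius r at x
      satisfies r <= \<open>\<sigma> k y\<close> <= 4 r. Hence x lies within
      \<open>\<sigma> k y\<close> of y, and the ball around x within
      \<open>2 * \<sigma> k y\<close>.\<close>
    define \<sigma> where "\<sigma> k y = bdist \<Omega> y / 10 / 2 ^ k" for k :: nat and y
    have [measurable]: "\<sigma> k \<in> borel_measurable borel" for k unfolding \<sigma>_def by measurable
    define g where "g k y = ennreal (B * bdist \<Omega> y powr a * \<sigma> k y powr (- (n + \<alpha>))) * strain_at u p y (2 * \<sigma> k y) y * indicator \<Omega> y" for k y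
    have [measurable]: "g k \<in> borel_measurable borel" for k unfolding g_def by measurable
    have "(\<integral>\<^sup>+x\<in>\<Omega>. ennreal (bdist \<Omega> x powr a) * (\<Sum>k. ennreal ((bdist \<Omega> x / 20 / 2 ^ k) powr (- (n + \<alpha>))) * strain_on u p x (bdist \<Omega> x / 20 / 2 ^ k)) \<partial>lborel)
      \<le> (\<integral>\<^sup>+x. (\<Sum>k. \<integral>\<^sup>+y. g k y * of_bool (dist y x < \<sigma> k y) \<partial>lborel) \<partial>lborel)"
    proof (rule nn_integral_mono)
      fix x
      show "ennreal (bdist \<Omega> x powr a) * (\<Sum>k. ennreal ((bdist \<Omega> x / 20 / 2 ^ k) powr (- (n + \<alpha>))) * strain_on u p x (bdist \<Omega> x / 20 / 2 ^ k)) * indicator \<Omega> x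
        \<le> (\<Sum>k. \<integral>\<^sup>+y. g k y * of_bool (dist y x < \<sigma> k y) \<partial>lborel)"
      proof (cases "x \<in> \<Omega>")
        case True
        have dx: "0 < bdist \<Omega> x" by (rule bdist_pos[OF op True])
        have "ennreal (bdist \<Omega> x powr a) * (\<Sum>k. ennreal ((bdist \<Omega> x / 20 / 2 ^ k) powr (- (n + \<alpha>))) * strain_on u p x (bdist \<Omega> x / 20 / 2 ^ k))
          = (\<Sum>k. ennreal (bdist \<Omega> x powr a) * (ennreal ((bdist \<Omega> x / 20 / 2 ^ k) powr (- (n + \<alpha>))) * strain_on u p x (bdist \<Omega> x / 20 / 2 ^ k)))"
          by simp
        also have "\<dots> \<le> (\<Sum>k. \<integral>\<^sup>+y. g k y * of_bool (dist y x < \<sigma> k y) \<partial>lborel)"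
        proof (intro suminf_le)
          fix k :: nat
          define r where "r = bdist \<Omega> x / 20 / 2 ^ k"
          have r: "0 < r" "r \<le> bdist \<Omega> x / 20"
            using dx by (auto simp: r_def divide_le_eq)
          have "ennreal (bdist \<Omega> x powr a) * (ennreal (r powr (- (n + \<alpha>))) * strain_on u p x r)
            = (\<integral>\<^sup>+y. ennreal (bdist \<Omega> x powr a * r powr (- (n + \<alpha>))) * (strain_at u p x r y * indicator (ball x r) y) \<partial>lborel)"
            unfolding strain_on_def by (subst nn_integral_cmult) (auto simp: ennreal_mult mult.assoc)
          also have "\<dots> \<le> (\<integral>\<^sup>+y. g k y * of_bool (dist y x < \<sigma> k y) \<partial>lborel)"
          proof (rule nn_integral_mono)
            fix y
            show "ennreal (bdist \<Omega> x powr a * r powr (- (n + \<alpha>))) * (strain_at u p x r y * indicator (ball x r) y) \<le> g k y * of_bool (dist y x < \<sigma> k y)"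
            proof (cases "y \<in> ball x r")
              case yr: True
              then have y: "y \<in> ball x (bdist \<Omega> x / 10)" using r dx by auto
              note cmp = bdist_comparable[OF y]
              have "y \<in> ball x (bdist \<Omega> x)" using y dx by simp
              then have yO: "y \<in> \<Omega>" using ball_bdist_subset[OF True] by blast
              have dy: "0 < bdist \<Omega> y" by (rule bdist_pos[OF op yO])
              have s1: "r \<le> \<sigma> k y"
              proof -
                have "bdist \<Omega> x / 20 \<le> bdist \<Omega> y / 10" using cmp dy by simp
                then show ?thesis unfolding r_def \<sigma>_def by (intro divide_right_mono) auto
              qed
              have s2: "\<sigma> k y / 4 \<le> r"
              proof -
                have "bdist \<Omega> y / 10 / 4 \<le> bdist \<Omega> x / 20" using cmp dx by simp
                then have "bdist \<Omega> y / 10 / 4 / 2 ^ k \<le> bdist \<Omega> x / 20 / 2 ^ k" by (intro divide_right_mono) auto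
                then show ?thesis unfolding r_def \<sigma>_def by (simp add: mult_ac)
              qed
              have \<sigma>0: "0 < \<sigma> k y" using s1 r by simp
              have "bdist \<Omega> x powr a \<le> Ca * bdist \<Omega> y powr a" using cmp dx dy by (intro Ca(2)) auto
              moreover have "r powr (- (n + \<alpha>)) \<le> (\<sigma> k y / 4) powr (- (n + \<alpha>))"
                using s2 \<sigma>0 n \<alpha> by (intro powr_mono2') auto
              moreover have "(\<sigma> k y / 4) powr (- (n + \<alpha>)) = 4 powr (n + \<alpha>) * \<sigma> k y powr (- (n + \<alpha>))"
              proof -
                have "(\<sigma> k y / 4) powr (- t) = 4 powr t * \<sigma> k y powr (- t)" for t
                  using \<sigma>0 by (simp add: powr_divide powr_minus field_simps)
                then show ?thesis .
              qed
              ultimately have "bdist \<Omega> x powr a * r powr (- (n + \<alpha>)) \<le> (Ca * bdist \<Omega> y powr a) * (4 powr (n + \<alpha>) * \<sigma> k y powr (- (n + \<alpha>)))"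
                using Ca by (intro mult_mono) auto
              then have c: "bdist \<Omega> x powr a * r powr (- (n + \<alpha>)) \<le> B * bdist \<Omega> y powr a * \<sigma> k y powr (- (n + \<alpha>))"
                by (simp add: B_def mult_ac)
              have "ball x r \<subseteq> ball y (2 * \<sigma> k y)"
              proof
                fix z assume "z \<in> ball x r"
                then show "z \<in> ball y (2 * \<sigma> k y)" using yr s1 dist_triangle[of y z x] by (simp add: dist_commute)
              qed
              then have sa: "strain_at u p x r y \<le> strain_at u p y (2 * \<sigma> k y) y" by (rule strain_at_mono)
              have "ennreal (bdist \<Omega> x powr a * r powr (- (n + \<alpha>))) * strain_at u p x r y
                \<le> ennreal (B * bdist \<Omega> y powr a * \<sigma> k y powr (- (n + \<alpha>))) * strain_at u p y (2 * \<sigma> k y) y"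
                by (rule mult_mono[OF ennreal_leI[OF c] sa]) auto
              moreover have "dist y x < \<sigma> k y" using yr s1 by (simp add: dist_commute)
              ultimately show ?thesis using yr yO by (simp add: g_def)
            qed simp
          qed
          finally show "ennreal (bdist \<Omega> x powr a) * (ennreal ((bdist \<Omega> x / 20 / 2 ^ k) powr (- (n + \<alpha>))) * strain_on u p x (bdist \<Omega> x / 20 / 2 ^ k)) \<le> (\<integral>\<^sup>+y. g k y * of_bool (dist y x < \<sigma> k y) \<partial>lborel)"
            unfolding r_def .
        qed auto
        finally show ?thesis using True by simp
      qed simp
    qed
    also have "\<dots> = (\<Sum>k. \<integral>\<^sup>+x. \<integral>\<^sup>+y. g k y * of_bool (dist y x < \<sigma> k y) \<partial>lborel \<partial>lborel)"
      by (rule nn_integral_suminf) measurable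
    also have "\<dots> = (\<Sum>k. \<integral>\<^sup>+y. \<integral>\<^sup>+x. g k y * of_bool (dist y x < \<sigma> k y) \<partial>lborel \<partial>lborel)"
      by (intro suminf_cong lborel_pair.Fubini'[symmetric]) measurable
    also have "\<dots> = (\<Sum>k. \<integral>\<^sup>+y. g k y * emeasure lborel (ball y (\<sigma> k y)) \<partial>lborel)"
    proof (intro suminf_cong nn_integral_cong)
      fix k y
      have "(\<integral>\<^sup>+x. g k y * of_bool (dist y x < \<sigma> k y) \<partial>lborel) = (\<integral>\<^sup>+x. g k y * indicator (ball y (\<sigma> k y)) x \<partial>lborel)"
        by (intro nn_integral_cong) (auto simp: indicator_def)
      also have "\<dots> = g k y * emeasure lborel (ball y (\<sigma> k y))" by (rule nn_integral_cmult_indicator) simp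
      finally show "(\<integral>\<^sup>+x. g k y * of_bool (dist y x < \<sigma> k y) \<partial>lborel) = g k y * emeasure lborel (ball y (\<sigma> k y))" .
    qed
    also have "\<dots> = (\<integral>\<^sup>+y. (\<Sum>k. g k y * emeasure lborel (ball y (\<sigma> k y))) \<partial>lborel)"
    proof (rule nn_integral_suminf[symmetric])
      fix k
      have "(\<lambda>y. g k y * emeasure lborel (ball y (\<sigma> k y))) = (\<lambda>y. g k y * ennreal (\<sigma> k y ^ DIM('a) * w))"
        by (simp add: emeasure_ball_eq w_def \<sigma>_def bdist_nonneg)
      then show "(\<lambda>y. g k y * emeasure lborel (ball y (\<sigma> k y))) \<in> borel_measurable lborel" by simp
    qed
    also have "\<dots> \<le> (\<integral>\<^sup>+y. ennreal (B * w * 2 powr \<alpha> * Cs) * (ennreal (bdist \<Omega> y powr a) * strain_kern u p \<alpha> (2/5 * bdist \<Omega> y) y * indicator \<Omega> y) \<partial>lborel)"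
    proof (rule nn_integral_mono)
      fix y
      show "(\<Sum>k. g k y * emeasure lborel (ball y (\<sigma> k y))) \<le> ennreal (B * w * 2 powr \<alpha> * Cs) * (ennreal (bdist \<Omega> y powr a) * strain_kern u p \<alpha> (2/5 * bdist \<Omega> y) y * indicator \<Omega> y)"
      proof (cases "y \<in> \<Omega>")
        case True
        have dy: "0 < bdist \<Omega> y" by (rule bdist_pos[OF op True])
        \<comment> \<open>Twice \<open>\<sigma> 0 y\<close>, so that the radii
          \<open>2 * \<sigma> k y\<close> are the dyadic fractions of \<open>?R\<close>.\<close>
        let ?R = "bdist \<Omega> y / 5"
        let ?c = "B * w * 2 powr \<alpha> * bdist \<Omega> y powr a"
        have "(\<Sum>k. g k y * emeasure lborel (ball y (\<sigma> k y))) = (\<Sum>k. ennreal ?c * (ennreal ((?R / 2 ^ k) powr (- \<alpha>)) * strain_at u p y (?R / 2 ^ k) y))"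
        proof (rule suminf_cong)
          fix k
          have s: "0 < \<sigma> k y" "2 * \<sigma> k y = ?R / 2 ^ k" using dy by (auto simp: \<sigma>_def)
          have "\<sigma> k y powr (- (n + \<alpha>)) * \<sigma> k y ^ DIM('a) = \<sigma> k y powr (- \<alpha>)"
            using s by (simp add: n_def flip: powr_realpow powr_add)
          also have "\<dots> = 2 powr \<alpha> * (?R / 2 ^ k) powr (- \<alpha>)"
          proof -
            have "0 < ?R / 2 ^ k" "\<sigma> k y = ?R / 2 ^ k / 2" using s by auto
            then show ?thesis using powr_half(2)[of "?R / 2 ^ k" \<alpha>] by metis
          qed
          finally have e: "\<sigma> k y powr (- (n + \<alpha>)) * \<sigma> k y ^ DIM('a) = 2 powr \<alpha> * (?R / 2 ^ k) powr (- \<alpha>)" .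
          have "g k y * emeasure lborel (ball y (\<sigma> k y)) = ennreal (B * w * bdist \<Omega> y powr a * (\<sigma> k y powr (- (n + \<alpha>)) * \<sigma> k y ^ DIM('a))) * strain_at u p y (2 * \<sigma> k y) y"
            using s B w True by (simp add: g_def emeasure_ball_eq ennreal_mult mult_ac flip: w_def)
          also have "\<dots> = ennreal ?c * (ennreal ((?R / 2 ^ k) powr (- \<alpha>)) * strain_at u p y (?R / 2 ^ k) y)"
            unfolding e s(2) using B w by (simp add: ennreal_mult mult_ac)
          finally show "g k y * emeasure lborel (ball y (\<sigma> k y)) = ennreal ?c * (ennreal ((?R / 2 ^ k) powr (- \<alpha>)) * strain_at u p y (?R / 2 ^ k) y)" .
        qed
        also have "\<dots> = ennreal ?c * (\<Sum>k. ennreal ((?R / 2 ^ k) powr (- \<alpha>)) * strain_at u p y (?R / 2 ^ k) y)"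
          by (rule ennreal_suminf_cmult)
        also have "\<dots> \<le> ennreal ?c * (ennreal Cs * strain_kern u p \<alpha> ?R y)"
          by (intro mult_left_mono Cs(2)) auto
        also have "\<dots> \<le> ennreal ?c * (ennreal Cs * strain_kern u p \<alpha> (2/5 * bdist \<Omega> y) y)"
          using dy by (intro mult_left_mono strain_kern_mono) auto
        also have "\<dots> = ennreal (B * w * 2 powr \<alpha> * Cs) * (ennreal (bdist \<Omega> y powr a) * strain_kern u p \<alpha> (2/5 * bdist \<Omega> y) y * indicator \<Omega> y)"
          using B w Cs True by (simp add: ennreal_mult mult_ac)
        finally show ?thesis .
      qed (simp add: g_def)
    qed
    also have "\<dots> = ennreal (B * w * 2 powr \<alpha> * Cs) * (\<integral>\<^sup>+y\<in>\<Omega>. ennreal (bdist \<Omega> y powr a) * strain_kern u p \<alpha> (2/5 * bdist \<Omega> y) y \<partial>lborel)"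
      by (rule nn_integral_cmult) measurable
    finally show "(\<integral>\<^sup>+x\<in>\<Omega>. ennreal (bdist \<Omega> x powr a) * (\<Sum>k. ennreal ((bdist \<Omega> x / 20 / 2 ^ k) powr (- (DIM('a) + \<alpha>))) * strain_on u p x (bdist \<Omega> x / 20 / 2 ^ k)) \<partial>lborel)
    \<le> ennreal (B * w * 2 powr \<alpha> * Cs) * (\<integral>\<^sup>+y\<in>\<Omega>. ennreal (bdist \<Omega> y powr a) * strain_kern u p \<alpha> (2/5 * bdist \<Omega> y) y \<partial>lborel)"
      unfolding n_def .
  qed
qed

section \<open>The weighted inequality\<close>

lemma strain_on_measurable_var [measurable (raw)]:
  fixes u :: "'a::euclidean_space \<Rightarrow> 'a"
  assumes [measurable]: "u \<in> borel_measurable borel" "f \<in> borel_measurable M" "g \<in> borel_measurable M"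
  shows "(\<lambda>x. strain_on u p (f x) (g x)) \<in> borel_measurable M"
  unfolding strain_on_def by measurable

lemma strain_cone_measurable [measurable (raw)]:
  fixes u :: "'a::euclidean_space \<Rightarrow> 'a"
  assumes [measurable]: "u \<in> borel_measurable borel" "\<Omega> \<in> sets borel" "f \<in> borel_measurable M"
  shows "(\<lambda>x. strain_cone \<Omega> K t u p (f x)) \<in> borel_measurable M"
  unfolding strain_cone_def by measurable

lemma dmin_measurable [measurable (raw)]:
  fixes f g :: "'b \<Rightarrow> 'a::euclidean_space"
  assumes [measurable]: "f \<in> borel_measurable M" "g \<in> borel_measurable M"
  shows "(\<lambda>x. dmin \<Omega> (f x) (g x)) \<in> borel_measurable M"
  unfolding dmin_def by measurable

lemma dmin_bounds:
  assumes "y \<in> ball x (\<tau> * bdist \<Omega> x)"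
  shows "(1 - \<tau>) * bdist \<Omega> x \<le> dmin \<Omega> x y" "dmin \<Omega> x y \<le> bdist \<Omega> x"
proof -
  have "bdist \<Omega> x \<le> bdist \<Omega> y + \<tau> * bdist \<Omega> x"
    using bdist_lipschitz[of \<Omega> x y] assms by simp
  moreover have "(1 - \<tau>) * bdist \<Omega> x \<le> bdist \<Omega> x"
  proof -
    have "0 \<le> \<tau> * bdist \<Omega> x" using assms zero_le_dist[of x y] unfolding mem_ball by linarith
    then show ?thesis by (simp add: algebra_simps)
  qed
  ultimately show "(1 - \<tau>) * bdist \<Omega> x \<le> dmin \<Omega> x y" by (simp add: dmin_def algebra_simps)
qed (simp add: dmin_def)

text \<open>Restricting to radius 2/5 keeps \<open>dmin\<close> between 3/5 \<delta>(x) and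
  \<delta>(x), so the weight can be moved out of the inner integral for either sign of its
  exponent.\<close>

lemma nn_integral_strain_kern_le_X_int:
  fixes \<Omega> :: "(real^'n) set" and s p \<tau> a :: real
  assumes op: "open \<Omega>" "bounded \<Omega>" and \<tau>: "2/5 \<le> \<tau>"
  obtains C where "0 < C" "\<And>u. u \<in> borel_measurable borel \<Longrightarrow>
    (\<integral>\<^sup>+y\<in>\<Omega>. ennreal (bdist \<Omega> y powr a) * strain_kern u p (real CARD('n) + p + s * p) (2/5 * bdist \<Omega> y) y \<partial>lborel)
      \<le> ennreal C * X_int s p \<tau> a \<Omega> u"
proof -
  obtain C where C: "0 < C" "\<And>x y :: real. 0 < y \<Longrightarrow> y / 2 \<le> x \<Longrightarrow> x \<le> 2 * y \<Longrightarrow> x powr a \<le> C * y powr a"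
    using powr_comparable by blast
  let ?\<alpha> = "real CARD('n) + p + s * p"
  show thesis
  proof (rule that[OF C(1)])
    fix u :: "real^'n \<Rightarrow> real^'n" assume [measurable]: "u \<in> borel_measurable borel"
    have [measurable]: "\<Omega> \<in> sets borel" using op by simp
    let ?X = "\<lambda>x y. ennreal (\<bar>(u y - u x) \<bullet> (y - x)\<bar> powr p / norm (y - x) powr (real CARD('n) + s * p + p) * dmin \<Omega> x y powr a)"
    have pt: "ennreal (bdist \<Omega> x powr a) * strain_kern u p ?\<alpha> (2/5 * bdist \<Omega> x) x
       \<le> ennreal C * (\<integral>\<^sup>+y\<in>ball x (\<tau> * bdist \<Omega> x). ?X x y \<partial>lborel)" if x: "x \<in> \<Omega>" for x
    proof -
      have dx: "0 < bdist \<Omega> x" by (rule bdist_pos[OF op x])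
      have "ennreal (bdist \<Omega> x powr a) * strain_kern u p ?\<alpha> (2/5 * bdist \<Omega> x) x
        = (\<integral>\<^sup>+y. ennreal (bdist \<Omega> x powr a) * (ennreal (\<bar>strain u x y\<bar> powr p / norm (y - x) powr ?\<alpha>) * indicator (ball x (2/5 * bdist \<Omega> x)) y) \<partial>lborel)"
        unfolding strain_kern_def by (rule nn_integral_cmult[symmetric]) measurable
      also have "\<dots> \<le> (\<integral>\<^sup>+y. ennreal C * (?X x y * indicator (ball x (\<tau> * bdist \<Omega> x)) y) \<partial>lborel)"
      proof (rule nn_integral_mono)
        fix y
        show "ennreal (bdist \<Omega> x powr a) * (ennreal (\<bar>strain u x y\<bar> powr p / norm (y - x) powr ?\<alpha>) * indicator (ball x (2/5 * bdist \<Omega> x)) y)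
          \<le> ennreal C * (?X x y * indicator (ball x (\<tau> * bdist \<Omega> x)) y)"
        proof (cases "y \<in> ball x (2/5 * bdist \<Omega> x)")
          case True
          have "2/5 * bdist \<Omega> x \<le> \<tau> * bdist \<Omega> x" using \<tau> dx by (intro mult_right_mono) auto
          then have y: "y \<in> ball x (\<tau> * bdist \<Omega> x)" using True by simp
          have "bdist \<Omega> x powr a \<le> C * dmin \<Omega> x y powr a"
            using dmin_bounds[OF True] dx by (intro C(2)) auto
          then have le: "(\<bar>strain u x y\<bar> powr p / norm (y - x) powr ?\<alpha>) * bdist \<Omega> x powr a
             \<le> (\<bar>strain u x y\<bar> powr p / norm (y - x) powr ?\<alpha>) * (C * dmin \<Omega> x y powr a)"
            by (intro mult_left_mono) auto
          have st: "strain u x y = (u y - u x) \<bullet> (y - x)" by (simp add: strain_def inner_diff_left inner_diff_right)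
          have "ennreal (bdist \<Omega> x powr a) * ennreal (\<bar>strain u x y\<bar> powr p / norm (y - x) powr ?\<alpha>)
            = ennreal ((\<bar>strain u x y\<bar> powr p / norm (y - x) powr ?\<alpha>) * bdist \<Omega> x powr a)"
            by (subst ennreal_mult[symmetric]) (auto simp: mult.commute)
          also have "\<dots> \<le> ennreal (C * (\<bar>strain u x y\<bar> powr p / norm (y - x) powr ?\<alpha> * dmin \<Omega> x y powr a))"
            using le by (intro ennreal_leI) (simp only: mult_ac)
          also have "\<dots> = ennreal C * ?X x y"
            unfolding st using C(1) by (subst ennreal_mult) (auto simp: add_ac)
          finally show ?thesis using True y by simp
        qed simp
      qed
      also have "\<dots> = ennreal C * (\<integral>\<^sup>+y\<in>ball x (\<tau> * bdist \<Omega> x). ?X x y \<partial>lborel)"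
        by (rule nn_integral_cmult) measurable
      finally show ?thesis .
    qed
    have "(\<integral>\<^sup>+y\<in>\<Omega>. ennreal (bdist \<Omega> y powr a) * strain_kern u p ?\<alpha> (2/5 * bdist \<Omega> y) y \<partial>lborel)
      \<le> (\<integral>\<^sup>+x. ennreal C * ((\<integral>\<^sup>+y\<in>ball x (\<tau> * bdist \<Omega> x). ?X x y \<partial>lborel) * indicator \<Omega> x) \<partial>lborel)"
    proof (rule nn_integral_mono)
      fix x
      show "ennreal (bdist \<Omega> x powr a) * strain_kern u p ?\<alpha> (2/5 * bdist \<Omega> x) x * indicator \<Omega> x
        \<le> ennreal C * ((\<integral>\<^sup>+y\<in>ball x (\<tau> * bdist \<Omega> x). ?X x y \<partial>lborel) * indicator \<Omega> x)"
      proof (cases "x \<in> \<Omega>")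
        case True
        then show ?thesis using pt[OF True] by (simp only: indicator_simps mult_1_right)
      qed simp
    qed
    also have "\<dots> = ennreal C * X_int s p \<tau> a \<Omega> u"
      unfolding X_int_def nn_integral_completion by (rule nn_integral_cmult) measurable
    finally show "(\<integral>\<^sup>+y\<in>\<Omega>. ennreal (bdist \<Omega> y powr a) * strain_kern u p ?\<alpha> (2/5 * bdist \<Omega> y) y \<partial>lborel)
      \<le> ennreal C * X_int s p \<tau> a \<Omega> u" .
  qed
qed

lemma skew_linear_in_RM:
  fixes A :: "real^'n \<Rightarrow> real^'n"
  assumes A: "linear A" and skew: "\<And>v w. A v \<bullet> w = - (A w \<bullet> v)"
  shows "A \<in> RM"
proof -
  have "transpose (matrix A) = - matrix A"
  proof -
    have sk: "matrix A $ j $ i = - (matrix A $ i $ j)" for i j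
      using skew[of "axis i 1" "axis j 1"] by (simp add: matrix_def inner_axis)
    have tr: "transpose (matrix A) $ i $ j = (- matrix A) $ i $ j" for i j
      unfolding transpose_def vec_lambda_beta vector_uminus_component by (rule sk)
    show ?thesis unfolding vec_eq_iff by (intro allI tr)
  qed
  moreover have "A = (\<lambda>x. matrix A *v x + 0)"
    using A by (simp add: matrix_works)
  ultimately show ?thesis unfolding RM_def by blast
qed

text \<open>The W-energy near x has three contributions: the deviation of the gradient
  (\<open>f1\<close>), the strain on dyadic balls (\<open>f2\<close>) and the strain at x itself
  (\<open>f3\<close>). Each integrates to at most a multiple of \<open>?Y\<close>, which the
  X-energy dominates.\<close>

lemma weighted_korn_borel:
  fixes \<Omega> :: "(real^'n) set" and p s \<tau>1 \<tau>2 \<beta> :: real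
  assumes J: "john_domain \<Omega>" and p: "1 < p" and s: "0 < s" "s < 1"
    and \<tau>1: "\<tau>1 \<le> 1 / 20" and \<tau>2: "2/5 \<le> \<tau>2"
    and \<beta>: "\<beta> + 1 - s > - (real CARD('n) - assouad_dim (frontier \<Omega>)) / p"
  obtains C where "0 < C" "\<And>u. u \<in> borel_measurable borel \<Longrightarrow>
     (\<And>x. x \<in> \<Omega> \<Longrightarrow> set_integrable lborel (ball x (bdist \<Omega> x / 10)) u) \<Longrightarrow>
     \<exists>r\<in>RM. W_int s p \<tau>1 (p * \<beta>) \<Omega> (\<lambda>x. u x - r x) \<le> ennreal C * X_int s p \<tau>2 (p * \<beta>) \<Omega> u"
proof -
  have op: "open \<Omega>" "bounded \<Omega>" using J by (auto simp: john_domain_def)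
  have [measurable]: "\<Omega> \<in> sets borel" using op by simp
  define n where "n = real CARD('n)"
  have n: "0 \<le> n" "real DIM(real^'n) = n" by (auto simp: n_def)
  define \<alpha> where "\<alpha> = n + p + s * p"
  have sp: "0 < s * p" using s p by simp
  have \<alpha>: "0 < \<alpha>" using n p sp unfolding \<alpha>_def by linarith
  define a where "a = p * \<beta>"
  \<comment> \<open>Half of the slack in the hypothesis on \<beta>, multiplied by p.\<close>
  define e where "e = (n + p * (\<beta> + 1 - s) - assouad_dim (frontier \<Omega>)) / 2"
  have "p * (\<beta> + 1 - s) > p * (- (n - assouad_dim (frontier \<Omega>)) / p)"
    using \<beta> p unfolding n_def by (intro mult_strict_left_mono) auto
  then have e: "0 < e" using p by (simp add: e_def)
  \<comment> \<open>The weight that remains for the cone after the scale factor \<delta>^((1 - s) p)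
    of the dyadic estimate and the loss \<delta>^(-e) of the chain; n + q exceeds the dimension of
    the boundary by exactly e.\<close>
  define q where "q = a + (1 - s) * p - e"
  have "n + q = assouad_dim (frontier \<Omega>) + e"
    by (simp add: q_def a_def e_def algebra_simps)
  then have dim: "assouad_dim (frontier \<Omega>) < real DIM(real^'n) + q" using e n by simp
  define t where "t = e - (2 * DIM(real^'n) + 2 * p)"
  \<comment> \<open>Fubini raises the exponent t of the cone by n + q; the result a - \<alpha> is
    the weight with which strain at scale \<delta> occurs in the X-energy.\<close>
  have tq: "t + DIM(real^'n) + q = a - \<alpha>"
    unfolding t_def q_def \<alpha>_def using n(2) by (simp add: algebra_simps)
  obtain Ca where Ca: "0 < Ca" "\<And>x y :: real. 0 < y \<Longrightarrow> y / 2 \<le> x \<Longrightarrow> x \<le> 2 * y \<Longrightarrow> x powr a \<le> Ca * y powr a"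
    using powr_comparable by blast
  obtain x0 K C1 where x0: "x0 \<in> \<Omega>" and K: "0 < K" and C1: "0 < C1"
    "\<And>u x v. u \<in> borel_measurable borel \<Longrightarrow> (\<And>x. x \<in> \<Omega> \<Longrightarrow> set_integrable lborel (ball x (bdist \<Omega> x / 10)) u) \<Longrightarrow> x \<in> \<Omega> \<Longrightarrow>
      ennreal (norm (kgrad u x (bdist \<Omega> x / 20) v - (1/2) *\<^sub>R (kgrad u x0 (bdist \<Omega> x0 / 20) v - kadj u x0 (bdist \<Omega> x0 / 20) v)) powr p)
        \<le> ennreal (C1 * bdist \<Omega> x powr (- e)) * strain_cone \<Omega> K t u p x * ennreal (norm v powr p)"
    using john_gradient_skew[OF J p e] unfolding t_def by metis
  obtain C2 where C2: "0 < C2"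
   "\<And>u (x::real^'n) R A F. 0 < R \<Longrightarrow> set_integrable lborel (ball x R) u \<Longrightarrow> u \<in> borel_measurable borel \<Longrightarrow>
     (\<And>v. ennreal (norm (kgrad u x R v - A v) powr p) \<le> F * ennreal (norm v powr p)) \<Longrightarrow>
     (\<integral>\<^sup>+y\<in>ball x R. ennreal (norm (u y - u x - A (y - x)) powr p / norm (y - x) powr (DIM(real^'n) + s * p)) \<partial>lborel)
      \<le> ennreal C2 * (ennreal (R powr ((1 - s) * p)) * F
          + (\<Sum>k. ennreal ((R / 2 ^ k) powr (- (2 * DIM(real^'n) + p + s * p))) * strain_on u p x (R / 2 ^ k))
          + (\<Sum>k. ennreal ((R / 2 ^ k) powr (- (DIM(real^'n) + p + s * p))) * strain_at u p x (R / 2 ^ k) x))"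
    using dyadic_estimate[OF p s] by blast
  obtain C3 where C3: "0 < C3" "\<And>u (y::real^'n) R. u \<in> borel_measurable borel \<Longrightarrow>
    (\<Sum>k. ennreal ((R / 2 ^ k) powr (- \<alpha>)) * strain_at u p y (R / 2 ^ k) y) \<le> ennreal C3 * strain_kern u p \<alpha> R y"
    using suminf_strain_at_le[OF \<alpha>] by blast
  obtain C4 where C4: "0 < C4" "\<And>u. u \<in> borel_measurable borel \<Longrightarrow>
    (\<integral>\<^sup>+x\<in>\<Omega>. ennreal (bdist \<Omega> x powr q) * strain_cone \<Omega> K t u p x \<partial>lborel)
    \<le> ennreal C4 * (\<integral>\<^sup>+y\<in>\<Omega>. ennreal (bdist \<Omega> y powr (t + DIM(real^'n) + q)) * strain_at u p y (2/5 * bdist \<Omega> y) y \<partial>lborel)"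
    using nn_integral_strain_cone_le[OF op K dim] by blast
  obtain C5 where C5: "0 < C5" "\<And>u. u \<in> borel_measurable borel \<Longrightarrow>
    (\<integral>\<^sup>+x\<in>\<Omega>. ennreal (bdist \<Omega> x powr a) * (\<Sum>k. ennreal ((bdist \<Omega> x / 20 / 2 ^ k) powr (- (DIM(real^'n) + \<alpha>))) * strain_on u p x (bdist \<Omega> x / 20 / 2 ^ k)) \<partial>lborel)
    \<le> ennreal C5 * (\<integral>\<^sup>+y\<in>\<Omega>. ennreal (bdist \<Omega> y powr a) * strain_kern u p \<alpha> (2/5 * bdist \<Omega> y) y \<partial>lborel)"
    using nn_integral_suminf_strain_on_le[OF op \<alpha>] by blast
  obtain C6 where C6: "0 < C6" "\<And>u. u \<in> borel_measurable borel \<Longrightarrow>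
    (\<integral>\<^sup>+y\<in>\<Omega>. ennreal (bdist \<Omega> y powr a) * strain_kern u p \<alpha> (2/5 * bdist \<Omega> y) y \<partial>lborel)
      \<le> ennreal C6 * X_int s p \<tau>2 a \<Omega> u"
    using nn_integral_strain_kern_le_X_int[OF op \<tau>2, of a p s] unfolding \<alpha>_def n_def by blast
  define B where "B = Ca * C2"
  have B: "0 < B" using Ca C2 by (simp add: B_def)
  show thesis
  proof (rule that[of "B * (C1 * C4 + C5 + C3) * C6"])
    have "0 < C1 * C4" using C1 C4 by simp
    then show "0 < B * (C1 * C4 + C5 + C3) * C6" using B C3 C5 C6 by simp
    fix u :: "real^'n \<Rightarrow> real^'n"
    assume um [measurable]: "u \<in> borel_measurable borel"
      and u: "\<And>x. x \<in> \<Omega> \<Longrightarrow> set_integrable lborel (ball x (bdist \<Omega> x / 10)) u"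
    define r0 where "r0 = bdist \<Omega> x0 / 20"
    have d0: "0 < bdist \<Omega> x0" by (rule bdist_pos[OF op x0])
    have u0: "set_integrable lborel (ball x0 r0) u"
      by (rule set_integrable_subset[OF u[OF x0]]) (use d0 in \<open>auto simp: r0_def\<close>)
    have r0: "0 < r0" using d0 by (simp add: r0_def)
    \<comment> \<open>The skew part of the averaged gradient at the base point, \<open>kadj\<close>
      being its transpose.\<close>
    define A where "A v = (1/2) *\<^sub>R (kgrad u x0 r0 v - kadj u x0 r0 v)" for v
    have linA: "linear A"
      unfolding A_def using linear_kgrad[OF r0 u0] linear_kadj[OF r0 u0]
      by (intro linear_compose_scale_right linear_compose_sub) auto
    have "A v \<bullet> w = - (A w \<bullet> v)" for v w
      unfolding A_def inner_scaleR_left inner_diff_left kgrad_inner[OF r0 u0 um] by (simp add: algebra_simps)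
    then have RM: "A \<in> RM" by (intro skew_linear_in_RM linA)
    let ?Y = "\<integral>\<^sup>+y\<in>\<Omega>. ennreal (bdist \<Omega> y powr a) * strain_kern u p \<alpha> (2/5 * bdist \<Omega> y) y \<partial>lborel"
    define S1 where "S1 x = (\<Sum>k. ennreal ((bdist \<Omega> x / 20 / 2 ^ k) powr (- (DIM(real^'n) + \<alpha>))) * strain_on u p x (bdist \<Omega> x / 20 / 2 ^ k))" for x
    define f1 where "f1 x = ennreal (bdist \<Omega> x powr q) * strain_cone \<Omega> K t u p x * indicator \<Omega> x" for x
    define f2 where "f2 x = ennreal (bdist \<Omega> x powr a) * S1 x * indicator \<Omega> x" for x
    define f3 where "f3 x = ennreal (bdist \<Omega> x powr a) * strain_kern u p \<alpha> (2/5 * bdist \<Omega> x) x * indicator \<Omega> x" for x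
    have [measurable]: "f1 \<in> borel_measurable borel" unfolding f1_def by measurable
    have [measurable]: "f2 \<in> borel_measurable borel" unfolding f2_def S1_def by measurable
    have [measurable]: "f3 \<in> borel_measurable borel" unfolding f3_def by measurable
    have pt: "(\<integral>\<^sup>+y\<in>ball x (\<tau>1 * bdist \<Omega> x). ennreal (norm ((u y - A y) - (u x - A x)) powr p / norm (y - x) powr (n + s * p) * dmin \<Omega> x y powr a) \<partial>lborel)
      \<le> ennreal B * (ennreal C1 * f1 x + f2 x + ennreal C3 * f3 x)" if x: "x \<in> \<Omega>" for x
    proof -
      let ?d = "bdist \<Omega> x" let ?R = "bdist \<Omega> x / 20"
      have d: "0 < ?d" by (rule bdist_pos[OF op x])
      let ?g = "\<lambda>y. norm (u y - u x - A (y - x)) powr p / norm (y - x) powr (n + s * p)"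
      have "(\<integral>\<^sup>+y\<in>ball x (\<tau>1 * ?d). ennreal (norm ((u y - A y) - (u x - A x)) powr p / norm (y - x) powr (n + s * p) * dmin \<Omega> x y powr a) \<partial>lborel)
        \<le> (\<integral>\<^sup>+y. ennreal (Ca * ?d powr a) * (ennreal (?g y) * indicator (ball x ?R) y) \<partial>lborel)"
      proof (rule nn_integral_mono)
        fix y
        show "ennreal (norm ((u y - A y) - (u x - A x)) powr p / norm (y - x) powr (n + s * p) * dmin \<Omega> x y powr a) * indicator (ball x (\<tau>1 * ?d)) y
          \<le> ennreal (Ca * ?d powr a) * (ennreal (?g y) * indicator (ball x ?R) y)"
        proof (cases "y \<in> ball x (\<tau>1 * ?d)")
          case True
          have "\<tau>1 * ?d \<le> 1/20 * ?d" using \<tau>1 d by (intro mult_right_mono) auto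
          then have yR: "y \<in> ball x ?R" using True by simp
          then have y20: "y \<in> ball x (1/20 * ?d)" by simp
          have "dmin \<Omega> x y powr a \<le> Ca * ?d powr a"
            using dmin_bounds[OF y20] d by (intro Ca(2)) auto
          then have "?g y * dmin \<Omega> x y powr a \<le> ?g y * (Ca * ?d powr a)" by (intro mult_left_mono) auto
          moreover have "(u y - A y) - (u x - A x) = u y - u x - A (y - x)"
            by (simp add: linear_diff[OF linA])
          ultimately have "ennreal (norm ((u y - A y) - (u x - A x)) powr p / norm (y - x) powr (n + s * p) * dmin \<Omega> x y powr a)
            \<le> ennreal ((Ca * ?d powr a) * ?g y)"
            by (intro ennreal_leI) (simp only: mult.commute)
          then show ?thesis using True yR Ca(1) by (simp add: ennreal_mult del: times_divide_eq_right)
        qed simp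
      qed
      also have "\<dots> = ennreal (Ca * ?d powr a) * (\<integral>\<^sup>+y\<in>ball x ?R. ennreal (?g y) \<partial>lborel)"
      proof (rule nn_integral_cmult)
        have [measurable]: "A \<in> borel_measurable borel"
          using linA by (intro borel_measurable_continuous_onI linear_continuous_on) (simp add: linear_conv_bounded_linear)
        show "(\<lambda>y. ennreal (?g y) * indicator (ball x ?R) y) \<in> borel_measurable lborel" by measurable
      qed
      also have "\<dots> \<le> ennreal (Ca * ?d powr a) * (ennreal C2 * (ennreal (?R powr ((1 - s) * p)) * (ennreal (C1 * ?d powr (- e)) * strain_cone \<Omega> K t u p x)
          + S1 x + ennreal C3 * strain_kern u p \<alpha> (2/5 * ?d) x))"
      proof (rule mult_left_mono)
        have uR: "set_integrable lborel (ball x ?R) u"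
          by (rule set_integrable_subset[OF u[OF x]]) (use d in auto)
        have "(\<integral>\<^sup>+y\<in>ball x ?R. ennreal (?g y) \<partial>lborel) \<le> ennreal C2 * (ennreal (?R powr ((1 - s) * p)) * (ennreal (C1 * ?d powr (- e)) * strain_cone \<Omega> K t u p x)
          + (\<Sum>k. ennreal ((?R / 2 ^ k) powr (- (2 * DIM(real^'n) + p + s * p))) * strain_on u p x (?R / 2 ^ k))
          + (\<Sum>k. ennreal ((?R / 2 ^ k) powr (- (DIM(real^'n) + p + s * p))) * strain_at u p x (?R / 2 ^ k) x))"
          unfolding n(2)[symmetric]
        proof (rule C2(2)[OF _ uR])
          show "0 < ?R" using d by simp
          fix v show "ennreal (norm (kgrad u x ?R v - A v) powr p) \<le> ennreal (C1 * ?d powr (- e)) * strain_cone \<Omega> K t u p x * ennreal (norm v powr p)"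
            unfolding A_def r0_def using u x by (intro C1(2)) auto
        qed simp
        also have "(\<Sum>k. ennreal ((?R / 2 ^ k) powr (- (2 * DIM(real^'n) + p + s * p))) * strain_on u p x (?R / 2 ^ k)) = S1 x"
        proof -
          have "2 * DIM(real^'n) + p + s * p = DIM(real^'n) + \<alpha>" unfolding \<alpha>_def using n(2) by simp
          then show ?thesis by (simp only: S1_def)
        qed
        also have "(\<Sum>k. ennreal ((?R / 2 ^ k) powr (- (DIM(real^'n) + p + s * p))) * strain_at u p x (?R / 2 ^ k) x)
          = (\<Sum>k. ennreal ((?R / 2 ^ k) powr (- \<alpha>)) * strain_at u p x (?R / 2 ^ k) x)"
          by (simp only: \<alpha>_def n(2))
        also have "ennreal C2 * (ennreal (?R powr ((1 - s) * p)) * (ennreal (C1 * ?d powr (- e)) * strain_cone \<Omega> K t u p x) + S1 x + (\<Sum>k. ennreal ((?R / 2 ^ k) powr (- \<alpha>)) * strain_at u p x (?R / 2 ^ k) x))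
          \<le> ennreal C2 * (ennreal (?R powr ((1 - s) * p)) * (ennreal (C1 * ?d powr (- e)) * strain_cone \<Omega> K t u p x) + S1 x + ennreal C3 * strain_kern u p \<alpha> (2/5 * ?d) x)"
        proof (intro mult_left_mono add_left_mono)
          have "(\<Sum>k. ennreal ((?R / 2 ^ k) powr (- \<alpha>)) * strain_at u p x (?R / 2 ^ k) x) \<le> ennreal C3 * strain_kern u p \<alpha> ?R x"
            by (rule C3(2)) simp
          also have "\<dots> \<le> ennreal C3 * strain_kern u p \<alpha> (2/5 * ?d) x"
            using d by (intro mult_left_mono strain_kern_mono) auto
          finally show "(\<Sum>k. ennreal ((?R / 2 ^ k) powr (- \<alpha>)) * strain_at u p x (?R / 2 ^ k) x) \<le> ennreal C3 * strain_kern u p \<alpha> (2/5 * ?d) x" .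
        qed simp
        finally show "(\<integral>\<^sup>+y\<in>ball x ?R. ennreal (?g y) \<partial>lborel) \<le> ennreal C2 * (ennreal (?R powr ((1 - s) * p)) * (ennreal (C1 * ?d powr (- e)) * strain_cone \<Omega> K t u p x)
          + S1 x + ennreal C3 * strain_kern u p \<alpha> (2/5 * ?d) x)" .
      qed simp
      also have "\<dots> = ennreal B * (ennreal (C1 * (?R powr ((1 - s) * p) * ?d powr (- e) * ?d powr a)) * strain_cone \<Omega> K t u p x
          + ennreal (?d powr a) * S1 x + ennreal C3 * (ennreal (?d powr a) * strain_kern u p \<alpha> (2/5 * ?d) x))"
        using Ca C1 C2 unfolding B_def by (simp add: ennreal_mult distrib_left mult_ac)
      also have "\<dots> \<le> ennreal B * (ennreal (C1 * ?d powr q) * strain_cone \<Omega> K t u p x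
          + ennreal (?d powr a) * S1 x + ennreal C3 * (ennreal (?d powr a) * strain_kern u p \<alpha> (2/5 * ?d) x))"
      proof (intro mult_left_mono add_right_mono mult_right_mono ennreal_leI)
        have "?R powr ((1 - s) * p) \<le> ?d powr ((1 - s) * p)"
          using d s p by (intro powr_mono2) auto
        then have "?R powr ((1 - s) * p) * (?d powr (- e) * ?d powr a) \<le> ?d powr ((1 - s) * p) * (?d powr (- e) * ?d powr a)"
          by (rule mult_right_mono) simp
        also have "\<dots> = ?d powr q" unfolding q_def powr_add[symmetric] by (simp add: algebra_simps)
        finally show "?R powr ((1 - s) * p) * ?d powr (- e) * ?d powr a \<le> ?d powr q" by (simp only: mult.assoc)
      qed (use C1 in auto)
      also have "\<dots> = ennreal B * (ennreal C1 * f1 x + f2 x + ennreal C3 * f3 x)"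
        using x C1 by (simp add: f1_def f2_def f3_def ennreal_mult mult.assoc)
      finally show ?thesis .
    qed
    have "W_int s p \<tau>1 a \<Omega> (\<lambda>x. u x - A x) \<le> (\<integral>\<^sup>+x. ennreal B * (ennreal C1 * f1 x + f2 x + ennreal C3 * f3 x) \<partial>lborel)"
      unfolding W_int_def nn_integral_completion
    proof (rule nn_integral_mono)
      fix x
      show "(\<integral>\<^sup>+y\<in>ball x (\<tau>1 * bdist \<Omega> x). ennreal (norm ((u y - A y) - (u x - A x)) powr p / norm (y - x) powr (real CARD('n) + s * p) * dmin \<Omega> x y powr a) \<partial>lborel) * indicator \<Omega> x
        \<le> ennreal B * (ennreal C1 * f1 x + f2 x + ennreal C3 * f3 x)"
      proof (cases "x \<in> \<Omega>")
        case True
        then show ?thesis using pt[OF True] by (simp only: indicator_simps mult_1_right n_def)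
      qed simp
    qed
    also have "\<dots> = ennreal B * (ennreal C1 * (\<integral>\<^sup>+x. f1 x \<partial>lborel) + (\<integral>\<^sup>+x. f2 x \<partial>lborel) + ennreal C3 * (\<integral>\<^sup>+x. f3 x \<partial>lborel))"
      by (simp add: nn_integral_cmult nn_integral_add)
    also have "\<dots> \<le> ennreal B * (ennreal C1 * (ennreal C4 * ?Y) + ennreal C5 * ?Y + ennreal C3 * ?Y)"
    proof (intro mult_left_mono add_mono)
      have "(\<integral>\<^sup>+x. f1 x \<partial>lborel) \<le> ennreal C4 * (\<integral>\<^sup>+y\<in>\<Omega>. ennreal (bdist \<Omega> y powr (t + DIM(real^'n) + q)) * strain_at u p y (2/5 * bdist \<Omega> y) y \<partial>lborel)"
        unfolding f1_def by (rule C4(2)) simp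
      also have "\<dots> \<le> ennreal C4 * ?Y"
      proof (intro mult_left_mono nn_integral_mono)
        fix y
        show "ennreal (bdist \<Omega> y powr (t + DIM(real^'n) + q)) * strain_at u p y (2/5 * bdist \<Omega> y) y * indicator \<Omega> y
          \<le> ennreal (bdist \<Omega> y powr a) * strain_kern u p \<alpha> (2/5 * bdist \<Omega> y) y * indicator \<Omega> y"
        proof (cases "y \<in> \<Omega>")
          case True
          let ?d = "bdist \<Omega> y"
          have d: "0 < ?d" by (rule bdist_pos[OF op True])
          \<comment> \<open>Since \<delta>^(-\<alpha>) is below (2/5 \<delta>)^(-\<alpha>), the
            strain on the ball of radius 2/5 \<delta> is dominated by its version with the singular
            weight.\<close>
          have "?d powr (t + DIM(real^'n) + q) = ?d powr a * ?d powr (- \<alpha>)" unfolding tq by (simp flip: powr_add)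
          also have "\<dots> \<le> ?d powr a * (2/5 * ?d) powr (- \<alpha>)"
            using d \<alpha> by (intro mult_left_mono powr_mono2') auto
          finally have "ennreal (?d powr (t + DIM(real^'n) + q)) \<le> ennreal (?d powr a) * ennreal ((2/5 * ?d) powr (- \<alpha>))"
            by (subst ennreal_mult[symmetric]) (auto intro: ennreal_leI)
          then have "ennreal (?d powr (t + DIM(real^'n) + q)) * strain_at u p y (2/5 * ?d) y
            \<le> ennreal (?d powr a) * ennreal ((2/5 * ?d) powr (- \<alpha>)) * strain_at u p y (2/5 * ?d) y"
            by (rule mult_right_mono) simp
          also have "\<dots> \<le> ennreal (?d powr a) * strain_kern u p \<alpha> (2/5 * ?d) y"
            unfolding mult.assoc using d \<alpha> by (intro mult_left_mono strain_at_le_strain_kern) auto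
          finally show ?thesis by (rule mult_right_mono) simp
        qed simp
      qed simp
      finally show "(\<integral>\<^sup>+x. f1 x \<partial>lborel) \<le> ennreal C4 * ?Y" .
      show "(\<integral>\<^sup>+x. f2 x \<partial>lborel) \<le> ennreal C5 * ?Y"
        unfolding f2_def S1_def by (rule C5(2)) simp
      show "(\<integral>\<^sup>+x. f3 x \<partial>lborel) \<le> ?Y" unfolding f3_def by simp
    qed auto
    also have "\<dots> = ennreal (B * (C1 * C4 + C5 + C3)) * ?Y"
      using B C1 C3 C4 C5 by (simp add: ennreal_mult distrib_left distrib_right mult_ac)
    also have "\<dots> \<le> ennreal (B * (C1 * C4 + C5 + C3)) * (ennreal C6 * X_int s p \<tau>2 a \<Omega> u)"
      by (intro mult_left_mono C6(2)) auto
    also have "\<dots> = ennreal (B * (C1 * C4 + C5 + C3) * C6) * X_int s p \<tau>2 a \<Omega> u"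
      using B C1 C3 C4 C5 C6 by (subst ennreal_mult[where b=C6]) (auto simp: mult.assoc)
    finally show "\<exists>r\<in>RM. W_int s p \<tau>1 (p * \<beta>) \<Omega> (\<lambda>x. u x - r x) \<le> ennreal (B * (C1 * C4 + C5 + C3) * C6) * X_int s p \<tau>2 (p * \<beta>) \<Omega> u"
      using RM unfolding a_def by blast
  qed
qed

section \<open>From Borel fields on the whole space to fields in the weighted space\<close>

lemma borel_representative:
  fixes u :: "real^'n \<Rightarrow> real^'n"
  assumes u: "u \<in> borel_measurable (lebesgue_on \<Omega>)" and [measurable]: "\<Omega> \<in> sets borel"
  obtains v where "v \<in> borel_measurable borel" "AE x in lborel. x \<in> \<Omega> \<longrightarrow> u x = v x"
proof -
  define f where "f x = indicator \<Omega> x *\<^sub>R u x" for x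
  have f: "f \<in> borel_measurable lebesgue"
    using u unfolding f_def by (subst (asm) borel_measurable_restrict_space_iff) auto
  \<comment> \<open>Lebesgue functions are replaced by Borel ones coordinate by coordinate, as the
    completion result concerns real-valued functions; the finitely many null sets are joined
    afterwards.\<close>
  have "\<forall>i. \<exists>g\<in>borel_measurable lborel. AE x in lborel. f x $ i = g x"
  proof
    fix i
    have "(\<lambda>x. f x $ i) \<in> borel_measurable lebesgue"
      using f by (intro borel_measurable_continuous_on[OF _ f]) (intro continuous_intros)
    then show "\<exists>g\<in>borel_measurable lborel. AE x in lborel. f x $ i = g x"
      by (rule completion_ex_borel_measurable_real)
  qed
  then obtain g where g: "\<And>i. g i \<in> borel_measurable lborel" "\<And>i. AE x in lborel. f x $ i = g i x" by metis
  define v where "v x = (\<chi> i. g i x)" for x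
  show thesis
  proof (rule that[of v])
    have "(\<lambda>x. v x \<bullet> b) \<in> borel_measurable borel" if "b \<in> Basis" for b
    proof -
      obtain i where "b = axis i 1" using \<open>b \<in> Basis\<close> by (auto simp: Basis_vec_def)
      then show ?thesis using g(1)[of i] by (simp add: v_def inner_axis)
    qed
    then show "v \<in> borel_measurable borel" by (subst borel_measurable_euclidean_space) auto
    have "AE x in lborel. \<forall>i. f x $ i = g i x" using g(2) by (subst AE_all_countable) auto
    then show "AE x in lborel. x \<in> \<Omega> \<longrightarrow> u x = v x"
      by eventually_elim (auto simp: f_def v_def vec_eq_iff)
  qed
qed

text \<open>With \<tau> <= 1 the inner balls stay in \<Omega>, so only the values on \<Omega>
  matter, and these up to null sets. Keeping the integrand a free \<open>F\<close> makes the W- and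
  X-energies two instances.\<close>

lemma nn_integral_interior_cong_AE:
  fixes \<Omega> :: "'a::euclidean_space set"
  assumes \<tau>: "\<tau> \<le> 1" and ae: "AE x in lborel. x \<in> \<Omega> \<longrightarrow> u x = v x"
  shows "(\<integral>\<^sup>+x\<in>\<Omega>. (\<integral>\<^sup>+y\<in>ball x (\<tau> * bdist \<Omega> x). F x y (u x) (u y) \<partial>lborel) \<partial>lborel)
    = (\<integral>\<^sup>+x\<in>\<Omega>. (\<integral>\<^sup>+y\<in>ball x (\<tau> * bdist \<Omega> x). F x y (v x) (v y) \<partial>lborel) \<partial>lborel)"
proof (rule nn_integral_cong_AE)
  show "AE x in lborel. (\<integral>\<^sup>+y\<in>ball x (\<tau> * bdist \<Omega> x). F x y (u x) (u y) \<partial>lborel) * indicator \<Omega> x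
    = (\<integral>\<^sup>+y\<in>ball x (\<tau> * bdist \<Omega> x). F x y (v x) (v y) \<partial>lborel) * indicator \<Omega> x"
    using ae
  proof eventually_elim
    case (elim x)
    show ?case
    proof (cases "x \<in> \<Omega>")
      case True
      have "\<tau> * bdist \<Omega> x \<le> 1 * bdist \<Omega> x" using \<tau> bdist_nonneg by (intro mult_right_mono) auto
      then have "ball x (\<tau> * bdist \<Omega> x) \<subseteq> ball x (bdist \<Omega> x)" by (intro subset_ball) simp
      then have sub: "ball x (\<tau> * bdist \<Omega> x) \<subseteq> \<Omega>" using ball_bdist_subset[OF True] by (rule subset_trans)
      have "(\<integral>\<^sup>+y\<in>ball x (\<tau> * bdist \<Omega> x). F x y (u x) (u y) \<partial>lborel) = (\<integral>\<^sup>+y\<in>ball x (\<tau> * bdist \<Omega> x). F x y (v x) (v y) \<partial>lborel)"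
      proof (rule nn_integral_cong_AE)
        show "AE y in lborel. F x y (u x) (u y) * indicator (ball x (\<tau> * bdist \<Omega> x)) y = F x y (v x) (v y) * indicator (ball x (\<tau> * bdist \<Omega> x)) y"
          using ae
        proof eventually_elim
          case yy: (elim y)
          show ?case
          proof (cases "y \<in> ball x (\<tau> * bdist \<Omega> x)")
            case True
            then have "y \<in> \<Omega>" using sub by blast
            then show ?thesis using yy elim \<open>x \<in> \<Omega>\<close> by simp
          next
            case False
            then show ?thesis by simp
          qed
        qed
      qed
      then show ?thesis by simp
    qed simp
  qed
qed

lemma W_int_cong_AE:
  fixes \<Omega> :: "(real^'n) set"
  assumes "\<tau> \<le> 1" "AE x in lborel. x \<in> \<Omega> \<longrightarrow> u x = v x"
  shows "W_int s p \<tau> a \<Omega> u = W_int s p \<tau> a \<Omega> v"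
  unfolding W_int_def nn_integral_completion
  by (rule nn_integral_interior_cong_AE[OF assms, of "\<lambda>x y ux uy. ennreal (norm (uy - ux) powr p / norm (y - x) powr (real CARD('n) + s * p) * dmin \<Omega> x y powr a)"])

lemma X_int_cong_AE:
  fixes \<Omega> :: "(real^'n) set"
  assumes "\<tau> \<le> 1" "AE x in lborel. x \<in> \<Omega> \<longrightarrow> u x = v x"
  shows "X_int s p \<tau> a \<Omega> u = X_int s p \<tau> a \<Omega> v"
  unfolding X_int_def nn_integral_completion
  by (rule nn_integral_interior_cong_AE[OF assms, of "\<lambda>x y ux uy. ennreal (\<bar>(uy - ux) \<bullet> (y - x)\<bar> powr p / norm (y - x) powr (real CARD('n) + s * p + p) * dmin \<Omega> x y powr a)"])

lemma AE_obtain_in_ball: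
  fixes c :: "'a::euclidean_space"
  assumes ae: "AE x in lborel. P x" and r: "0 < r"
  obtains x where "x \<in> ball c r" "P x"
proof -
  obtain N where N: "{x \<in> space lborel. \<not> P x} \<subseteq> N" "emeasure lborel N = 0" "N \<in> sets lborel"
    using AE_E[OF ae] by blast
  have "\<not> ball c r \<subseteq> N"
  proof
    assume "ball c r \<subseteq> N"
    then have "emeasure lborel (ball c r) = 0" using N(2,3) emeasure_mono by (metis le_zero_eq)
    then show False using content_ball_pos[OF r, of c] by (simp add: measure_def)
  qed
  then obtain x where "x \<in> ball c r" "x \<notin> N" by blast
  then show thesis using N(1) that[of x] by force
qed

text \<open>Finite energy makes the inner integral finite for almost every x, hence for some x close
  to c. Around it the denominator is bounded above and the weight is bounded below, so u - u(x) is
  p-integrable on the ball around c and therefore integrable.\<close>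

lemma W_int_finite_locally_integrable:
  fixes \<Omega> :: "(real^'n) set" and s p \<tau> a :: real
  assumes op: "open \<Omega>" "bounded \<Omega>" and p: "1 < p" and s: "0 < s" and \<tau>: "2/5 \<le> \<tau>" "\<tau> < 1"
    and um [measurable]: "u \<in> borel_measurable borel" and fin: "W_int s p \<tau> a \<Omega> u \<noteq> \<infinity>" and c: "c \<in> \<Omega>"
  shows "set_integrable lborel (ball c (bdist \<Omega> c / 10)) u"
proof -
  have [measurable]: "\<Omega> \<in> sets borel" using op by simp
  let ?g = "\<lambda>x y. norm (u y - u x) powr p / norm (y - x) powr (real CARD('n) + s * p) * dmin \<Omega> x y powr a"
  let ?I = "\<lambda>x. (\<integral>\<^sup>+y\<in>ball x (\<tau> * bdist \<Omega> x). ennreal (?g x y) \<partial>lborel)"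
  have "AE x in lborel. ?I x * indicator \<Omega> x \<noteq> \<infinity>"
  proof (rule nn_integral_PInf_AE)
    show "(\<integral>\<^sup>+x. ?I x * indicator \<Omega> x \<partial>lborel) \<noteq> \<infinity>"
      using fin unfolding W_int_def nn_integral_completion .
  qed measurable
  moreover have d: "0 < bdist \<Omega> c" by (rule bdist_pos[OF op c])
  ultimately obtain x where x: "x \<in> ball c (bdist \<Omega> c / 10)" "?I x * indicator \<Omega> x \<noteq> \<infinity>"
    using AE_obtain_in_ball[of _ "bdist \<Omega> c / 10" c] by force
  note cmp = bdist_comparable[OF x(1)]
  have "x \<in> ball c (bdist \<Omega> c)" using x(1) d by simp
  then have xO: "x \<in> \<Omega>" using ball_bdist_subset[OF c] by blast
  have dx: "0 < bdist \<Omega> x" by (rule bdist_pos[OF op xO])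
  have Ifin: "?I x < \<infinity>" using x(2) xO by (simp add: less_top)
  \<comment> \<open>Here \<tau> >= 2/5 enters: points of the ball are within \<delta>(c)/5 of x, and
    \<delta>(c) <= 10/9 \<delta>(x).\<close>
  have sub: "ball c (bdist \<Omega> c / 10) \<subseteq> ball x (\<tau> * bdist \<Omega> x)"
  proof
    fix y assume y: "y \<in> ball c (bdist \<Omega> c / 10)"
    have "dist x y < bdist \<Omega> c / 5" using y x(1) dist_triangle[of x y c] by (simp add: dist_commute)
    also have "\<dots> \<le> 2/5 * bdist \<Omega> x" using cmp d by simp
    also have "\<dots> \<le> \<tau> * bdist \<Omega> x" using \<tau> dx by (intro mult_right_mono) auto
    finally show "y \<in> ball x (\<tau> * bdist \<Omega> x)" by simp
  qed
  \<comment> \<open>As \<tau> < 1, \<open>dmin\<close> lies between two positive multiples of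
    \<delta>(x); the sum of the end values bounds its power -a for either sign of a.\<close>
  define \<kappa> where "\<kappa> = ((1 - \<tau>) * bdist \<Omega> x) powr (- a) + bdist \<Omega> x powr (- a)"
  define D where "D = bdist \<Omega> x powr (real CARD('n) + s * p) * \<kappa>"
  have D: "0 \<le> D" by (simp add: D_def \<kappa>_def)
  have up: "norm (u y) \<le> norm (u x) + 1 + D * ?g x y" if y: "y \<in> ball c (bdist \<Omega> c / 10)" for y
  proof -
    have yx: "y \<in> ball x (\<tau> * bdist \<Omega> x)" using y sub by blast
    let ?a = "norm (u y - u x)"
    have "?a \<le> 1 + ?a powr p"
    proof (cases "?a \<le> 1")
      case False
      then have "?a powr 1 \<le> ?a powr p" using p by (intro powr_mono) auto
      then show ?thesis using False by simp
    qed (simp add: add_increasing2)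
    moreover have "?a powr p \<le> D * ?g x y"
    proof (cases "y = x")
      case False
      have yn: "0 < norm (y - x)" using False by simp
      have dm: "(1 - \<tau>) * bdist \<Omega> x \<le> dmin \<Omega> x y" "dmin \<Omega> x y \<le> bdist \<Omega> x" using dmin_bounds[OF yx] .
      have d1: "0 < (1 - \<tau>) * bdist \<Omega> x" using \<tau> dx by simp
      have dm0: "0 < dmin \<Omega> x y" using d1 dm by linarith
      have "\<tau> * bdist \<Omega> x \<le> 1 * bdist \<Omega> x" using \<tau> dx by (intro mult_right_mono) auto
      then have "norm (y - x) \<le> bdist \<Omega> x" using yx by (simp add: dist_norm norm_minus_commute)
      moreover have "0 \<le> real CARD('n) + s * p" using s p by (simp add: add_nonneg_nonneg)
      ultimately have "norm (y - x) powr (real CARD('n) + s * p) \<le> bdist \<Omega> x powr (real CARD('n) + s * p)"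
        by (intro powr_mono2) auto
      moreover have "dmin \<Omega> x y powr (- a) \<le> \<kappa>" unfolding \<kappa>_def by (rule powr_le_endpoints[OF d1 dm])
      ultimately have le: "norm (y - x) powr (real CARD('n) + s * p) * dmin \<Omega> x y powr (- a) \<le> D"
        unfolding D_def by (intro mult_mono) auto
      have "dmin \<Omega> x y powr (- a) * dmin \<Omega> x y powr a = 1" using dm0 by (simp flip: powr_add)
      then have "?a powr p = (norm (y - x) powr (real CARD('n) + s * p) * dmin \<Omega> x y powr (- a)) * ?g x y"
        using yn by (simp add: field_simps)
      also have "\<dots> \<le> D * ?g x y" using le by (rule mult_right_mono) simp
      finally show ?thesis .
    qed (use D in simp)
    ultimately have "?a \<le> 1 + D * ?g x y" by linarith
    moreover have "norm (u y) \<le> norm (u x) + ?a" using norm_triangle_sub[of "u y" "u x"] by simp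
    ultimately show ?thesis by linarith
  qed
  let ?B = "ball c (bdist \<Omega> c / 10)"
  show ?thesis unfolding set_integrable_def
  proof (rule integrableI_bounded)
    have "(\<integral>\<^sup>+y. ennreal (norm (indicat_real ?B y *\<^sub>R u y)) \<partial>lborel)
      \<le> (\<integral>\<^sup>+y. ennreal (norm (u x) + 1) * indicator ?B y + ennreal D * (ennreal (?g x y) * indicator (ball x (\<tau> * bdist \<Omega> x)) y) \<partial>lborel)"
    proof (rule nn_integral_mono)
      fix y
      show "ennreal (norm (indicat_real ?B y *\<^sub>R u y)) \<le> ennreal (norm (u x) + 1) * indicator ?B y + ennreal D * (ennreal (?g x y) * indicator (ball x (\<tau> * bdist \<Omega> x)) y)"
      proof (cases "y \<in> ?B")
        case True
        then have y2: "y \<in> ball x (\<tau> * bdist \<Omega> x)" using sub by blast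
        have "ennreal (norm (u y)) \<le> ennreal (norm (u x) + 1 + D * ?g x y)" by (rule ennreal_leI[OF up[OF True]])
        also have "\<dots> = ennreal (norm (u x) + 1) + ennreal D * ennreal (?g x y)"
          using D by (subst ennreal_plus) (auto simp flip: ennreal_mult)
        finally show ?thesis using True y2 by (simp only: indicator_simps) simp
      next
        case False
        then show ?thesis by simp
      qed
    qed
    also have "\<dots> = ennreal (norm (u x) + 1) * emeasure lborel ?B + ennreal D * ?I x"
      by (subst nn_integral_add) (simp_all add: nn_integral_cmult nn_integral_cmult_indicator)
    also have "\<dots> < \<infinity>"
      using Ifin emeasure_lborel_ball_finite[of c "bdist \<Omega> c / 10"]
      by (simp add: ennreal_mult_less_top)
    finally show "(\<integral>\<^sup>+y. ennreal (norm (indicat_real ?B y *\<^sub>R u y)) \<partial>lborel) < \<infinity>" .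
  qed measurable
qed

text \<open>An infinite right side is trivial because C > 0; otherwise both integrals are finite and
  \<open>enn2real\<close> loses nothing.\<close>

lemma enn_root_le:
  assumes p: "0 < p" and C: "0 < C" and le: "I \<le> ennreal C * X"
  shows "enn_root p I \<le> ennreal (C powr (1 / p)) * enn_root p X"
proof (cases "X = \<infinity>")
  case True
  then show ?thesis using C by (simp add: enn_root_def ennreal_mult_top)
next
  case False
  then have X: "X = ennreal (enn2real X)" by (simp add: less_top)
  have I: "I \<le> ennreal (C * enn2real X)" using le C by (subst (asm) X) (simp add: ennreal_mult)
  then have "I \<noteq> \<infinity>" by (metis ennreal_neq_top infinity_ennreal_def top_unique)
  moreover have "enn2real I \<le> C * enn2real X"
    using enn2real_mono[OF I] C by simp
  then have "enn2real I powr (1 / p) \<le> (C * enn2real X) powr (1 / p)"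
    using p by (intro powr_mono2) auto
  ultimately show ?thesis using False
    by (simp add: enn_root_def ennreal_leI powr_mult flip: ennreal_mult)
qed

theorem theorem5p6:
  fixes \<Omega> :: "(real^'n) set" and p s \<tau>1 \<tau>2 \<beta> :: real
  assumes "john_domain \<Omega>"
    and "1 < p" and "0 < s" and "s < 1"
    and "0 < \<tau>1" and "\<tau>1 < 1 / (36 * sqrt (real CARD('n)))"
    and "3/5 \<le> \<tau>2" and "\<tau>2 < 1"
    and "\<beta> + 1 - s > - (real CARD('n) - assouad_dim (frontier \<Omega>)) / p"
  shows "\<exists>C. \<forall>u \<in> W_space s p \<tau>2 (p * \<beta>) \<Omega>.
           (INF r \<in> RM. W_seminorm s p \<tau>1 (p * \<beta>) \<Omega> (\<lambda>x. u x - r x))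
             \<le> ennreal C * X_seminorm s p \<tau>2 (p * \<beta>) \<Omega> u"
proof -
  have op: "open \<Omega>" "bounded \<Omega>" using assms(1) by (auto simp: john_domain_def)
  have [measurable]: "\<Omega> \<in> sets borel" using op by simp
  \<comment> \<open>The dimension is at least 1, so \<tau>1 is below 1/36, inside the radius 1/20 of
    the balls that carry the averaged gradients.\<close>
  have "1 \<le> sqrt (real CARD('n))" by (simp add: Suc_le_eq)
  then have "1 / (36 * sqrt (real CARD('n))) \<le> 1 / 36" by (intro divide_left_mono) auto
  then have \<tau>1: "\<tau>1 \<le> 1 / 20" using assms(6) by linarith
  have \<tau>2: "2/5 \<le> \<tau>2" "\<tau>2 \<le> 1" using assms(7,8) by auto
  obtain C where C: "0 < C" "\<And>u. u \<in> borel_measurable borel \<Longrightarrow>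
     (\<And>x. x \<in> \<Omega> \<Longrightarrow> set_integrable lborel (ball x (bdist \<Omega> x / 10)) u) \<Longrightarrow>
     \<exists>r\<in>RM. W_int s p \<tau>1 (p * \<beta>) \<Omega> (\<lambda>x. u x - r x) \<le> ennreal C * X_int s p \<tau>2 (p * \<beta>) \<Omega> u"
    using weighted_korn_borel[OF assms(1-4) \<tau>1 \<tau>2(1) assms(9)] by blast
  show ?thesis
  proof (intro exI[of _ "C powr (1 / p)"] ballI)
    fix u assume u: "u \<in> W_space s p \<tau>2 (p * \<beta>) \<Omega>"
    then have um: "u \<in> borel_measurable (lebesgue_on \<Omega>)" and fin: "W_int s p \<tau>2 (p * \<beta>) \<Omega> u \<noteq> \<infinity>"
      by (auto simp: W_space_def W_seminorm_def enn_root_def split: if_splits)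
    obtain v where v: "v \<in> borel_measurable borel" and ae: "AE x in lborel. x \<in> \<Omega> \<longrightarrow> u x = v x"
      using borel_representative[OF um] by auto
    have "W_int s p \<tau>2 (p * \<beta>) \<Omega> v \<noteq> \<infinity>" using fin W_int_cong_AE[OF \<tau>2(2) ae] by metis
    then obtain r where r: "r \<in> RM" "W_int s p \<tau>1 (p * \<beta>) \<Omega> (\<lambda>x. v x - r x) \<le> ennreal C * X_int s p \<tau>2 (p * \<beta>) \<Omega> v"
      using C(2)[OF v] W_int_finite_locally_integrable[OF op assms(2,3) \<tau>2(1) assms(8) v] by metis
    \<comment> \<open>Subtracting the same r preserves equality almost everywhere, so the rigid
      motion found for the Borel representative also serves u.\<close>
    have "AE x in lborel. x \<in> \<Omega> \<longrightarrow> u x - r x = v x - r x" using ae by eventually_elim simp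
    then have "W_int s p \<tau>1 (p * \<beta>) \<Omega> (\<lambda>x. u x - r x) \<le> ennreal C * X_int s p \<tau>2 (p * \<beta>) \<Omega> u"
      using r(2) W_int_cong_AE[of \<tau>1 \<Omega> "\<lambda>x. u x - r x" "\<lambda>x. v x - r x"] X_int_cong_AE[OF \<tau>2(2) ae] \<tau>1 by auto
    then have "W_seminorm s p \<tau>1 (p * \<beta>) \<Omega> (\<lambda>x. u x - r x) \<le> ennreal (C powr (1 / p)) * X_seminorm s p \<tau>2 (p * \<beta>) \<Omega> u"
      unfolding W_seminorm_def X_seminorm_def using C(1) assms(2) by (intro enn_root_le) auto
    then show "(INF r \<in> RM. W_seminorm s p \<tau>1 (p * \<beta>) \<Omega> (\<lambda>x. u x - r x))
        \<le> ennreal (C powr (1 / p)) * X_seminorm s p \<tau>2 (p * \<beta>) \<Omega> u"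
      by (rule INF_lower2[OF r(1)])
  qed
qed

end
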